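(* For all $n>6$, every potential signature $[1;n_1,\ldots,n_r]$ for the alternating group $A_n$ is an actual signature for $A_n$. For $n=5$, the only potential signature of the form $[1;n_1,\ldots,n_r]$ for $A_5$ that is not an actual signature for $A_5$ is $[1;2]$. For $n=6$, the only potential signature of the form $[1;n_1,\ldots,n_r]$ for $A_6$ that is not an actual signature for $A_6$ is $[1;3]$.
   Context: For a finite group $G$, $\mathcal{O}(G)=\{\mathrm{ord}(g): g\in G\}\setminus\{1\}$ is the set of orders of non-trivial elements of $G$, and $[a,b]=a^{-1}b^{-1}ab$ for $a,b\in G$. A tuple $[h;n_1,\ldots,n_r]$ consists of an integer $h\ge 0$ (the quotient genus) and integers $n_1,\ldots,n_r$ (the periods), $r\ge 0$. The tuple is a potential signature for $G$ if it satisfies the arithmetic conditions: all $n_j\in\mathcal{O}(G)$ and the number $\sigma=1+|G|(h-1)+\frac{|G|}{2}\sum_{j=1}^r\left(1-\frac{1}{n_j}\right)$ is an integer with $\sigma\ge 2$. (For $h=1$ this forces $r\ge 1$.) The tuple is an actual signature for $G$ if, in addition, there is a generating vector: elements $a_1,b_1,\ldots,a_h,b_h,c_1,\ldots,c_r\in G$ such that (a) they generate $G$; (b) $c_j$ has order $n_j$ for $1\le j\le r$; (c) $\prod_{i=1}^h[a_i,b_i]\prod_{j=1}^r c_j=1_G$. (By Riemann's Existence Theorem this is equivalent to $G$ acting on a compact Riemann surface $S$ of genus $\sigma\ge2$ with $S/G$ of genus $h$ and $S\to S/G$ branched over $r$ points with orders $n_1,\ldots,n_r$.) *)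

theory Defs
  imports "HOL-Algebra.Algebra"
begin

definition nontrivial_orders :: "('a, 'b) monoid_scheme \<Rightarrow> nat set"
  where "nontrivial_orders G = group.ord G ` carrier G - {1}"

definition group_commutator :: "('a, 'b) monoid_scheme \<Rightarrow> 'a \<Rightarrow> 'a \<Rightarrow> 'a"
  where "group_commutator G a b = inv\<^bsub>G\<^esub> a \<otimes>\<^bsub>G\<^esub> inv\<^bsub>G\<^esub> b \<otimes>\<^bsub>G\<^esub> a \<otimes>\<^bsub>G\<^esub> b"

text \<open>A tuple $[h; n_1, \ldots, n_r]$ is given by the quotient genus \<open>h\<close> and the list
  \<open>ns\<close> of periods, so that $r$ is the length of \<open>ns\<close>. The definitions below are
  meant for a finite group \<open>G\<close>.\<close>

text \<open>The genus $\sigma$ prescribed by the Riemann--Hurwitz formula.\<close>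

definition signature_genus :: "('a, 'b) monoid_scheme \<Rightarrow> nat \<Rightarrow> nat list \<Rightarrow> real"
  where "signature_genus G h ns =
    1 + real (order G) * (real h - 1) + real (order G) / 2 * (\<Sum>n\<leftarrow>ns. 1 - 1 / real n)"

definition potential_signature :: "('a, 'b) monoid_scheme \<Rightarrow> nat \<Rightarrow> nat list \<Rightarrow> bool"
  where "potential_signature G h ns \<longleftrightarrow>
    set ns \<subseteq> nontrivial_orders G \<and>
    signature_genus G h ns \<in> \<int> \<and> signature_genus G h ns \<ge> 2"

definition generating_vector ::
    "('a, 'b) monoid_scheme \<Rightarrow> nat \<Rightarrow> nat list \<Rightarrow> 'a list \<Rightarrow> 'a list \<Rightarrow> 'a list \<Rightarrow> bool"
  where "generating_vector G h ns as bs cs \<longleftrightarrow>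
    length as = h \<and> length bs = h \<and> length cs = length ns \<and>
    set as \<union> set bs \<union> set cs \<subseteq> carrier G \<and>
    generate G (set as \<union> set bs \<union> set cs) = carrier G \<and>
    (\<forall>j < length ns. group.ord G (cs ! j) = ns ! j) \<and>
    foldr (\<otimes>\<^bsub>G\<^esub>) (map2 (group_commutator G) as bs @ cs) \<one>\<^bsub>G\<^esub> = \<one>\<^bsub>G\<^esub>"

definition actual_signature :: "('a, 'b) monoid_scheme \<Rightarrow> nat \<Rightarrow> nat list \<Rightarrow> bool"
  where "actual_signature G h ns \<longleftrightarrow>
    potential_signature G h ns \<and> (\<exists>as bs cs. generating_vector G h ns as bs cs)"

end

theory Submission
  imports Defs
begin

text \<open>A tuple $[1; n_1, \ldots, n_r]$ is actual if and only if some product of elements of orders $n_1, \ldots, n_r$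
  is the commutator of a pair that generates $A_n$. Every even permutation that moves at least five points is such
  a commutator when $n \ge 9$ or $n = 7$. Write it as $a^{-1} a'$, where $a$ and its conjugate $a'$ are products of
  two transpositions and a long cycle of odd length. Suitable powers of $a$ and $a'$ are double transpositions that
  together produce a 3-cycle, and from it one links all points by 3-cycles. Inserting new points into both
  long cycles at a common point lengthens a cycle of $a^{-1} a'$ by two, or adds two fixed points or two
  transpositions; this gives an induction that starts from explicit tables in degrees 11, 12 and 13. The smaller
  degrees are treated by explicit generating pairs.

  For $r \ge 2$ the product of two nontrivial elements can be made to move at least five points by replacing one
  of them by a conjugate, as an average over all conjugates shows. For $r = 1$ an element of the prescribed order
  with large enough support has to be found, which fails only for $[1; 2]$ in $A_5$ and $[1; 3]$ in $A_6$: there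
  any two elements with a commutator of that order preserve a common family of subsets.\<close>

section \<open>Linking points by 3-cycles\<close>

text \<open>The shape of \<open>a\<close> makes generation a matter of positions: the odd power |M|
  of \<open>a\<close> isolates its double transposition, and once a 3-cycle is available, linking
  points replaces any argument about primitivity. The remaining freedom, the relative position of
  the two long cycles, has to produce every cycle type. The obstacle is that prolonging a cycle of
  a^{-1} a' needs a suitable point in it, so the induction must carry along which cycles have one.
  Hence the tables must offer not just every type but every choice of such cycles that the induction
  may ask for. This number stays small because cycles are shortened to fixed points or
  transpositions, which are removed in pairs. Removing points lowers the degree by 2 or 4: two
  consecutive starting degrees catch both parities, and in degrees 13 and 14, where a loss of 4
  would go below them, only the type 2^6 1 cannot be reduced by shortening a cycle instead.\<close>

text \<open>Subgroups of the symmetric group on a type; closed sets are used instead of \<^const>\<open>generate\<close> so that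
  no carrier has to be tracked.\<close>

definition perm_closed :: "('a \<Rightarrow> 'a) set \<Rightarrow> bool"
  where "perm_closed H \<longleftrightarrow> id \<in> H \<and> (\<forall>p\<in>H. bij p \<and> inv' p \<in> H) \<and> (\<forall>p\<in>H. \<forall>q\<in>H. p \<circ> q \<in> H)"

lemma perm_closedD:
  assumes "perm_closed H"
  shows "id \<in> H" "p \<in> H \<Longrightarrow> bij p" "p \<in> H \<Longrightarrow> inv' p \<in> H" "p \<in> H \<Longrightarrow> q \<in> H \<Longrightarrow> p \<circ> q \<in> H"
  using assms by (auto simp: perm_closed_def)

lemma perm_closed_funpow: "perm_closed H \<Longrightarrow> p \<in> H \<Longrightarrow> p ^^ k \<in> H"
  by (induction k) (auto simp: perm_closedD)

definition three_in :: "('a \<Rightarrow> 'a) set \<Rightarrow> 'a \<Rightarrow> 'a \<Rightarrow> 'a \<Rightarrow> bool"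
  where "three_in H i j k \<longleftrightarrow> distinct [i, j, k] \<and> cycle_of_list [i, j, k] \<in> H"

lemma three_in_rotate: "three_in H i j k \<Longrightarrow> three_in H j k i"
  using cycle_of_list_rotate_independent[of "[i, j, k]" 1] by (auto simp: three_in_def)

lemma three_in_conj:
  assumes "perm_closed H" "g \<in> H" "three_in H i j k"
  shows "three_in H (g i) (g j) (g k)"
proof -
  have "bij g" using assms perm_closedD by blast
  have "g \<circ> cycle_of_list [i, j, k] \<circ> inv' g \<in> H"
    using assms by (auto simp: perm_closedD three_in_def)
  then show ?thesis
    using assms(3) conjugation_of_cycle[OF _ \<open>bij g\<close>, of "[i, j, k]"] bij_is_inj[OF \<open>bij g\<close>]
    by (auto simp: three_in_def inj_eq)
qed

lemma three_in_reverse: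
  assumes "perm_closed H" "three_in H i j k"
  shows "three_in H k j i"
proof -
  have d: "distinct [i, j, k]" using assms by (simp add: three_in_def)
  have "cycle_of_list [k, j, i] \<circ> cycle_of_list [i, j, k] = id"
    using d by (auto simp: fun_eq_iff transpose_def)
  then have "inv' (cycle_of_list [i, j, k]) = cycle_of_list [k, j, i]"
    using cycle_permutes[of "[i, j, k]"] permutes_inv_o(1) by (metis comp_assoc comp_id id_comp)
  then show ?thesis using assms d perm_closedD(3)[OF assms(1)] by (force simp: three_in_def)
qed

lemma three_cycle_apply:
  assumes "distinct [i, j, k]"
  shows "cycle_of_list [i, j, k] i = j" "cycle_of_list [i, j, k] j = k" "cycle_of_list [i, j, k] k = i"
    "x \<notin> {i, j, k} \<Longrightarrow> cycle_of_list [i, j, k] x = x"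
  using assms by (auto simp: transpose_def)

definition linked :: "('a \<Rightarrow> 'a) set \<Rightarrow> 'a \<Rightarrow> 'a \<Rightarrow> bool"
  where "linked H i j \<longleftrightarrow> i = j \<or> (\<exists>k. three_in H i j k)"

lemma linked_sym: "perm_closed H \<Longrightarrow> linked H i j \<Longrightarrow> linked H j i"
  using three_in_rotate[OF three_in_reverse, of H i j] by (auto simp: linked_def)

lemma linked_conj: "perm_closed H \<Longrightarrow> g \<in> H \<Longrightarrow> linked H i j \<Longrightarrow> linked H (g i) (g j)"
  using three_in_conj[of H g i j] by (auto simp: linked_def)

text \<open>Conjugating (i j p) by (j l q) moves j to l and leaves i alone if q is not i. If q = i,
  the second 3-cycle already contains both i and l.\<close>

lemma linked_trans:
  assumes H: "perm_closed H" and "linked H i j" "linked H j l"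
  shows "linked H i l"
proof (cases "i = j \<or> j = l \<or> i = l")
  case False
  then obtain p q where p: "three_in H i j p" and q: "three_in H j l q"
    using assms by (auto simp: linked_def)
  show ?thesis
  proof (cases "q = i")
    case True
    then have "linked H l i" using three_in_rotate[OF q] by (auto simp: linked_def)
    then show ?thesis by (rule linked_sym[OF H])
  next
    case iq: False
    let ?g = "cycle_of_list [j, l, q]"
    have g: "?g \<in> H" and d: "distinct [j, l, q]" using q by (auto simp: three_in_def)
    have "?g i = i" "?g j = l" using three_cycle_apply(1,4)[OF d] False iq by (auto simp del: cycle_of_list.simps)
    then have "three_in H i l (?g p)" using three_in_conj[OF H g p] by (simp del: cycle_of_list.simps)
    then show ?thesis unfolding linked_def by (intro disjI2 exI)
  qed
qed (use assms in \<open>auto simp: linked_def\<close>)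

lemma three_in_conj_three:
  assumes H: "perm_closed H" and t: "three_in H u v w" "three_in H x y z"
  shows "three_in H (cycle_of_list [u, v, w] x) (cycle_of_list [u, v, w] y) (cycle_of_list [u, v, w] z)"
  by (rule three_in_conj[OF H _ t(2)]) (use t(1) in \<open>unfold three_in_def, blast\<close>)

text \<open>\<open>linked\<close> leaves the third point open; conjugation removes this freedom. In
  the generic case (i k q) turns (i j p) into (k j p), and the inverse of that cycle turns (i j p)
  into a 3-cycle on i, j, k. If p = q, one conjugation is enough.\<close>

lemma three_in_of_linked:
  assumes H: "perm_closed H" and "linked H i j" "linked H i k" and d: "distinct [i, j, k]"
  shows "three_in H i j k"
proof -
  obtain p q where p: "three_in H i j p" and q: "three_in H i k q"
    using assms(2-4) by (auto simp: linked_def)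
  have dp: "distinct [i, j, p]" and dq: "distinct [i, k, q]"
    using p q unfolding three_in_def by blast+
  note ikq = three_cycle_apply[OF dq]
  consider "p = k" | "q = j" | "p = q" "p \<noteq> k" | "p \<noteq> k" "q \<noteq> j" "p \<noteq> q" by blast
  then show ?thesis
  proof cases
    case 1 then show ?thesis using p by simp
  next
    case 2 then show ?thesis using three_in_rotate[OF three_in_rotate[OF three_in_reverse[OF H q]]] by simp
  next
    case 3
    have "cycle_of_list [i, k, q] j = j" using d dp 3 by (intro ikq(4)) auto
    then have "three_in H k j i"
      using three_in_conj_three[OF H q p] ikq(1,3) 3(1) by (simp del: cycle_of_list.simps)
    then show ?thesis by (rule three_in_reverse[OF H])
  next
    case 4
    have "cycle_of_list [i, k, q] j = j" "cycle_of_list [i, k, q] p = p"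
      using d dp 4 by (intro ikq(4); auto)+
    then have t: "three_in H k j p"
      using three_in_conj_three[OF H q p] ikq(1) by (simp del: cycle_of_list.simps)
    have t': "three_in H p j k" by (rule three_in_reverse[OF H t])
    have dt: "distinct [p, j, k]" using t' unfolding three_in_def by blast
    have "cycle_of_list [p, j, k] i = i" using d dp by (intro three_cycle_apply(4)[OF dt]) auto
    then have "three_in H k j i"
      using three_in_conj_three[OF H t' three_in_rotate[OF p]] three_cycle_apply(1,2)[OF dt]
      by (simp del: cycle_of_list.simps)
    then show ?thesis by (rule three_in_reverse[OF H])
  qed
qed

lemma alt_group_subset_if_linked:
  assumes H: "perm_closed H" and L: "\<And>i j. i \<in> {1..n} \<Longrightarrow> j \<in> {1..n} \<Longrightarrow> linked H i j"
  shows "carrier (alt_group n) \<subseteq> H"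
proof -
  have 3: "three_cycles n \<subseteq> H"
  proof
    fix p assume "p \<in> three_cycles n"
    then obtain i j k where "p = cycle_of_list [i, j, k]" "distinct [i, j, k]" "{i, j, k} \<subseteq> {1..n}"
      by (auto simp: length_Suc_conv eval_nat_numeral)
    then show "p \<in> H" using three_in_of_linked[OF H L L, of i j k] by (auto simp: three_in_def)
  qed
  have "p \<in> H" if "p \<in> generate (alt_group n) (three_cycles n)" for p
    using that
  proof induction
    case one
    show ?case unfolding alt_group_one by (rule perm_closedD(1)[OF H])
  next
    case (incl h)
    then show ?case using 3 by blast
  next
    case (inv h)
    then have "h \<in> carrier (alt_group n)" using three_cycles_incl by blast
    then have "inv\<^bsub>alt_group n\<^esub> h = inv' h" by (rule alt_group_inv_equality)
    then show ?case using inv 3 perm_closedD(3)[OF H, of h] by auto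
  next
    case (eng g h)
    show ?case unfolding alt_group_mult by (rule perm_closedD(4)[OF H eng.IH])
  qed
  then show ?thesis using alt_group_carrier_as_three_cycles by blast
qed

text \<open>Elements of H permute the classes of \<open>linked H\<close>. So a single point of the
  class of u whose image under a generator is again in this class forces the generator to preserve
  the class. By transitivity, in the form of \<open>trans\<close>, the class is then all of
  {1..n}.\<close>

lemma alt_group_subset_criterion:
  assumes H: "perm_closed H" and ab: "a \<in> H" "b \<in> H" and u: "u \<in> {1..n}"
    and perm: "a permutes {1..n}" "b permutes {1..n}"
    and a: "linked H u v" "linked H u (a v)" and b: "linked H u v'" "linked H u (b v')"
    and trans: "\<And>C. u \<in> C \<Longrightarrow> C \<subseteq> {1..n} \<Longrightarrow> a ` C \<subseteq> C \<Longrightarrow> b ` C \<subseteq> C \<Longrightarrow> {1..n} \<subseteq> C"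
  shows "carrier (alt_group n) \<subseteq> H"
proof -
  let ?C = "{x \<in> {1..n}. linked H u x}"
  have step: "linked H u (g x)" if "g \<in> H" "linked H u v" "linked H u (g v)" "linked H u x" for g v x
    using linked_trans[OF H that(3)] linked_conj[OF H that(1) linked_trans[OF H linked_sym[OF H that(2)] that(4)]] .
  have "{1..n} \<subseteq> ?C"
  proof (rule trans)
    show "u \<in> ?C" using u by (simp add: linked_def)
    show "a ` ?C \<subseteq> ?C" using step[OF ab(1) a] permutes_in_image[OF perm(1)] by auto
    show "b ` ?C \<subseteq> ?C" using step[OF ab(2) b] permutes_in_image[OF perm(2)] by auto
  qed auto
  then have "linked H i j" if "i \<in> {1..n}" "j \<in> {1..n}" for i j
    using that linked_trans[OF H linked_sym[OF H], of u i j] by blast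
  then show ?thesis by (rule alt_group_subset_if_linked[OF H])
qed

section \<open>Products of disjoint cycles\<close>

definition cycs :: "'a list list \<Rightarrow> 'a \<Rightarrow> 'a"
  where "cycs css = foldr (\<lambda>cs f. cycle_of_list cs \<circ> f) css id"

lemma cycs_simps [simp]: "cycs [] = id" "cycs (cs # css) = cycle_of_list cs \<circ> cycs css"
  by (simp_all add: cycs_def)

lemma cycs_permutes: "cycs css permutes set (concat css)"
proof (induction css)
  case (Cons cs css)
  have "cycs css permutes set (concat (cs # css))"
    by (rule permutes_subset[OF Cons.IH]) auto
  moreover have "cycle_of_list cs permutes set (concat (cs # css))"
    by (rule permutes_subset[OF cycle_permutes]) auto
  ultimately show ?case unfolding cycs_simps by (rule permutes_compose)
qed (auto simp: fun_eq_iff)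

lemma cycs_outside: "x \<notin> set (concat css) \<Longrightarrow> cycs css x = x"
  using cycs_permutes by (rule permutes_not_in)

lemma cycs_apply:
  assumes "distinct (concat css)" "cs \<in> set css" "x \<in> set cs"
  shows "cycs css x = cycle_of_list cs x"
  using assms
proof (induction css)
  case (Cons ds css)
  show ?case
  proof (cases "x \<in> set ds")
    case True
    then have x: "x \<notin> set (concat css)" using Cons.prems by auto
    have "cs = ds" using x Cons.prems by auto
    then show ?thesis using cycs_outside[OF x] by simp
  next
    case False
    then have cs: "cs \<in> set css" using Cons.prems by auto
    then have IH: "cycs css x = cycle_of_list cs x" using Cons by simp
    have "cycle_of_list cs x \<in> set cs"
      using permutes_in_image[OF cycle_permutes] Cons.prems(3) by metis
    then have "cycle_of_list cs x \<notin> set ds" using Cons.prems cs by auto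
    then show ?thesis using IH id_outside_supp by (metis comp_apply cycs_simps(2))
  qed
qed simp

lemma cycs_cong_set:
  assumes "distinct (concat css)" "distinct (concat dss)" "set css = set dss"
  shows "cycs css = cycs dss"
proof
  fix x
  show "cycs css x = cycs dss x"
  proof (cases "x \<in> set (concat css)")
    case True
    then obtain cs where "cs \<in> set css" "x \<in> set cs" by auto
    then show ?thesis using cycs_apply[of css] cycs_apply[of dss] assms by simp
  next
    case False
    then have "x \<notin> set (concat dss)" using assms(3) by simp
    then show ?thesis using False cycs_outside by metis
  qed
qed

lemma cycs_conj:
  assumes "bij h" "distinct (concat css)"
  shows "h \<circ> cycs css \<circ> inv' h = cycs (map (map h) css)"
  using assms(2)
proof (induction css)
  case Nil
  then show ?case using assms(1) by (auto simp: fun_eq_iff bij_is_surj surj_f_inv_f)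
next
  case (Cons cs css)
  have "h \<circ> cycs (cs # css) \<circ> inv' h = (h \<circ> cycle_of_list cs \<circ> inv' h) \<circ> (h \<circ> cycs css \<circ> inv' h)"
    using assms(1) by (auto simp: fun_eq_iff bij_is_inj)
  also have "\<dots> = cycs (map (map h) (cs # css))"
  proof -
    have "distinct cs" "distinct (concat css)" using Cons.prems by auto
    then show ?thesis
      by (simp only: conjugation_of_cycle[OF _ assms(1)] Cons.IH list.map cycs_simps)
  qed
  finally show ?case .
qed

lemma cycle_of_list_append: "cycle_of_list (xs @ x # ys) = cycle_of_list (xs @ [x]) \<circ> cycle_of_list (x # ys)"
proof (induction xs)
  case (Cons a xs)
  then show ?case by (cases xs) (auto simp: comp_assoc)
qed simp

text \<open>The mechanism behind the insertion of points: composing two cycles that meet in one point joins them.\<close>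

lemma cycle_of_list_join:
  assumes "distinct (q # r @ ys)"
  shows "cycle_of_list (q # r) \<circ> cycle_of_list (q # ys) = cycle_of_list (q # ys @ r)"
proof -
  have "cycle_of_list (q # r) = cycle_of_list (r @ [q])"
    using cycle_of_list_rotate_independent[of "q # r" 1] assms by simp
  moreover have "cycle_of_list (q # ys @ r) = cycle_of_list (r @ q # ys)"
    using cycle_of_list_rotate_independent[of "(q # ys) @ r" "length (q # ys)"] rotate_append[of "q # ys" r] assms
    by auto
  ultimately show ?thesis using cycle_of_list_append[of r q ys] by simp
qed

lemma cycle_of_list_neq:
  assumes "distinct cs" "x \<in> set cs" "2 \<le> length cs"
  shows "cycle_of_list cs x \<noteq> x"
proof -
  obtain i where i: "i < length cs" "x = cs ! i" using assms by (auto simp: in_set_conv_nth)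
  have "map (cycle_of_list cs) cs = rotate 1 cs" using cyclic_rotation[OF assms(1), of 1] by simp
  then have "cycle_of_list cs x = rotate 1 cs ! i" using i by (metis nth_map)
  also have "\<dots> = cs ! (Suc i mod length cs)" using i nth_rotate[of i cs 1] by simp
  finally have "cycle_of_list cs x = cs ! (Suc i mod length cs)" .
  moreover have "Suc i mod length cs < length cs" using i by (intro mod_less_divisor) auto
  moreover have "Suc i mod length cs \<noteq> i" using i assms(3) by (cases "Suc i = length cs") auto
  ultimately show ?thesis using i nth_eq_iff_index_eq[OF assms(1)] by simp
qed

lemma evenperm_cycle_of_list: "distinct cs \<Longrightarrow> evenperm (cycle_of_list cs) \<longleftrightarrow> even (length cs - 1)"
proof (induction cs rule: cycle_of_list.induct)
  case (1 i j cs)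
  have *: "evenperm (transpose i j \<circ> cycle_of_list (j # cs)) \<longleftrightarrow>
      (evenperm (transpose i j) \<longleftrightarrow> evenperm (cycle_of_list (j # cs)))"
    by (rule evenperm_comp[OF permutation_swap_id permutation_of_cycle])
  show ?case unfolding cycle_of_list.simps * using 1 by (auto simp: evenperm_swap)
qed simp_all

lemma evenperm_cycs:
  "distinct (concat css) \<Longrightarrow> evenperm (cycs css) \<longleftrightarrow> even (\<Sum>cs\<leftarrow>css. length cs - 1)"
proof (induction css)
  case (Cons cs css)
  have "permutation (cycs css)" using cycs_permutes permutation_permutes by blast
  then have *: "evenperm (cycle_of_list cs \<circ> cycs css) \<longleftrightarrow>
      (evenperm (cycle_of_list cs) \<longleftrightarrow> evenperm (cycs css))"
    by (rule evenperm_comp[OF permutation_of_cycle])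
  show ?case unfolding cycs_simps * using Cons evenperm_cycle_of_list[of cs] by auto
qed simp

section \<open>Cycle decompositions and conjugacy of permutations with equal cycle type\<close>

lemma cycs_exists:
  assumes "p permutes S" "finite S"
  obtains css where "distinct (concat css)" "[] \<notin> set css" "set (concat css) = S" "cycs css = p"
proof -
  have "cycle_decomp S p" using cycle_decomposition[OF assms] .
  then have "\<exists>css. distinct (concat css) \<and> [] \<notin> set css \<and> set (concat css) = S \<and> cycs css = p"
  proof induction
    case (comp I p cs)
    then obtain css where css: "distinct (concat css)" "[] \<notin> set css" "set (concat css) = I" "cycs css = p"
      by blast
    show ?case
    proof (cases "cs = []")
      case True
      then show ?thesis using css by (intro exI[of _ css]) auto
    next
      case False
      then show ?thesis using css comp by (intro exI[of _ "cs # css"]) auto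
    qed
  qed (auto intro: exI[of _ "[]"])
  then show thesis using that by blast
qed

lemma distinct_concat_mset:
  assumes "distinct (concat css)" "mset css = mset dss"
  shows "distinct (concat dss)"
proof -
  have "mset (concat ess) = (\<Sum>cs\<in>#mset ess. mset cs)" for ess :: "'a list list"
    by (induction ess) auto
  then have "mset (concat css) = mset (concat dss)" using assms(2) by simp
  then show ?thesis using assms(1) mset_eq_imp_distinct_iff by blast
qed

lemma map_map_concat_eq:
  assumes "map length css = map length dss" "\<And>i. i < length (concat css) \<Longrightarrow> h (concat css ! i) = concat dss ! i"
  shows "map (map h) css = dss"
  using assms
proof (induction css arbitrary: dss)
  case (Cons cs css)
  then obtain ds dss' where d: "dss = ds # dss'" "length cs = length ds" "map length css = map length dss'"
    by (cases dss) auto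
  have "map h cs = ds"
  proof (rule nth_equalityI)
    fix i assume "i < length (map h cs)"
    then show "map h cs ! i = ds ! i" using Cons.prems(2)[of i] d by (simp add: nth_append)
  qed (use d in simp)
  moreover have "map (map h) css = dss'"
  proof (rule Cons.IH[OF d(3)])
    fix i assume "i < length (concat css)"
    then show "h (concat css ! i) = concat dss' ! i"
      using Cons.prems(2)[of "length cs + i"] d by (simp add: nth_append)
  qed
  ultimately show ?case using d by simp
qed simp

lemma bij_of_lists:
  assumes "distinct xs" "distinct ys" "set xs = S" "set ys = S"
  obtains h where "h permutes S" "\<And>i. i < length xs \<Longrightarrow> h (xs ! i) = ys ! i"
proof -
  have len: "length xs = length ys" using assms distinct_card by metis
  define f where "f x = (THE i. i < length xs \<and> xs ! i = x)" for x
  have f: "f (xs ! i) = i" if "i < length xs" for i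
    unfolding f_def using that assms(1) by (auto simp: nth_eq_iff_index_eq)
  define h where "h x = (if x \<in> S then ys ! f x else x)" for x
  have h: "h (xs ! i) = ys ! i" if "i < length xs" for i
    using that f assms(3) by (auto simp: h_def)
  have "map h xs = ys" using h len by (intro nth_equalityI) auto
  then have "h ` S = S" using assms(3,4) by (metis set_map)
  moreover have "finite S" using assms(3) by auto
  ultimately have "bij_betw h S S" by (simp add: bij_betw_def eq_card_imp_inj_on)
  then have "h permutes S" by (intro bij_imp_permutes) (auto simp: h_def)
  then show thesis using that h by blast
qed

lemma ex_reordering:
  "mset (map f xs) = mset ys \<Longrightarrow> \<exists>zs. mset zs = mset xs \<and> map f zs = ys"
proof (induction ys arbitrary: xs)
  case (Cons y ys)
  then have "y \<in> f ` set xs" by (metis list.set_intros(1) list.set_map set_mset_mset)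
  then obtain x where x: "x \<in> set xs" "f x = y" by blast
  have "mset (x # remove1 x xs) = mset xs" using x(1) by simp
  then have "mset (map f (x # remove1 x xs)) = mset (y # ys)" using Cons.prems by (metis mset_map)
  then have "mset (map f (remove1 x xs)) = mset ys" using x by simp
  from Cons.IH[OF this] obtain zs where "mset zs = mset (remove1 x xs)" "map f zs = ys" by blast
  then show ?case using x by (intro exI[of _ "x # zs"]) simp
qed simp

text \<open>After reordering the cycles of \<open>dss\<close> so that the lengths match position by
  position, the conjugator is the bijection between the two concatenated lists of points.\<close>

lemma cycs_conjugate:
  assumes "distinct (concat css)" "distinct (concat dss)" "set (concat css) = S" "set (concat dss) = S"
    and "mset (map length css) = mset (map length dss)"
  obtains h where "h permutes S" "h \<circ> cycs css \<circ> inv' h = cycs dss"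
proof -
  obtain ess where ess: "mset ess = mset dss" "map length css = map length ess"
    using ex_reordering[of length dss "map length css"] assms(5) by metis
  have dist: "distinct (concat ess)" using distinct_concat_mset[OF assms(2)] ess(1) by metis
  have set: "set ess = set dss" using ess(1) by (metis set_mset_mset)
  obtain h where h: "h permutes S" "\<And>i. i < length (concat css) \<Longrightarrow> h (concat css ! i) = concat ess ! i"
    using bij_of_lists[OF assms(1) dist assms(3)] set assms(4) by auto
  have "h \<circ> cycs css \<circ> inv' h = cycs (map (map h) css)"
    using cycs_conj[OF permutes_bij[OF h(1)] assms(1)] .
  also have "\<dots> = cycs dss"
    using map_map_concat_eq[OF ess(2) h(2)] cycs_cong_set[OF dist assms(2) set] by simp
  finally show thesis using that h(1) by blast
qed

lemma cycs_fixed_iff: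
  assumes "distinct (concat css)" "cs \<in> set css" "x \<in> set cs"
  shows "cycs css x = x \<longleftrightarrow> length cs = 1"
proof -
  have d: "distinct cs" using assms by (meson distinct_concat_iff)
  have "length cs \<noteq> 0" using assms(3) by auto
  show ?thesis
  proof (cases "length cs = 1")
    case True
    then obtain y where "cs = [y]" by (auto simp: length_Suc_conv)
    then show ?thesis using cycs_apply[OF assms] by simp
  next
    case False
    then have "2 \<le> length cs" using \<open>length cs \<noteq> 0\<close> by linarith
    then show ?thesis using cycs_apply[OF assms] cycle_of_list_neq[OF d assms(3)] False by simp
  qed
qed

lemma card_fixed_cycs:
  "distinct (concat css) \<Longrightarrow> card {x \<in> set (concat css). cycs css x = x} = length (filter (\<lambda>cs. length cs = 1) css)"
proof -
  assume d: "distinct (concat css)"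
  have "{x \<in> set (concat css). cycs css x = x} = set (concat (filter (\<lambda>cs. length cs = 1) css))"
    using cycs_fixed_iff[OF d] by auto
  moreover have "distinct (concat (filter P css))" for P
    using d by (induction css) auto
  ultimately have "card {x \<in> set (concat css). cycs css x = x} = length (concat (filter (\<lambda>cs. length cs = 1) css))"
    by (simp only: distinct_card)
  also have "\<dots> = length (filter (\<lambda>cs. length cs = 1) css)" by (induction css) auto
  finally show ?thesis .
qed

lemma funpow_cycs:
  assumes "distinct (concat css)" "\<And>cs. cs \<in> set css \<Longrightarrow> length cs dvd k"
  shows "cycs css ^^ k = id"
proof
  fix x
  show "(cycs css ^^ k) x = id x"
  proof (cases "x \<in> set (concat css)")
    case True
    then obtain cs where cs: "cs \<in> set css" "x \<in> set cs" by auto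
    have d: "distinct cs" using assms(1) cs by (meson distinct_concat_iff)
    have *: "(cycs css ^^ m) x = (cycle_of_list cs ^^ m) x \<and> (cycle_of_list cs ^^ m) x \<in> set cs" for m
    proof (induction m)
      case (Suc m)
      have "cycle_of_list cs y \<in> set cs \<longleftrightarrow> y \<in> set cs" for y
        by (rule permutes_in_image[OF cycle_permutes])
      then show ?case using Suc cycs_apply[OF assms(1) cs(1)] by simp
    qed (use cs in simp)
    obtain j where "k = length cs * j" using assms(2)[OF cs(1)] by auto
    then have "cycle_of_list cs ^^ k = id"
      using cycle_is_id_root[OF d] by (metis funpow_mult id_funpow)
    then show ?thesis using * by simp
  next
    case False
    then have "cycs css x = x" by (rule cycs_outside)
    then show ?thesis by (induction k) auto
  qed
qed

section \<open>Commutators of generating pairs\<close>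

definition gen_commutator :: "nat \<Rightarrow> (nat \<Rightarrow> nat) \<Rightarrow> bool"
  where "gen_commutator n c \<longleftrightarrow> (\<exists>a b. a \<in> carrier (alt_group n) \<and> b \<in> carrier (alt_group n) \<and>
    c = inv' a \<circ> inv' b \<circ> a \<circ> b \<and>
    (\<forall>H. perm_closed H \<longrightarrow> a \<in> H \<longrightarrow> b \<in> H \<longrightarrow> carrier (alt_group n) \<subseteq> H))"

lemma evenperm_conj:
  assumes "permutation p" "permutation h"
  shows "evenperm (h \<circ> p \<circ> inv' h) \<longleftrightarrow> evenperm p"
proof -
  have "permutation (inv' h)" using assms(2) by (rule permutation_inverse)
  then show ?thesis
    using evenperm_comp[OF permutation_compose[OF assms(2,1)] \<open>permutation (inv' h)\<close>]
      evenperm_comp[OF assms(2,1)] evenperm_inv[OF assms(2)] by blast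
qed

lemma alt_group_conj:
  assumes "p \<in> carrier (alt_group n)" "h permutes {1..n}"
  shows "h \<circ> p \<circ> inv' h \<in> carrier (alt_group n)"
proof -
  have "permutation p" "permutation h"
    using assms permutation_permutes by (auto simp: alt_group_carrier)
  then show ?thesis
    using assms evenperm_conj[of p h] permutes_compose permutes_inv
    unfolding alt_group_carrier by metis
qed

lemma perm_closed_conj:
  assumes H: "perm_closed H" and bh: "bij h"
  shows "perm_closed {p. bij p \<and> h \<circ> p \<circ> inv' h \<in> H}"
    (is "perm_closed ?K")
proof -
  let ?k = "\<lambda>p. h \<circ> p \<circ> inv' h"
  have k_comp: "?k p \<circ> ?k q = ?k (p \<circ> q)" for p q
    using bh by (auto simp: fun_eq_iff bij_is_inj)
  have k_inv: "inv' (?k p) = ?k (inv' p)" if "bij p" for p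
  proof -
    have bi: "bij (inv' h)" using bh by (rule bij_imp_bij_inv)
    have "inv' (h \<circ> p \<circ> inv' h) = inv' (inv' h) \<circ> inv' (h \<circ> p)"
      by (rule o_inv_distrib[OF bij_comp[OF that bh] bi])
    also have "\<dots> = h \<circ> (inv' p \<circ> inv' h)"
      by (simp only: inv_inv_eq[OF bh] o_inv_distrib[OF bh that])
    finally show ?thesis by (simp only: comp_assoc)
  qed
  show ?thesis
    unfolding perm_closed_def
  proof (intro conjI ballI)
    have "?k id = id" using bh by (auto simp: fun_eq_iff bij_is_surj surj_f_inv_f)
    then show "id \<in> ?K" using perm_closedD(1)[OF H] by (simp only: mem_Collect_eq bij_id simp_thms)
  next
    fix p assume "p \<in> ?K"
    then show "bij p" by blast
  next
    fix p assume p: "p \<in> ?K"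
    then have "?k (inv' p) \<in> H" using perm_closedD(3)[OF H] k_inv by (metis (no_types, lifting) mem_Collect_eq)
    then show "inv' p \<in> ?K" using p bij_imp_bij_inv by blast
  next
    fix p q assume pq: "p \<in> ?K" "q \<in> ?K"
    then have "?k (p \<circ> q) \<in> H" using perm_closedD(4)[OF H] k_comp by (metis (no_types, lifting) mem_Collect_eq)
    then show "p \<circ> q \<in> ?K" using pq bij_comp by blast
  qed
qed

lemma gen_commutator_conj:
  assumes "gen_commutator n c" and h: "h permutes {1..n}"
  shows "gen_commutator n (h \<circ> c \<circ> inv' h)"
proof -
  obtain a b where ab: "a \<in> carrier (alt_group n)" "b \<in> carrier (alt_group n)" and c: "c = inv' a \<circ> inv' b \<circ> a \<circ> b"
    and gen: "\<And>H. perm_closed H \<Longrightarrow> a \<in> H \<Longrightarrow> b \<in> H \<Longrightarrow> carrier (alt_group n) \<subseteq> H"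
    using assms(1) unfolding gen_commutator_def by blast
  have bh: "bij h" using h by (rule permutes_bij)
  have bij: "bij a" "bij b" using ab by (auto simp: alt_group_carrier permutes_bij)
  let ?k = "\<lambda>p. h \<circ> p \<circ> inv' h"
  have k_comp: "?k p \<circ> ?k q = ?k (p \<circ> q)" for p q
    using bh by (auto simp: fun_eq_iff bij_is_inj)
  have k_inv: "inv' (?k p) = ?k (inv' p)" if "bij p" for p
  proof -
    have bi: "bij (inv' h)" using bh by (rule bij_imp_bij_inv)
    have "inv' (h \<circ> p \<circ> inv' h) = inv' (inv' h) \<circ> inv' (h \<circ> p)"
      by (rule o_inv_distrib[OF bij_comp[OF that bh] bi])
    also have "\<dots> = h \<circ> (inv' p \<circ> inv' h)"
      by (simp only: inv_inv_eq[OF bh] o_inv_distrib[OF bh that])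
    finally show ?thesis by (simp only: comp_assoc)
  qed
  have "h \<circ> c \<circ> inv' h = inv' (?k a) \<circ> inv' (?k b) \<circ> ?k a \<circ> ?k b"
    by (simp only: k_inv[OF bij(1)] k_inv[OF bij(2)] k_comp c)
  moreover have "carrier (alt_group n) \<subseteq> H" if H: "perm_closed H" "?k a \<in> H" "?k b \<in> H" for H
  proof -
    let ?K = "{p. bij p \<and> ?k p \<in> H}"
    have "perm_closed ?K" by (rule perm_closed_conj[OF H(1) bh])
    then have sub: "carrier (alt_group n) \<subseteq> ?K" using gen H bij by blast
    show ?thesis
    proof
      fix q assume q: "q \<in> carrier (alt_group n)"
      have "inv' h \<circ> q \<circ> inv' (inv' h) \<in> carrier (alt_group n)"
        using alt_group_conj[OF q permutes_inv[OF h]] .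
      then have "?k (inv' h \<circ> q \<circ> h) \<in> H" using sub inv_inv_eq[OF bh] by auto
      moreover have "?k (inv' h \<circ> q \<circ> h) = q"
        using bh by (auto simp: fun_eq_iff bij_is_surj surj_f_inv_f)
      ultimately show "q \<in> H" by metis
    qed
  qed
  ultimately show ?thesis
    unfolding gen_commutator_def using alt_group_conj[OF ab(1) h] alt_group_conj[OF ab(2) h] by blast
qed

text \<open>Odd conjugators are allowed as well, since conjugation by any permutation of {1..n} is
  an automorphism of the alternating group. Hence one witness per partition of n suffices, even
  where a cycle type splits into two classes of the alternating group.\<close>

lemma gen_commutator_same_type:
  assumes "gen_commutator n (cycs css)" "distinct (concat css)" "distinct (concat dss)"
    "set (concat css) = {1..n}" "set (concat dss) = {1..n}" "mset (map length css) = mset (map length dss)"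
  shows "gen_commutator n (cycs dss)"
  using cycs_conjugate[OF assms(2-6)] gen_commutator_conj[OF assms(1)] by metis

lemma image_inv_subset:
  assumes "finite C" "inj g" "g ` C \<subseteq> C"
  shows "inv' g ` C \<subseteq> C"
proof -
  have "g ` C = C" using assms by (intro endo_inj_surj) (auto intro: inj_on_subset)
  then show ?thesis using assms(2) by (metis image_inv_f_f subset_refl)
qed

lemma cycle_closed_subset:
  assumes "distinct M" "m \<in> set M" "m \<in> C" "\<And>x. x \<in> set M \<Longrightarrow> x \<in> C \<Longrightarrow> cycle_of_list M x \<in> C"
  shows "set M \<subseteq> C"
proof
  fix x assume "x \<in> set M"
  then obtain i where i: "i < length M" "x = M ! i" by (auto simp: in_set_conv_nth)
  obtain j where j: "j < length M" "m = M ! j" using assms(2) by (auto simp: in_set_conv_nth)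
  have mem: "(cycle_of_list M ^^ k) m \<in> C \<and> (cycle_of_list M ^^ k) m \<in> set M" for k
  proof (induction k)
    case (Suc k)
    have "cycle_of_list M y \<in> set M \<longleftrightarrow> y \<in> set M" for y
      by (rule permutes_in_image[OF cycle_permutes])
    then show ?case using Suc assms(4) by simp
  qed (use assms in simp)
  have "map (cycle_of_list M ^^ k) M ! j = rotate k M ! j" for k
    using cyclic_rotation[OF assms(1)] by simp
  then have "(cycle_of_list M ^^ k) m = M ! ((k + j) mod length M)" for k
    using j by (simp add: nth_rotate add.commute)
  from this[of "i + length M - j"] have "(cycle_of_list M ^^ (i + length M - j)) m = x"
    using i j by simp
  then show "x \<in> C" using mem by metis
qed

lemma funpow_comp_commute:
  assumes "f \<circ> g = g \<circ> f"
  shows "(f \<circ> g) ^^ k = f ^^ k \<circ> g ^^ k"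
proof (induction k)
  case (Suc k)
  have c: "g (f x) = f (g x)" for x using fun_cong[OF assms, of x] by simp
  have "(f ^^ k) (g x) = g ((f ^^ k) x)" for x by (induction k) (auto simp: c)
  then have "f ^^ k \<circ> g = g \<circ> f ^^ k" by (auto simp: fun_eq_iff)
  then show ?case using Suc by (auto simp: fun_eq_iff c)
qed simp

text \<open>If \<open>M\<close> has odd length, then the power of $(x\,y)(z\,w)(M)$ with exponent $|M|$ is the double
  transposition $(x\,y)(z\,w)$. Two permutations of this shape are conjugate by an even permutation, since
  \<open>z\<close> and \<open>w\<close> can be exchanged. The two clauses of \<open>compatible\<close> are the relative positions in which the
  commutator, respectively the product, of the two double transpositions is a 3-cycle.\<close>

fun double_swap :: "nat list \<Rightarrow> nat list \<Rightarrow> nat \<Rightarrow> nat"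
  where "double_swap [x, y, z, w] M = cycs [[x, y], [z, w], M]"
  | "double_swap _ M = id"

fun compatible :: "nat list \<Rightarrow> nat list \<Rightarrow> nat list \<Rightarrow> nat list \<Rightarrow> bool"
  where "compatible [x, y, z, w] [x', p, q, r] M N \<longleftrightarrow>
      x' = x \<and> p \<notin> set [x, y, z, w] \<and> q \<notin> set [x, y, z, w] \<and> r \<notin> set [x, y, z, w] \<and> (y \<in> set N \<or> p \<in> set M) \<or>
      x' = z \<and> q = x \<and> r = y \<and> (p \<in> set M \<or> w \<in> set N)"
  | "compatible _ _ _ _ \<longleftrightarrow> False"

text \<open>\<open>F\<close> and \<open>F'\<close> hold the fixed point of the two permutations, if there is one.\<close>

definition configuration :: "nat \<Rightarrow> nat list \<Rightarrow> nat list \<Rightarrow> nat list \<Rightarrow> nat list \<Rightarrow> nat list \<Rightarrow> nat list \<Rightarrow> bool"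
  where "configuration n G F M G' F' N \<longleftrightarrow>
    distinct (G @ F @ M) \<and> distinct (G' @ F' @ N) \<and> set (G @ F @ M) = {1..n} \<and> set (G' @ F' @ N) = {1..n} \<and>
    length F = length F' \<and> length F \<le> 1 \<and> set F \<inter> set F' = {} \<and> odd (length M) \<and>
    set M \<inter> set N \<noteq> {} \<and> compatible G G' M N"

lemma compatible_cases:
  assumes "compatible G G' M N"
  obtains (meet) x y z w p q r where "G = [x, y, z, w]" "G' = [x, p, q, r]"
      "p \<notin> set [x, y, z, w]" "q \<notin> set [x, y, z, w]" "r \<notin> set [x, y, z, w]" "y \<in> set N \<or> p \<in> set M"
    | (overlap) x y z w p where "G = [x, y, z, w]" "G' = [z, p, x, y]" "p \<in> set M \<or> w \<in> set N"
  using assms by (cases "(G, G', M, N)" rule: compatible.cases) auto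

lemma double_swap_funpow:
  assumes "distinct ([x, y, z, w] @ M)" "odd (length M)"
  shows "double_swap [x, y, z, w] M ^^ length M = transpose x y \<circ> transpose z w"
proof -
  let ?s = "transpose x y \<circ> transpose z w"
  have eq: "double_swap [x, y, z, w] M = ?s \<circ> cycle_of_list M" by (simp add: comp_assoc)
  have sM: "?s v = v" if "v \<in> set M" for v using that assms(1) by (auto simp: transpose_def)
  have Ms: "cycle_of_list M v = v" if "v \<notin> set M" for v by (rule id_outside_supp[OF that])
  have "?s \<circ> cycle_of_list M = cycle_of_list M \<circ> ?s"
  proof
    fix v
    have "v \<in> set M \<longleftrightarrow> cycle_of_list M v \<in> set M" using permutes_in_image[OF cycle_permutes] by metis
    moreover have "?s v \<notin> set M" if "v \<notin> set M" using that assms(1) by (auto simp: transpose_def)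
    ultimately show "(?s \<circ> cycle_of_list M) v = (cycle_of_list M \<circ> ?s) v"
      using sM Ms by (cases "v \<in> set M") (simp_all del: comp_apply add: comp_def)
  qed
  then have "double_swap [x, y, z, w] M ^^ length M = ?s ^^ length M \<circ> cycle_of_list M ^^ length M"
    unfolding eq by (rule funpow_comp_commute)
  moreover have "cycle_of_list M ^^ length M = id"
    using assms(1) by (intro cycle_is_id_root) auto
  moreover have "?s ^^ length M = ?s"
  proof -
    have "?s \<circ> ?s = id" using assms(1) by (auto simp: fun_eq_iff transpose_def)
    then have "?s ^^ (2 * k) = id" for k
      by (metis funpow_mult id_funpow numeral_2_eq_2 funpow_Suc_right funpow_0 funpow.simps id_comp comp_id)
    moreover obtain k where "length M = Suc (2 * k)" using assms(2) by (auto elim: oddE)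
    ultimately show ?thesis by (metis comp_id funpow.simps(2))
  qed
  ultimately show ?thesis by simp
qed

lemma commutator_meet:
  assumes "distinct [x, y, z, w, p, q, r]"
  shows "(transpose x y \<circ> transpose z w) \<circ> (transpose x p \<circ> transpose q r) \<circ>
    (transpose x y \<circ> transpose z w) \<circ> (transpose x p \<circ> transpose q r) = cycle_of_list [x, y, p]"
    (is "?f = ?g")
proof
  fix v
  \<comment> \<open>The reversed list supplies every inequality in the opposite orientation for the
    simplifier.\<close>
  have rev: "distinct [r, q, p, w, z, y, x]" using assms by auto
  have "v = x \<or> v = y \<or> v = z \<or> v = w \<or> v = p \<or> v = q \<or> v = r \<or> v \<notin> set [x, y, z, w, p, q, r]" by auto
  then show "?f v = ?g v" by (elim disjE) (use assms rev in simp_all)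
qed

lemma product_overlap:
  assumes "distinct [x, y, z, w, p]"
  shows "(transpose x y \<circ> transpose z w) \<circ> (transpose z p \<circ> transpose x y) = cycle_of_list [z, p, w]"
    (is "?f = ?g")
proof
  fix v
  have rev: "distinct [p, w, z, y, x]" using assms by auto
  have "v = x \<or> v = y \<or> v = z \<or> v = w \<or> v = p \<or> v \<notin> set [x, y, z, w, p]" by auto
  then show "?f v = ?g v" by (elim disjE) (use assms rev in simp_all)
qed

lemma double_swap_permutes: "double_swap [x, y, z, w] M permutes set ([x, y, z, w] @ M)"
  using cycs_permutes[of "[[x, y], [z, w], M]"] by (simp add: insert_commute)

lemma double_swap_apply_cycle:
  assumes "distinct ([x, y, z, w] @ M)" "v \<in> set M"
  shows "double_swap [x, y, z, w] M v = cycle_of_list M v"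
  using cycs_apply[of "[[x, y], [z, w], M]" M v] assms by auto

lemma double_swap_apply_swap:
  assumes "distinct ([x, y, z, w] @ M)"
  shows "double_swap [x, y, z, w] M x = y" "double_swap [x, y, z, w] M y = x" "double_swap [x, y, z, w] M z = w" "double_swap [x, y, z, w] M w = z"
  using cycs_apply[of "[[x, y], [z, w], M]" "[x, y]" x] cycs_apply[of "[[x, y], [z, w], M]" "[x, y]" y]
    cycs_apply[of "[[x, y], [z, w], M]" "[z, w]" z] cycs_apply[of "[[x, y], [z, w], M]" "[z, w]" w] assms
  by auto

lemma double_swap_evenperm:
  assumes "distinct ([x, y, z, w] @ M)" "odd (length M)"
  shows "evenperm (double_swap [x, y, z, w] M)"
  using evenperm_cycs[of "[[x, y], [z, w], M]"] assms by auto

declare double_swap.simps [simp del]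

lemma configuration_conjugator:
  assumes st: "configuration n G F M G' F' N" and G: "G = [x, y, z, w]" and G': "G' = [x', y', z', w']"
  obtains b where "b \<in> carrier (alt_group n)" "b x = x'" "b y = y'" "{b z, b w} = {z', w'}"
    "map b M = N" "b \<circ> double_swap G M \<circ> inv' b = double_swap G' N"
proof -
  have d: "distinct (G @ F @ M)" "distinct (G' @ F' @ N)" "set (G @ F @ M) = {1..n}" "set (G' @ F' @ N) = {1..n}"
    and len: "length F = length F'" using st by (auto simp: configuration_def)
  have lall: "length (G @ F @ M) = length (G' @ F' @ N)" using d distinct_card by metis
  from lall have len': "length M = length N" using len G G' by simp
  obtain b0 where b0: "b0 permutes {1..n}" "\<And>i. i < length (G @ F @ M) \<Longrightarrow> b0 ((G @ F @ M) ! i) = (G' @ F' @ N) ! i"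
    using bij_of_lists[OF d] by auto
  have "map b0 (G @ F @ M) = G' @ F' @ N"
  proof (rule nth_equalityI)
    show "length (map b0 (G @ F @ M)) = length (G' @ F' @ N)" using lall by simp
    fix i assume "i < length (map b0 (G @ F @ M))"
    then show "map b0 (G @ F @ M) ! i = (G' @ F' @ N) ! i"
      using b0(2)[of i] by (simp only: length_map nth_map)
  qed
  then have m: "map b0 G = G'" "map b0 M = N" using len G G' by auto
  have zw: "z \<in> {1..n}" "w \<in> {1..n}" unfolding d(3)[symmetric] G by auto
  have zw': "z \<noteq> w" "x \<noteq> z" "x \<noteq> w" "y \<noteq> z" "y \<noteq> w" "z \<notin> set M" "w \<notin> set M"
    using d(1) G by auto
  define b where "b = (if evenperm b0 then b0 else b0 \<circ> transpose z w)"
  have t: "transpose z w permutes {1..n}" using zw by (intro permutes_swap_id)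
  have bp: "b permutes {1..n}" using b0(1) permutes_compose[OF t b0(1)] by (simp add: b_def)
  have "permutation b0" using b0(1) permutation_permutes by blast
  then have "evenperm (b0 \<circ> transpose z w) \<longleftrightarrow> (evenperm b0 \<longleftrightarrow> evenperm (transpose z w))"
    by (rule evenperm_comp[OF _ permutation_swap_id])
  then have be: "evenperm b" using zw' by (auto simp: b_def evenperm_swap)
  have bv: "b x = x'" "b y = y'" "{b z, b w} = {z', w'}" using m zw' G G' by (auto simp: b_def transpose_def)
  have "b v = b0 v" if "v \<in> set M" for v using that zw' by (auto simp: b_def transpose_def)
  then have bM: "map b M = N" using m by (metis map_eq_conv)
  have swap: "cycle_of_list [b z, b w] = cycle_of_list [z', w']"
    using bv(3) by (auto simp: doubleton_eq_iff transpose_commute)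
  have "b \<circ> double_swap G M \<circ> inv' b = cycs (map (map b) [[x, y], [z, w], M])"
    unfolding G double_swap.simps by (rule cycs_conj[OF permutes_bij[OF bp]]) (use d(1) G in auto)
  also have "\<dots> = double_swap G' N" unfolding G' double_swap.simps using bv(1,2) bM swap by simp
  finally have "b \<circ> double_swap G M \<circ> inv' b = double_swap G' N" .
  then show thesis using that bp be bv bM by (auto simp: alt_group_carrier)
qed

text \<open>With a' = b a b^{-1}, the quotient a^{-1} a' is the commutator of a and b^{-1}. If the
  gadgets meet in x only, b fixes x and thereby preserves the class of x. If they overlap, the class
  of z contains both long cycles, and b maps one onto the other.\<close>

theorem configuration_gen_commutator:
  assumes st: "configuration n G F M G' F' N"
  shows "gen_commutator n (inv' (double_swap G M) \<circ> double_swap G' N)"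
proof -
  have d: "distinct (G @ F @ M)" "distinct (G' @ F' @ N)" "set (G @ F @ M) = {1..n}" "set (G' @ F' @ N) = {1..n}"
    and len: "length F = length F'" "length F \<le> 1" and FF: "set F \<inter> set F' = {}" and odd: "odd (length M)"
    and MN: "set M \<inter> set N \<noteq> {}" and compatible: "compatible G G' M N"
    using st by (auto simp: configuration_def)
  have "length G = 4 \<and> length G' = 4" using compatible by (cases rule: compatible_cases) auto
  then have "length (G @ F @ M) = length (G' @ F' @ N) \<Longrightarrow> length M = length N" using len by simp
  then have lenM: "length M = length N" using d distinct_card by metis
  obtain x y z w x' y' z' w' where G: "G = [x, y, z, w]" and G': "G' = [x', y', z', w']"
    using compatible by (cases rule: compatible_cases) auto
  let ?a = "double_swap G M" and ?a' = "double_swap G' N"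
  obtain b where b: "b \<in> carrier (alt_group n)" "b x = x'" "b y = y'" "{b z, b w} = {z', w'}"
    "map b M = N" and conj: "b \<circ> ?a \<circ> inv' b = ?a'"
    using configuration_conjugator[OF st G G'] by metis
  have dG: "distinct ([x, y, z, w] @ M)" "distinct ([x', y', z', w'] @ N)" using d(1,2) G G' by auto
  have sub: "set ([x, y, z, w] @ M) \<subseteq> {1..n}" unfolding d(3)[symmetric] G by auto
  have ap: "?a permutes {1..n}" using permutes_subset[OF double_swap_permutes sub] G by simp
  have ac: "?a \<in> carrier (alt_group n)"
    using ap double_swap_evenperm[OF dG(1) odd] G by (simp only: alt_group_carrier)
  have bp: "b permutes {1..n}" using b(1) by (simp add: alt_group_carrier)
  have bij: "bij b" using bp by (rule permutes_bij)
  have ib: "inv' b \<in> carrier (alt_group n)" using b(1) by (rule alt_group_inv_closed)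
  have ibp: "inv' b permutes {1..n}" using bp by (rule permutes_inv)
  have com: "inv' ?a \<circ> ?a' = inv' ?a \<circ> inv' (inv' b) \<circ> ?a \<circ> inv' b"
    unfolding inv_inv_eq[OF bij] conj[symmetric] by (simp only: comp_assoc)
  have closed_b: "b ` C \<subseteq> C" if "C \<subseteq> {1..n}" "inv' b ` C \<subseteq> C" for C
    using image_inv_subset[of C "inv' b"] that finite_subset[OF that(1)] permutes_inj[OF ibp] inv_inv_eq[OF bij] by auto
  have closed_a': "?a' ` C \<subseteq> C" if "C \<subseteq> {1..n}" "?a ` C \<subseteq> C" "inv' b ` C \<subseteq> C" for C
    using closed_b[OF that(1,3)] that(2,3) unfolding conj[symmetric] by fastforce
  have M_sub: "set M \<subseteq> C" if "?a ` C \<subseteq> C" "m \<in> set M" "m \<in> C" for C m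
  proof (rule cycle_closed_subset[OF _ that(2,3)])
    show "distinct M" using dG(1) by simp
    fix v assume v: "v \<in> set M" "v \<in> C"
    then have "?a v \<in> C" using that(1) by blast
    then show "cycle_of_list M v \<in> C" using double_swap_apply_cycle[OF dG(1) v(1)] G by simp
  qed
  have N_sub: "set N \<subseteq> C" if "?a' ` C \<subseteq> C" "m \<in> set N" "m \<in> C" for C m
  proof (rule cycle_closed_subset[OF _ that(2,3)])
    show "distinct N" using dG(2) by simp
    fix v assume v: "v \<in> set N" "v \<in> C"
    then have "?a' v \<in> C" using that(1) by blast
    then show "cycle_of_list N v \<in> C" using double_swap_apply_cycle[OF dG(2) v(1)] G' by simp
  qed
  \<comment> \<open>The two long cycles share a point, so a set closed under a and a' that touches
    one of them contains both.\<close>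
  have both: "set M \<subseteq> C \<and> set N \<subseteq> C"
    if "?a ` C \<subseteq> C" "?a' ` C \<subseteq> C" "(\<exists>m\<in>set M. m \<in> C) \<or> (\<exists>m\<in>set N. m \<in> C)" for C
    using MN M_sub[OF that(1)] N_sub[OF that(2)] that(3) by blast
  note swap = double_swap_apply_swap[OF dG(1), folded G] double_swap_apply_swap[OF dG(2), folded G']
  have gen: "carrier (alt_group n) \<subseteq> H" if H: "perm_closed H" and aH: "?a \<in> H" and bH: "inv' b \<in> H" for H
  proof -
    have bH': "b \<in> H" using perm_closedD(3)[OF H bH] inv_inv_eq[OF bij] by simp
    have a'H: "?a' \<in> H" unfolding conj[symmetric] by (intro perm_closedD(4)[OF H] aH bH bH')
    have sH: "transpose x y \<circ> transpose z w \<in> H"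
      using perm_closed_funpow[OF H aH, of "length M"] double_swap_funpow[OF dG(1) odd] G by simp
    have s'H: "transpose x' y' \<circ> transpose z' w' \<in> H"
      using perm_closed_funpow[OF H a'H, of "length N"] double_swap_funpow[OF dG(2)] odd lenM G' by simp
    show ?thesis
      using compatible
    proof (cases rule: compatible_cases)
      case (meet x0 y0 z0 w0 p q r)
      have eqs: "x' = x" "y' = p" "z' = q" "w' = r" "y \<in> set N \<or> p \<in> set M"
        and new: "p \<notin> {x, y, z, w}" "q \<notin> {x, y, z, w}" "r \<notin> {x, y, z, w}"
        using meet G G' by auto
      have "distinct [x, y, z, w, p, q, r]" using d(1,2) G G' eqs new by auto
      then have 3: "three_in H x y p"
        using perm_closedD(4)[OF H perm_closedD(4)[OF H perm_closedD(4)[OF H sH s'H] sH] s'H]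
          commutator_meet[of x y z w p q r] unfolding eqs three_in_def by (auto simp del: cycle_of_list.simps)
      have xn: "x \<in> {1..n}" unfolding d(3)[symmetric] G by simp
      show ?thesis
      proof (rule alt_group_subset_criterion[OF H aH bH xn ap ibp])
        show "linked H x x" "linked H x x" by (auto simp: linked_def)
        show "linked H x (?a x)" using 3 swap by (auto simp: linked_def)
        have "inv' b x = x" using b(2) eqs(1) bij by (metis bij_inv_eq_iff)
        then show "linked H x (inv' b x)" by (simp add: linked_def)
        fix C assume C: "x \<in> C" "C \<subseteq> {1..n}" "?a ` C \<subseteq> C" "inv' b ` C \<subseteq> C"
        note a'C = closed_a'[OF C(2,3,4)]
        have y: "y \<in> C" using C(1,3) swap(1) by (metis image_subset_iff)
        have p: "p \<in> C" using C(1) a'C swap(5) eqs by (metis image_subset_iff)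
        have M: "set M \<subseteq> C" and N: "set N \<subseteq> C" using both[OF C(3) a'C] eqs(5) y p by blast+
        \<comment> \<open>Outside G there are only M and at most one fixed point of a, so q or r
          lies on M; a' exchanges q and r. The same argument with the roles of a and a' exchanged
          gives z and w below.\<close>
        have "q \<in> set (G @ F @ M)" "r \<in> set (G @ F @ M)" unfolding d(3) d(4)[symmetric] G' eqs by auto
        then have "q \<in> set F \<union> set M" "r \<in> set F \<union> set M" "q \<noteq> r" using d(2) new G G' eqs by auto
        then have "q \<in> set M \<or> r \<in> set M" using len(2) by (cases F) auto
        then have qr: "q \<in> C" "r \<in> C" using M a'C swap(7,8) eqs by (metis image_subset_iff subsetD)+
        have "z \<in> set (G' @ F' @ N)" "w \<in> set (G' @ F' @ N)" unfolding d(4) d(3)[symmetric] G by auto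
        then have "z \<in> set F' \<union> set N" "w \<in> set F' \<union> set N" "z \<noteq> w" using d(1) new G G' eqs by auto
        then have "z \<in> set N \<or> w \<in> set N" using len by (cases F') auto
        then have zw: "z \<in> C" "w \<in> C" using N C(3) swap(3,4) by (metis image_subset_iff subsetD)+
        \<comment> \<open>The fixed point of a is not the fixed point of a', so a' moves it and it
          belongs to G' or to N.\<close>
        have "set F \<subseteq> set (G' @ F' @ N)" unfolding d(4) d(3)[symmetric] by auto
        then have "set F \<subseteq> set G' \<union> set N" using FF by auto
        then have "set F \<subseteq> C" using G' eqs C(1) p qr N by auto
        then have "set (G @ F @ M) \<subseteq> C" using G C(1) y zw M by auto
        then show "{1..n} \<subseteq> C" by (simp only: d(3))
      qed
    next
      case (overlap x0 y0 z0 w0 p)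
      have eqs: "x' = z" "y' = p" "z' = x" "w' = y" "p \<in> set M \<or> w \<in> set N"
        using overlap G G' by auto
      have "distinct [x, y, z, w, p]" using d(1,2) G G' eqs by auto
      then have 3: "three_in H z p w"
        using perm_closedD(4)[OF H sH s'H] product_overlap[of x y z w p]
        unfolding eqs three_in_def by (auto simp del: cycle_of_list.simps)
      have zp: "linked H z p" using 3 by (auto simp: linked_def)
      have zw: "linked H z w" using three_in_rotate[OF three_in_rotate[OF three_in_reverse[OF H 3]]] three_in_rotate[OF three_in_reverse[OF H 3]]
        by (auto simp: linked_def)
      have zn: "z \<in> {1..n}" unfolding d(3)[symmetric] G by simp
      let ?B = "{v. linked H z v}"
      have closedB: "g ` ?B \<subseteq> ?B" if "g \<in> H" "linked H z v" "linked H z (g v)" for g v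
        using linked_trans[OF H that(3)] linked_conj[OF H that(1) linked_trans[OF H linked_sym[OF H that(2)]]] by blast
      have aB: "?a ` ?B \<subseteq> ?B" using closedB[OF aH, of z] zw swap by (simp add: linked_def)
      have a'B: "?a' ` ?B \<subseteq> ?B" using closedB[OF a'H, of z] zp swap eqs by (simp add: linked_def)
      have MB: "set M \<subseteq> ?B" and NB: "set N \<subseteq> ?B" using both[OF aB a'B] eqs(5) zp zw by blast+
      obtain m where m: "m \<in> set M" using MN by blast
      \<comment> \<open>The criterion is applied to b^{-1} at the point b m of N: it goes back to m
        in M, and both points are linked to z.\<close>
      have bm: "b m \<in> set N" using b(5) m by auto
      show ?thesis
      proof (rule alt_group_subset_criterion[OF H aH bH zn ap ibp])
        show "linked H z z" "linked H z (?a z)" using zw swap by (auto simp: linked_def)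
        show "linked H z (b m)" using NB bm by blast
        show "linked H z (inv' b (b m))" using MB m bij by (auto simp: bij_is_inj)
        fix C assume C: "z \<in> C" "C \<subseteq> {1..n}" "?a ` C \<subseteq> C" "inv' b ` C \<subseteq> C"
        note a'C = closed_a'[OF C(2,3,4)]
        have w: "w \<in> C" using C(1,3) swap(3) by (metis image_subset_iff)
        have p: "p \<in> C" using C(1) a'C swap(5) eqs by (metis image_subset_iff)
        have M: "set M \<subseteq> C" and N: "set N \<subseteq> C" using both[OF C(3) a'C] eqs(5) w p by blast+
        \<comment> \<open>In the overlapping position b maps the transposition (z w) of a to the
          transposition (x y) of a'.\<close>
        have "b z \<in> C" "b w \<in> C" using closed_b[OF C(2,4)] C(1) w by auto
        then have xy: "x \<in> C" "y \<in> C" using b(4) eqs by (auto simp: doubleton_eq_iff)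
        have "set F \<subseteq> set (G' @ F' @ N)" unfolding d(4) d(3)[symmetric] by auto
        then have "set F \<subseteq> set G' \<union> set N" using FF by auto
        then have "set F \<subseteq> C" using G' eqs C(1) p xy N by auto
        then have "set (G @ F @ M) \<subseteq> C" using G C(1) w xy M by auto
        then show "{1..n} \<subseteq> C" by (simp only: d(3))
      qed
    qed
  qed
  show ?thesis unfolding gen_commutator_def
    by (intro exI[of _ ?a] exI[of _ "inv' b"] conjI ac ib com allI impI gen)
qed

section \<open>Inserting points\<close>

lemma permutes_disjoint_commute:
  assumes "p permutes A" "q permutes B" "A \<inter> B = {}"
  shows "p \<circ> q = q \<circ> p"
proof
  fix x
  have out: "p x = x" if "x \<notin> A" for x using that assms(1) permutes_not_in by metis
  have out': "q x = x" if "x \<notin> B" for x using that assms(2) permutes_not_in by metis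
  have "p x \<in> A \<longleftrightarrow> x \<in> A" "q x \<in> B \<longleftrightarrow> x \<in> B"
    using permutes_in_image[OF assms(1)] permutes_in_image[OF assms(2)] by auto
  then show "(p \<circ> q) x = (q \<circ> p) x"
    using out out' assms(3) by (metis comp_apply disjoint_iff)
qed

lemma double_swap_permutes_points: "double_swap G M permutes set G \<union> set M"
proof (cases "(G, M)" rule: double_swap.cases)
  case (1 x y z w M')
  then show ?thesis using double_swap_permutes[of x y z w M] by (simp add: insert_commute)
qed (auto simp: double_swap.simps fun_eq_iff permutes_def)

text \<open>Rotating M so that it starts at p does not change the cycle, and then the join with (p
  ys) applies. The factor (p ys) passes the two transpositions because it is disjoint from
  them.\<close>

lemma double_swap_join:
  assumes d: "distinct ([x, y, z, w] @ M)" and p: "p \<in> set M"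
    and ys: "distinct ys" "set ys \<inter> set ([x, y, z, w] @ M) = {}"
  obtains M' where "distinct M'" "set M' = set M \<union> set ys" "length M' = length M + length ys"
    "double_swap [x, y, z, w] M' = cycle_of_list (p # ys) \<circ> double_swap [x, y, z, w] M"
proof -
  obtain A B where AB: "M = A @ p # B" using p by (meson split_list)
  have dM: "distinct M" using d by simp
  have rot: "cycle_of_list M = cycle_of_list (p # B @ A)"
    using cycle_of_list_rotate_independent[OF dM, of "length A"] rotate_append[of A "p # B"] AB by simp
  have dist: "distinct (p # ys @ B @ A)" using dM ys AB by auto
  have "cycle_of_list (p # ys) \<circ> cycle_of_list (p # B @ A) = cycle_of_list (p # (B @ A) @ ys)"
    by (rule cycle_of_list_join) (use dist in auto)
  then have M': "cycle_of_list (p # (B @ A) @ ys) = cycle_of_list (p # ys) \<circ> cycle_of_list M" using rot by simp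
  have com: "cycle_of_list [x, y] \<circ> cycle_of_list (p # ys) = cycle_of_list (p # ys) \<circ> cycle_of_list [x, y]"
    "cycle_of_list [z, w] \<circ> cycle_of_list (p # ys) = cycle_of_list (p # ys) \<circ> cycle_of_list [z, w]"
    using d ys p dist by (intro cycles_commute; auto)+
  have "double_swap [x, y, z, w] (p # (B @ A) @ ys) = cycle_of_list [x, y] \<circ> (cycle_of_list [z, w] \<circ> cycle_of_list (p # ys)) \<circ> cycle_of_list M"
    unfolding double_swap.simps cycs_simps M' by (simp only: comp_assoc comp_id)
  also have "\<dots> = cycle_of_list (p # ys) \<circ> double_swap [x, y, z, w] M"
    unfolding double_swap.simps cycs_simps com(2) comp_id comp_assoc[symmetric] com(1) ..
  finally show thesis by (intro that[of "p # (B @ A) @ ys"]) (use dist AB in auto)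
qed

text \<open>Both long cycles grow at the same point p. Their length stays odd because k is even, and
  \<open>compatible\<close> only gains from larger long cycles.\<close>

lemma configuration_join:
  assumes st: "configuration n G F M G' F' N" and p: "p \<in> set M" "p \<in> set N"
    and ys: "distinct ys" "distinct zs" "set ys = {n+1..n+k}" "set zs = {n+1..n+k}" and "even k"
  obtains M' N' where "configuration (n + k) G F M' G' F' N'" "set M' = set M \<union> {n+1..n+k}" "set N' = set N \<union> {n+1..n+k}"
    "double_swap G M' = cycle_of_list (p # ys) \<circ> double_swap G M" "double_swap G' N' = cycle_of_list (p # zs) \<circ> double_swap G' N"
proof -
  have d: "distinct (G @ F @ M)" "distinct (G' @ F' @ N)" "set (G @ F @ M) = {1..n}" "set (G' @ F' @ N) = {1..n}"
    and r: "length F = length F'" "length F \<le> 1" "set F \<inter> set F' = {}" "odd (length M)"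
      "set M \<inter> set N \<noteq> {}" and compatible: "compatible G G' M N"
    using st by (auto simp: configuration_def)
  obtain x y z w x' y' z' w' where G: "G = [x, y, z, w]" and G': "G' = [x', y', z', w']"
    using compatible by (cases rule: compatible_cases) auto
  have len: "length ys = k" "length zs = k" using ys distinct_card[of ys] distinct_card[of zs] by auto
  have new: "set ys \<inter> set (G @ F @ M) = {}" "set zs \<inter> set (G' @ F' @ N) = {}"
    unfolding d(3,4) ys(3,4) by auto
  obtain M' where M': "distinct M'" "set M' = set M \<union> set ys" "length M' = length M + length ys"
    "double_swap [x, y, z, w] M' = cycle_of_list (p # ys) \<circ> double_swap [x, y, z, w] M"
    by (rule double_swap_join[of x y z w M p ys]) (use d G p ys(1) new in auto)
  obtain N' where N': "distinct N'" "set N' = set N \<union> set zs" "length N' = length N + length zs"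
    "double_swap [x', y', z', w'] N' = cycle_of_list (p # zs) \<circ> double_swap [x', y', z', w'] N"
    by (rule double_swap_join[of x' y' z' w' N p zs]) (use d G' p ys(2) new in auto)
  have un: "{1..n + k} = {1..n} \<union> {n+1..n+k}" by auto
  have "distinct (G @ F @ M')" "distinct (G' @ F' @ N')" using d new M'(1,2) N'(1,2) by auto
  moreover have "set (G @ F @ M') = {1..n + k}" "set (G' @ F' @ N') = {1..n + k}"
    unfolding un d(3)[symmetric] ys(3)[symmetric] using M'(2) apply auto[1]
    unfolding d(3) ys(3) d(4)[symmetric] ys(4)[symmetric] using N'(2) by auto[1]
  moreover have "compatible G G' M' N'"
    using compatible M'(2) N'(2) by (cases rule: compatible_cases) auto
  ultimately have "configuration (n + k) G F M' G' F' N'"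
    unfolding configuration_def using r M'(2,3) N'(2) len assms(8) by auto
  then show thesis using that M' N' G G' ys by simp
qed

text \<open>A cycle is flagged (its length belongs to \<open>S\<close>) if it contains a point \<open>q\<close> of the long cycle \<open>N\<close> whose
  image lies in \<open>M\<close> as well: there the cycle can be prolonged by two new points.\<close>

definition realizable :: "nat multiset \<Rightarrow> nat multiset \<Rightarrow> bool"
  where "realizable U S \<longleftrightarrow> (\<exists>n G F M G' F' N uss sss. configuration n G F M G' F' N \<and>
    distinct (concat (uss @ sss)) \<and> set (concat (uss @ sss)) = {1..n} \<and>
    double_swap G M \<circ> cycs (uss @ sss) = double_swap G' N \<and>
    mset (map length uss) = U \<and> mset (map length sss) = S \<and>
    (\<forall>cs\<in>set sss. \<exists>q\<in>set cs. q \<in> set N \<and> double_swap G' N q \<in> set M))"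

lemma realizableE:
  assumes "realizable U S"
  obtains n G F M G' F' N uss sss where "configuration n G F M G' F' N"
    "distinct (concat (uss @ sss))" "set (concat (uss @ sss)) = {1..n}"
    "double_swap G M \<circ> cycs (uss @ sss) = double_swap G' N"
    "mset (map length uss) = U" "mset (map length sss) = S"
    "\<forall>cs\<in>set sss. \<exists>q\<in>set cs. q \<in> set N \<and> double_swap G' N q \<in> set M"
  using assms unfolding realizable_def by blast

lemma realizable_gen_commutator:
  assumes "realizable U S" "distinct (concat dss)" "set (concat dss) = {1..n}" "mset (map length dss) = U + S"
  shows "gen_commutator n (cycs dss)"
proof -
  obtain m G F M G' F' N uss sss where st: "configuration m G F M G' F' N"
    and c: "distinct (concat (uss @ sss))" "set (concat (uss @ sss)) = {1..m}"
    "double_swap G M \<circ> cycs (uss @ sss) = double_swap G' N"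
    and l: "mset (map length uss) = U" "mset (map length sss) = S"
    using realizableE[OF assms(1)] by metis
  have len: "mset (map length (uss @ sss)) = mset (map length dss)" using l assms(4) by simp
  have "length (concat ess) = sum_mset (mset (map length ess))" for ess :: "nat list list"
    by (induction ess) auto
  then have "length (concat (uss @ sss)) = length (concat dss)" using len by metis
  then have mn: "m = n" using distinct_card[OF c(1)] distinct_card[OF assms(2)] c(2) assms(3) by simp
  have "bij (double_swap G M)" using double_swap_permutes_points permutes_bij by blast
  then have "inv' (double_swap G M) \<circ> double_swap G' N = cycs (uss @ sss)"
    unfolding c(3)[symmetric] by (auto simp: fun_eq_iff bij_is_inj)
  then have "gen_commutator n (cycs (uss @ sss))" using configuration_gen_commutator[OF st] mn by simp
  then show ?thesis using gen_commutator_same_type[OF _ c(1) assms(2)] c(2) assms(3) mn len by simp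
qed

lemma realizableI:
  assumes "configuration n G F M G' F' N" "distinct (concat (uss @ sss))" "set (concat (uss @ sss)) = {1..n}"
    "double_swap G M \<circ> cycs (uss @ sss) = double_swap G' N"
    "\<forall>cs\<in>set sss. \<exists>q\<in>set cs. q \<in> set N \<and> double_swap G' N q \<in> set M"
    "mset (map length uss) = U" "mset (map length sss) = S"
  shows "realizable U S"
  unfolding realizable_def by (intro exI conjI) (fact assms)+

lemma realizable_unflag:
  assumes "realizable U (add_mset k S)"
  shows "realizable (add_mset k U) S"
proof -
  obtain n G F M G' F' N uss sss where st: "configuration n G F M G' F' N"
    and c: "distinct (concat (uss @ sss))" "set (concat (uss @ sss)) = {1..n}"
    "double_swap G M \<circ> cycs (uss @ sss) = double_swap G' N"
    and l: "mset (map length uss) = U" "mset (map length sss) = add_mset k S"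
    and e: "\<forall>cs\<in>set sss. \<exists>q\<in>set cs. q \<in> set N \<and> double_swap G' N q \<in> set M"
    using assms by (elim realizableE) blast
  have "k \<in> set (map length sss)" using l(2) by (metis set_mset_mset union_single_eq_member)
  then obtain s1 cs s2 where s: "sss = s1 @ cs # s2" "length cs = k" by (auto dest: split_list)
  let ?u = "cs # uss" and ?s = "s1 @ s2"
  have d: "distinct (concat (?u @ ?s))" using c(1) s by auto
  have eq: "cycs (?u @ ?s) = cycs (uss @ sss)" by (rule cycs_cong_set[OF d c(1)]) (use s in auto)
  have set: "set (concat (?u @ ?s)) = {1..n}" unfolding c(2)[symmetric] s(1) by auto
  show ?thesis
    by (rule realizableI[OF st d set]) (use eq c(3) l e s in auto)
qed

text \<open>Flags survive the insertion: values of a' change only inside the cycle (p zs), all of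
  whose points lie on the new M. A new point is fixed by the old a', so every cycle through a new
  point is flagged too.\<close>

lemma realizable_join:
  assumes st: "configuration n G F M G' F' N" and p: "p \<in> set M" "p \<in> set N"
    and ys: "distinct ys" "distinct zs" "set ys = {n+1..n+k}" "set zs = {n+1..n+k}" "even k"
    and c: "distinct (concat (uss @ sss))" "set (concat (uss @ sss)) = {1..n+k}"
      "cycle_of_list (p # ys) \<circ> double_swap G M \<circ> cycs (uss @ sss) = cycle_of_list (p # zs) \<circ> double_swap G' N"
    and e: "\<forall>cs\<in>set sss. \<exists>q\<in>set cs. q \<in> set N \<and> double_swap G' N q \<in> set M \<or> q \<in> {n+1..n+k}"
    and l: "mset (map length uss) = U" "mset (map length sss) = S"
  shows "realizable U S"
proof -
  obtain M' N' where st': "configuration (n + k) G F M' G' F' N'"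
    and sets: "set M' = set M \<union> {n+1..n+k}" "set N' = set N \<union> {n+1..n+k}"
    and double_swap: "double_swap G M' = cycle_of_list (p # ys) \<circ> double_swap G M" "double_swap G' N' = cycle_of_list (p # zs) \<circ> double_swap G' N"
    using configuration_join[OF st p ys] by metis
  have GN: "set G' \<union> set N \<subseteq> {1..n}" using st unfolding configuration_def by auto
  have stable: "double_swap G' N' q \<in> set M'" if "double_swap G' N q \<in> set M \<or> double_swap G' N q \<in> {n+1..n+k}" for q
  proof (cases "double_swap G' N q \<in> set (p # zs)")
    case True
    then have "double_swap G' N' q \<in> set (p # zs)"
      unfolding double_swap comp_apply using permutes_in_image[OF cycle_permutes] by metis
    then show ?thesis using sets p(1) ys(4) by auto
  next
    case False
    then have "double_swap G' N' q = double_swap G' N q" unfolding double_swap comp_apply by (rule id_outside_supp)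
    then show ?thesis using that sets by auto
  qed
  have "\<exists>q\<in>set cs. q \<in> set N' \<and> double_swap G' N' q \<in> set M'" if cs: "cs \<in> set sss" for cs
  proof -
    obtain q where q: "q \<in> set cs" "q \<in> set N \<and> double_swap G' N q \<in> set M \<or> q \<in> {n+1..n+k}" using bspec[OF e cs] by (elim bexE)
    have "double_swap G' N q = q" if "q \<in> {n+1..n+k}"
    proof -
      have "q \<notin> {1..n}" using that by simp
      then have "q \<notin> set G' \<union> set N" using GN by blast
      then show ?thesis by (rule permutes_not_in[OF double_swap_permutes_points])
    qed
    then have "double_swap G' N q \<in> set M \<or> double_swap G' N q \<in> {n+1..n+k}" using q(2) by metis
    then show ?thesis using stable q sets(2) by blast
  qed
  moreover have "double_swap G M' \<circ> cycs (uss @ sss) = double_swap G' N'" unfolding double_swap by (rule c(3))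
  ultimately show ?thesis using realizableI[OF st' c(1,2)] l by blast
qed

text \<open>Multiplying a and a' on the left by the same cycle (p n+1 n+2) leaves a^{-1} a'
  unchanged, so the new points are fixed by it.\<close>

lemma realizable_two_fixed:
  assumes "realizable U S"
  shows "realizable U (add_mset 1 (add_mset 1 S))"
proof -
  obtain n G F M G' F' N uss sss where st: "configuration n G F M G' F' N"
    and c: "distinct (concat (uss @ sss))" "set (concat (uss @ sss)) = {1..n}"
    "double_swap G M \<circ> cycs (uss @ sss) = double_swap G' N"
    and l: "mset (map length uss) = U" "mset (map length sss) = S"
    and e: "\<forall>cs\<in>set sss. \<exists>q\<in>set cs. q \<in> set N \<and> double_swap G' N q \<in> set M"
    using assms by (elim realizableE) blast
  obtain p where p: "p \<in> set M" "p \<in> set N" using st by (auto simp: configuration_def)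
  let ?ys = "[n + 1, n + 2]" and ?s = "[n + 1] # [n + 2] # sss"
  have ys: "distinct ?ys" "set ?ys = {n+1..n+2}" by auto
  have d: "distinct (concat (uss @ ?s))"
  proof -
    have "n + 1 \<notin> set (concat (uss @ sss))" "n + 2 \<notin> set (concat (uss @ sss))" unfolding c(2) by auto
    then show ?thesis using c(1) by auto
  qed
  have eq: "cycs (uss @ ?s) = cycs (uss @ sss)"
    unfolding cycs_def by (simp add: id_def[symmetric])
  have set: "set (concat (uss @ ?s)) = {1..n + 2}"
  proof -
    have "{1..n + 2} = {1..n} \<union> {n + 1, n + 2}" by auto
    then show ?thesis unfolding c(2)[symmetric] by auto
  qed
  show ?thesis
  proof (rule realizable_join[OF st p ys(1) ys(1) ys(2) ys(2) _ d set])
    show "cycle_of_list (p # ?ys) \<circ> double_swap G M \<circ> cycs (uss @ ?s) = cycle_of_list (p # ?ys) \<circ> double_swap G' N"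
      unfolding eq c(3)[symmetric] by (simp only: comp_assoc)
    show "\<forall>cs\<in>set ?s. \<exists>q\<in>set cs. q \<in> set N \<and> double_swap G' N q \<in> set M \<or> q \<in> {n+1..n+2}"
      using e by auto
  qed (use l in auto)
qed

text \<open>The 5-cycle (p n+1 n+2 n+3 n+4) times the double transposition (n+1 n+3)(n+2 n+4) is
  again a 5-cycle through p. The double transposition commutes with a', so inserting the two
  5-cycles adds exactly this factor to a^{-1} a'.\<close>

lemma realizable_two_transpositions:
  assumes "realizable U S"
  shows "realizable U (add_mset 2 (add_mset 2 S))"
proof -
  obtain n G F M G' F' N uss sss where st: "configuration n G F M G' F' N"
    and c: "distinct (concat (uss @ sss))" "set (concat (uss @ sss)) = {1..n}"
    "double_swap G M \<circ> cycs (uss @ sss) = double_swap G' N"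
    and l: "mset (map length uss) = U" "mset (map length sss) = S"
    and e: "\<forall>cs\<in>set sss. \<exists>q\<in>set cs. q \<in> set N \<and> double_swap G' N q \<in> set M"
    using assms by (elim realizableE) blast
  obtain p where p: "p \<in> set M" "p \<in> set N" using st by (auto simp: configuration_def)
  let ?ys = "[n + 1, n + 2, n + 3, n + 4]" and ?zs = "[n + 1, n + 4, n + 3, n + 2]"
    and ?s = "sss @ [[n + 1, n + 3], [n + 2, n + 4]]"
  let ?k = "cycs [[n + 1, n + 3], [n + 2, n + 4]]"
  have ys: "distinct ?ys" "distinct ?zs" "set ?ys = {n+1..n+4}" "set ?zs = {n+1..n+4}" by auto
  have new: "v \<notin> set (concat (uss @ sss))" if "v \<in> {n+1..n+4}" for v unfolding c(2) using that by auto
  have d: "distinct (concat (uss @ ?s))"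
    using c(1) new[of "n+1"] new[of "n+2"] new[of "n+3"] new[of "n+4"] by auto
  have append: "cycs (xs @ ys) = cycs xs \<circ> cycs ys" for xs ys :: "nat list list"
    by (induction xs) (auto simp: fun_eq_iff)
  have set: "set (concat (uss @ ?s)) = {1..n + 4}"
  proof -
    have "{1..n + 4} = {1..n} \<union> {n+1..n+4}" by auto
    then show ?thesis unfolding c(2)[symmetric] ys(3)[symmetric] by auto
  qed
  have GN: "set G' \<union> set N \<subseteq> {1..n}" "set M \<subseteq> {1..n}" using st unfolding configuration_def by auto
  have "double_swap G' N permutes {1..n}" using permutes_subset[OF double_swap_permutes_points GN(1)] .
  moreover have "?k permutes {n+1..n+4}"
    using permutes_subset[OF cycs_permutes[of "[[n + 1, n + 3], [n + 2, n + 4]]"], of "{n+1..n+4}"] by simp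
  ultimately have com: "double_swap G' N \<circ> ?k = ?k \<circ> double_swap G' N"
    by (rule permutes_disjoint_commute) auto
  have pn: "p \<le> n" using p(1) GN(2) by auto
  have prod: "cycle_of_list (p # ?ys) \<circ> ?k = cycle_of_list (p # ?zs)" (is "?l = ?r")
  proof
    fix v
    have "v = p \<or> v = n + 1 \<or> v = n + 2 \<or> v = n + 3 \<or> v = n + 4 \<or> v \<notin> set (p # ?ys)" by auto
    then show "?l v = ?r v" using pn by (elim disjE) (simp_all add: transpose_def)
  qed
  show ?thesis
  proof (rule realizable_join[OF st p ys _ d set])
    have "cycle_of_list (p # ?ys) \<circ> double_swap G M \<circ> cycs (uss @ ?s) = cycle_of_list (p # ?ys) \<circ> (double_swap G M \<circ> cycs (uss @ sss)) \<circ> ?k"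
      unfolding append[of "uss @ sss" "[[n + 1, n + 3], [n + 2, n + 4]]", unfolded append_assoc] by (simp only: comp_assoc)
    also have "\<dots> = cycle_of_list (p # ?zs) \<circ> double_swap G' N"
      unfolding c(3) comp_assoc com prod[symmetric] ..
    finally show "cycle_of_list (p # ?ys) \<circ> double_swap G M \<circ> cycs (uss @ ?s) = cycle_of_list (p # ?zs) \<circ> double_swap G' N" .
    show "\<forall>cs\<in>set ?s. \<exists>q\<in>set cs. q \<in> set N \<and> double_swap G' N q \<in> set M \<or> q \<in> {n+1..n+4}"
      using e by auto
    show "mset (map length ?s) = add_mset 2 (add_mset 2 S)" using l by (simp add: numeral_2_eq_2)
  qed (use l in auto)
qed

text \<open>Multiplying by (q n+1 n+2) on the right prolongs the cycle through q. Conjugation by a'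
  turns this factor into (p n+1 n+2) with p = a' q, and the square of that 3-cycle is (p n+2 n+1).
  So a and a' receive a 3-cycle and its inverse, both at p; a flag is exactly what puts p on both
  long cycles.\<close>

lemma realizable_lengthen:
  assumes "realizable U (add_mset k S)"
  shows "realizable U (add_mset (k + 2) S)"
proof -
  obtain n G F M G' F' N uss sss where st: "configuration n G F M G' F' N"
    and c: "distinct (concat (uss @ sss))" "set (concat (uss @ sss)) = {1..n}"
    "double_swap G M \<circ> cycs (uss @ sss) = double_swap G' N"
    and l: "mset (map length uss) = U" "mset (map length sss) = add_mset k S"
    and e: "\<forall>cs\<in>set sss. \<exists>q\<in>set cs. q \<in> set N \<and> double_swap G' N q \<in> set M"
    using assms by (elim realizableE) blast
  have "k \<in> set (map length sss)" using l(2) by (metis set_mset_mset union_single_eq_member)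
  then obtain s1 cs s2 where s: "sss = s1 @ cs # s2" "length cs = k" by (auto dest: split_list)
  obtain q where q: "q \<in> set cs" "q \<in> set N" "double_swap G' N q \<in> set M" using e s by auto
  obtain A B where cs: "cs = A @ q # B" using q(1) by (meson split_list)
  define p where "p = double_swap G' N q"
  have pN: "p \<in> set N"
  proof -
    obtain x' y' z' w' where G': "G' = [x', y', z', w']" using st by (auto simp: configuration_def elim!: compatible_cases)
    have dN: "distinct ([x', y', z', w'] @ N)" using st G' by (auto simp: configuration_def)
    have "p = cycle_of_list N q" unfolding p_def G' by (rule double_swap_apply_cycle[OF dN q(2)])
    then show ?thesis using permutes_in_image[OF cycle_permutes, of N q] q(2) by simp
  qed
  have p: "p \<in> set M" "p \<in> set N" using q(3) pN by (auto simp: p_def)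
  let ?rest = "uss @ s1 @ s2" and ?cs = "q # [n + 1, n + 2] @ B @ A"
  let ?ys = "[n + 1, n + 2]" and ?zs = "[n + 2, n + 1]" and ?s = "?cs # s1 @ s2"
  let ?k = "cycle_of_list [q, n + 1, n + 2]"
  have ys: "distinct ?ys" "distinct ?zs" "set ?ys = {n+1..n+2}" "set ?zs = {n+1..n+2}" by auto
  have new: "v \<notin> set (concat (uss @ sss))" if "v \<in> {n+1..n+2}" for v unfolding c(2) using that by auto
  have d0: "distinct (concat (cs # ?rest))"
    by (rule distinct_concat_mset[OF c(1)]) (simp add: s)
  then have dcs: "distinct cs" and drest: "distinct (concat ?rest)"
    and disj: "set cs \<inter> set (concat ?rest) = {}" by simp_all
  have "set (concat (uss @ sss)) = set cs \<union> set (concat ?rest)" using s by auto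
  then have fresh: "n + 1 \<notin> set cs \<union> set (concat ?rest)" "n + 2 \<notin> set cs \<union> set (concat ?rest)"
    using new[of "n + 1"] new[of "n + 2"] by auto
  have "distinct ?cs" using dcs fresh cs by auto
  moreover have "set ?cs \<inter> set (concat ?rest) = {}" using disj fresh unfolding cs by auto
  ultimately have d1: "distinct (concat (?cs # ?rest))" using drest by (simp only: concat.simps distinct_append simp_thms)
  have d: "distinct (concat (uss @ ?s))"
    by (rule distinct_concat_mset[OF d1]) simp
  have set: "set (concat (uss @ ?s)) = {1..n + 2}"
  proof -
    have "{1..n + 2} = {1..n} \<union> {n+1, n+2}" by auto
    then show ?thesis unfolding c(2)[symmetric] s cs by auto
  qed
  have c0: "cycs (uss @ sss) = cycle_of_list cs \<circ> cycs ?rest"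
    using cycs_cong_set[OF c(1) d0] s by auto
  have c1: "cycs (uss @ ?s) = cycle_of_list ?cs \<circ> cycs ?rest"
    using cycs_cong_set[OF d d1] by auto
  have rot: "cycle_of_list cs = cycle_of_list (q # B @ A)"
    using cycle_of_list_rotate_independent[OF dcs, of "length A"] rotate_append[of A "q # B"] cs by simp
  have "cycle_of_list (q # B @ A) \<circ> ?k = cycle_of_list ?cs"
    by (rule cycle_of_list_join) (use d1 in auto)
  then have k: "cycle_of_list ?cs = cycle_of_list cs \<circ> ?k" using rot by simp
  have com: "?k \<circ> cycs ?rest = cycs ?rest \<circ> ?k"
    by (rule permutes_disjoint_commute[OF cycle_permutes cycs_permutes]) (use d1 in auto)
  have GN: "set G' \<union> set N \<subseteq> {1..n}" "set M \<subseteq> {1..n}" using st unfolding configuration_def by auto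
  have A'p: "double_swap G' N permutes {1..n}" using permutes_subset[OF double_swap_permutes_points GN(1)] .
  have fix': "double_swap G' N v = v" if "v > n" for v using permutes_not_in[OF A'p, of v] that by simp
  have bij: "bij (double_swap G' N)" using A'p permutes_bij by blast
  have qn: "q \<le> n" "p \<le> n" using q(2) p(1) GN by auto
  have "double_swap G' N \<circ> ?k \<circ> inv' (double_swap G' N) = cycle_of_list (map (double_swap G' N) [q, n + 1, n + 2])"
    by (rule conjugation_of_cycle[OF _ bij]) (use qn in auto)
  also have "map (double_swap G' N) [q, n + 1, n + 2] = [p, n + 1, n + 2]" using fix' by (simp add: p_def)
  finally have kk: "double_swap G' N \<circ> ?k = cycle_of_list [p, n + 1, n + 2] \<circ> double_swap G' N"
    using bij by (metis bij_is_inj comp_assoc comp_id inv_o_cancel)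
  have prod: "cycle_of_list (p # ?ys) \<circ> cycle_of_list [p, n + 1, n + 2] = cycle_of_list (p # ?zs)" (is "?l = ?r")
  proof
    fix v
    have "v = p \<or> v = n + 1 \<or> v = n + 2 \<or> v \<notin> set (p # ?ys)" by auto
    then show "?l v = ?r v" using qn by (elim disjE) (simp_all add: transpose_def)
  qed
  show ?thesis
  proof (rule realizable_join[OF st p ys _ d set])
    have "cycle_of_list (p # ?ys) \<circ> double_swap G M \<circ> cycs (uss @ ?s)
        = cycle_of_list (p # ?ys) \<circ> double_swap G M \<circ> (cycle_of_list cs \<circ> (?k \<circ> cycs ?rest))"
      unfolding c1 k by (simp only: comp_assoc)
    also have "\<dots> = cycle_of_list (p # ?ys) \<circ> (double_swap G M \<circ> cycs (uss @ sss)) \<circ> ?k"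
      unfolding com c0 by (simp only: comp_assoc)
    also have "\<dots> = cycle_of_list (p # ?ys) \<circ> (double_swap G' N \<circ> ?k)"
      unfolding c(3) by (simp only: comp_assoc)
    also have "\<dots> = cycle_of_list (p # ?zs) \<circ> double_swap G' N"
      unfolding kk prod[symmetric] by (simp only: comp_assoc)
    finally show "cycle_of_list (p # ?ys) \<circ> double_swap G M \<circ> cycs (uss @ ?s) = cycle_of_list (p # ?zs) \<circ> double_swap G' N" .
    show "\<forall>cs\<in>set ?s. \<exists>q\<in>set cs. q \<in> set N \<and> double_swap G' N q \<in> set M \<or> q \<in> {n+1..n+2}"
      using e s by auto
    show "mset (map length ?s) = add_mset (k + 2) S" using l(2) s cs by auto
  qed (use l in auto)
qed

section \<open>Checking configurations by computation\<close>

lemma set_eq_atLeastAtMost: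
  assumes "distinct xs" "length xs = n" "list_all (\<lambda>v. 1 \<le> v \<and> v \<le> n) xs"
  shows "set xs = {1..n}"
proof (rule card_subset_eq)
  show "set xs \<subseteq> {1..n}" using assms(3) by (auto simp: list_all_iff)
  show "card (set xs) = card {1..n}" using distinct_card[OF assms(1)] assms(2) by simp
qed simp

text \<open>A cycle is evaluated by one scan of its list. The first argument is the successor of the
  last entry; it is passed along because the recursion loses the head of the cycle.\<close>

fun next_in :: "nat \<Rightarrow> nat list \<Rightarrow> nat \<Rightarrow> nat"
  where "next_in d [] x = x"
  | "next_in d [a] x = (if x = a then d else x)"
  | "next_in d (a # b # cs) x = (if x = a then b else next_in d (b # cs) x)"

fun apply_cycles :: "nat list list \<Rightarrow> nat \<Rightarrow> nat"
  where "apply_cycles [] x = x"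
  | "apply_cycles ([] # css) x = apply_cycles css x"
  | "apply_cycles ((a # cs) # css) x = next_in a (a # cs) (apply_cycles css x)"

fun agree_on :: "nat list list \<Rightarrow> nat list list \<Rightarrow> nat list list \<Rightarrow> nat list \<Rightarrow> bool"
  where "agree_on A C B [] \<longleftrightarrow> True"
  | "agree_on A C B (v # vs) \<longleftrightarrow> apply_cycles A (apply_cycles C v) = apply_cycles B v \<and> agree_on A C B vs"

text \<open>This is the inductive step in the comparison with \<open>cycle_of_list\<close>, a
  product of transpositions of neighbours: the outer transposition redirects only the last entry,
  from j to i.\<close>

lemma next_in_transpose:
  assumes "x \<noteq> i" "x \<in> set l \<or> x \<noteq> j" "set (tl l) \<inter> {i, j} = {}"
  shows "transpose i j (next_in j l x) = next_in i l x"
  using assms by (induction i l x rule: next_in.induct) (auto simp: transpose_def split: if_splits)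

lemma next_in_outside: "x \<notin> set l \<Longrightarrow> next_in d l x = x"
  by (induction d l x rule: next_in.induct) auto

lemma cycle_of_list_next_in: "distinct (a # cs) \<Longrightarrow> cycle_of_list (a # cs) x = next_in a (a # cs) x"
proof (induction cs arbitrary: a x)
  case (Cons b cs)
  have IH: "cycle_of_list (b # cs) x = next_in b (b # cs) x" using Cons by simp
  show ?case
  proof (cases "x = a")
    case True
    then show ?thesis using IH next_in_outside[of a "b # cs" b] Cons.prems by simp
  next
    case False
    have "transpose a b (next_in b (b # cs) x) = next_in a (b # cs) x" if "x \<in> set (b # cs) \<or> x \<noteq> b"
      by (rule next_in_transpose) (use False Cons.prems that in auto)
    then show ?thesis using IH False by auto
  qed
qed simp

lemma cycs_apply_cycles: "distinct (concat css) \<Longrightarrow> cycs css x = apply_cycles css x"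
  by (induction css x rule: apply_cycles.induct)
    (auto simp: cycle_of_list_next_in simp del: cycle_of_list.simps(1,3) next_in.simps)

lemma agree_on_iff:
  assumes "distinct (concat A)" "distinct (concat B)" "distinct (concat C)"
  shows "agree_on A C B vs \<longleftrightarrow> (\<forall>v\<in>set vs. cycs A (cycs C v) = cycs B v)"
  by (induction vs) (simp_all add: cycs_apply_cycles assms)

definition perm_list :: "nat \<Rightarrow> nat list \<Rightarrow> bool"
  where "perm_list n xs \<longleftrightarrow> distinct xs \<and> length xs = n \<and> list_all (\<lambda>v. 1 \<le> v \<and> v \<le> n) xs"

fun gadget_cycles :: "nat list \<Rightarrow> nat list \<Rightarrow> nat list list"
  where "gadget_cycles [x, y, z, w] M = [[x, y], [z, w], M]"
  | "gadget_cycles _ M = []"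

text \<open>The tables write each flagged cycle with its flagging point in front, so that no search
  is necessary.\<close>

fun heads_ok :: "nat list \<Rightarrow> nat list \<Rightarrow> nat list list \<Rightarrow> nat list list \<Rightarrow> bool"
  where "heads_ok M N B [] \<longleftrightarrow> True"
  | "heads_ok M N B ([] # css) \<longleftrightarrow> False"
  | "heads_ok M N B ((q # cs) # css) \<longleftrightarrow> q \<in> set N \<and> apply_cycles B q \<in> set M \<and> heads_ok M N B css"

type_synonym witness = "nat list \<times> nat list \<times> nat list \<times> nat list \<times> nat list \<times> nat list list \<times> nat list list"

text \<open>Relabelling makes G equal to [1, 2, 3, 4] in all witnesses, which is why it is not
  stored.\<close>

fun witness_ok :: "nat \<Rightarrow> witness \<Rightarrow> bool"
  where "witness_ok n (F, M, G', F', N, uss, sss) \<longleftrightarrow>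
    perm_list n ([1, 2, 3, 4] @ F @ M) \<and> perm_list n (G' @ F' @ N) \<and> perm_list n (concat (uss @ sss)) \<and>
    length F = length F' \<and> length F \<le> 1 \<and> list_all (\<lambda>v. v \<notin> set F') F \<and> odd (length M) \<and>
    list_ex (\<lambda>v. v \<in> set N) M \<and> compatible [1, 2, 3, 4] G' M N \<and>
    agree_on [[1, 2], [3, 4], M] (uss @ sss) (gadget_cycles G' N) (concat (uss @ sss)) \<and>
    heads_ok M N (gadget_cycles G' N) sss"

lemma heads_okD:
  assumes "heads_ok M N B sss" "distinct (concat B)" "cs \<in> set sss"
  shows "\<exists>q\<in>set cs. q \<in> set N \<and> cycs B q \<in> set M"
  using assms by (induction M N B sss rule: heads_ok.induct) (auto simp: cycs_apply_cycles)

lemma witness_ok_realizable: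
  assumes "witness_ok n (F, M, G', F', N, uss, sss)"
  shows "realizable (mset (map length uss)) (mset (map length sss))"
proof -
  have sets: "set ([1, 2, 3, 4] @ F @ M) = {1..n}" "set (G' @ F' @ N) = {1..n}" "set (concat (uss @ sss)) = {1..n}"
    and d: "distinct ([1, 2, 3, 4] @ F @ M)" "distinct (G' @ F' @ N)" "distinct (concat (uss @ sss))"
    using assms set_eq_atLeastAtMost unfolding witness_ok.simps perm_list_def by metis+
  have compatible: "compatible [1, 2, 3, 4] G' M N" using assms by simp
  then obtain x y z w where G': "G' = [x, y, z, w]" by (cases rule: compatible_cases) auto
  have dc: "distinct (concat [[1, 2], [3, 4], M])" "distinct (concat (gadget_cycles G' N))" using d(1,2) G' by auto
  have double_swap: "double_swap [1, 2, 3, 4] M = cycs [[1, 2], [3, 4], M]" "double_swap G' N = cycs (gadget_cycles G' N)"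
    using G' by (simp_all only: double_swap.simps gadget_cycles.simps)
  have ag: "agree_on [[1, 2], [3, 4], M] (uss @ sss) (gadget_cycles G' N) (concat (uss @ sss))"
    and hd: "heads_ok M N (gadget_cycles G' N) sss"
    using assms unfolding witness_ok.simps by blast+
  have eq: "double_swap [1, 2, 3, 4] M (cycs (uss @ sss) v) = double_swap G' N v" if "v \<in> {1..n}" for v
    using ag that unfolding agree_on_iff[OF dc d(3)] sets(3) double_swap by blast
  have r: "length F = length F'" "length F \<le> 1" "set F \<inter> set F' = {}" "odd (length M)" "set M \<inter> set N \<noteq> {}"
    using assms by (auto simp: list_all_iff list_ex_iff)
  have e: "\<forall>cs\<in>set sss. \<exists>q\<in>set cs. q \<in> set N \<and> double_swap G' N q \<in> set M"
    using heads_okD[OF hd dc(2)] unfolding double_swap by blast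
  have st: "configuration n [1, 2, 3, 4] F M G' F' N"
    unfolding configuration_def by (intro conjI sets d r compatible)
  have sub: "set [1, 2, 3, 4] \<union> set M \<subseteq> {1..n}" unfolding sets(1)[symmetric] by auto
  have sub': "set G' \<union> set N \<subseteq> {1..n}" unfolding sets(2)[symmetric] by auto
  have "double_swap [1, 2, 3, 4] M \<circ> cycs (uss @ sss) = double_swap G' N"
  proof
    fix v
    show "(double_swap [1, 2, 3, 4] M \<circ> cycs (uss @ sss)) v = double_swap G' N v"
    proof (cases "v \<in> {1..n}")
      case False
      then have "cycs (uss @ sss) v = v" using cycs_outside[of v "uss @ sss"] sets(3) by metis
      moreover have "double_swap [1, 2, 3, 4] M v = v"
        by (rule permutes_not_in[OF double_swap_permutes_points]) (use False sub in blast)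
      moreover have "double_swap G' N v = v"
        by (rule permutes_not_in[OF double_swap_permutes_points]) (use False sub' in blast)
      ultimately show ?thesis by simp
    qed (use eq in simp)
  qed
  then show ?thesis using realizableI[OF st d(3) sets(3) _ e] by blast
qed

section \<open>Enumeration of partitions and the coverage test for the tables\<close>

fun part_lists :: "nat \<Rightarrow> nat \<Rightarrow> nat \<Rightarrow> nat list list"
  where "part_lists 0 n m = (if n = 0 then [[]] else [])"
  | "part_lists (Suc d) n m =
      (if n = 0 then [[]] else concat (map (\<lambda>k. map ((#) k) (part_lists d (n - k) k)) [1..<Suc (min n m)]))"

text \<open>The enumerated lists are the partitions in weakly decreasing order. The first argument
  bounds the number of parts and makes the recursion structural, so the degree itself is always a
  large enough value.\<close>

lemma part_lists_complete:
  assumes "sorted_wrt (\<ge>) t" "\<forall>k\<in>set t. 1 \<le> k \<and> k \<le> m" "sum_list t \<le> d"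
  shows "t \<in> set (part_lists d (sum_list t) m)"
  using assms
proof (induction d arbitrary: t m)
  case 0
  then show ?case by (cases t) auto
next
  case (Suc d)
  show ?case
  proof (cases t)
    case (Cons k t')
    have k: "1 \<le> k" "k \<le> m" using Suc.prems(2) Cons by auto
    have "t' \<in> set (part_lists d (sum_list t') k)"
      by (rule Suc.IH) (use Suc.prems Cons k in auto)
    then show ?thesis using k Cons by (auto simp del: upt_Suc intro!: image_eqI bexI[of _ k])
  qed simp
qed

fun sublist_ms :: "nat list \<Rightarrow> nat list \<Rightarrow> bool"
  where "sublist_ms [] ys \<longleftrightarrow> True"
  | "sublist_ms (x # xs) ys \<longleftrightarrow> x \<in> set ys \<and> sublist_ms xs (remove1 x ys)"

lemma sublist_ms_iff: "sublist_ms xs ys \<longleftrightarrow> mset xs \<subseteq># mset ys"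
proof (induction xs arbitrary: ys)
  case (Cons x xs)
  then show ?case
    by (auto simp: insert_subset_eq_iff)
qed simp

text \<open>An even number of even parts characterizes the cycle types of even permutations.\<close>

definition even_moving_parts :: "nat list \<Rightarrow> bool"
  where "even_moving_parts t \<longleftrightarrow> even (length (filter even t)) \<and> 5 \<le> sum_list (filter ((\<le>) 2) t)"

fun witness_lens :: "witness \<Rightarrow> nat list \<times> nat list"
  where "witness_lens (F, M, G', F', N, uss, sss) = (map length uss, map length sss)"

fun same_parts :: "nat list \<Rightarrow> nat list \<times> nat list \<Rightarrow> bool"
  where "same_parts t (u, s) \<longleftrightarrow> length t = length u + length s \<and> sublist_ms t (u @ s)"

fun flags :: "nat list \<Rightarrow> nat list \<times> nat list \<Rightarrow> bool"
  where "flags S (u, s) \<longleftrightarrow> sublist_ms S s"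

text \<open>These are the selections of cycles that the induction may need flagged at once: one
  cycle, two cycles of lengths of equal parity, and for the descent from degrees 13 and 14 two
  transpositions with a third cycle.\<close>

definition flag_sets :: "nat list \<Rightarrow> nat list list"
  where "flag_sets t = map (\<lambda>a. [a]) (remdups t) @
    filter (\<lambda>S. sublist_ms S t) (concat (map (\<lambda>a. map (\<lambda>b. [a, b]) (filter (\<lambda>b. even a = even b) (remdups t))) (remdups t))) @
    filter (\<lambda>S. sublist_ms S t) (map (\<lambda>k. [2, 2, k]) (remdups t))"

text \<open>Flags are demanded only for types with at most two fixed points: the induction removes
  pairs of fixed points before it asks for a flag, and shortening a 3-cycle then adds at most one
  more.\<close>

definition covers :: "(nat list \<times> nat list) list \<Rightarrow> nat list \<Rightarrow> bool"
  where "covers tab t \<longleftrightarrow> tab \<noteq> [] \<and>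
    (length (filter ((=) 1) t) \<le> 2 \<longrightarrow> list_all (\<lambda>S. list_ex (flags S) tab) (flag_sets t))"

definition complete_table :: "nat \<Rightarrow> witness list \<Rightarrow> bool"
  where "complete_table n W \<longleftrightarrow> (let tab = map witness_lens W in
    list_all (\<lambda>t. even_moving_parts t \<longrightarrow> covers (filter (same_parts t) tab) t) (part_lists n n n))"

text \<open>The tables of this development were found by a computer search.\<close>

definition table11 :: "witness list"
  where "table11 = [
    ([], [5, 6, 7, 8, 9, 10, 11], [1, 5, 6, 8], [], [2, 3, 7, 9, 4, 11, 10], [], [[11, 9, 3, 6, 7, 8, 5, 2, 4, 10, 1]]),
    ([], [5, 6, 7, 8, 9, 10, 11], [1, 5, 6, 8], [], [2, 3, 7, 9, 10, 11, 4], [], [[3, 6, 7, 8, 5, 2, 4, 1, 11], [9], [10]]),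
    ([], [5, 6, 7, 8, 9, 10, 11], [1, 5, 6, 8], [], [2, 3, 10, 11, 7, 9, 4], [], [[11, 6, 7, 8, 5, 2, 4, 1], [3, 9], [10]]),
    ([], [5, 6, 7, 8, 9, 10, 11], [1, 5, 6, 8], [], [2, 3, 7, 4, 10, 11, 9], [], [[11, 8, 5, 2, 4, 9, 1], [3, 6, 7], [10]]),
    ([], [5, 6, 7, 8, 9, 10, 11], [1, 5, 6, 9], [], [2, 3, 8, 7, 4, 11, 10], [], [[11, 9, 5, 2, 4, 10, 1], [3, 7], [8, 6]]),
    ([], [5, 6, 7, 8, 9, 10, 11], [1, 5, 6, 7], [], [2, 3, 4, 9, 10, 11, 8], [[3], [6]], [[11, 7, 5, 2, 4, 8, 1], [9], [10]]),
    ([], [5, 6, 7, 8, 9, 10, 11], [1, 5, 6, 8], [], [2, 3, 7, 10, 11, 4, 9], [], [[3, 6, 7, 9, 1, 11], [4, 8, 5, 2], [10]]),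
    ([], [5, 6, 7, 8, 9, 10, 11], [1, 5, 6, 8], [], [2, 3, 10, 7, 11, 9, 4], [], [[11, 8, 5, 2, 4, 1], [7, 10, 6], [3, 9]]),
    ([], [5, 6, 7, 8, 9, 10, 11], [1, 5, 6, 7], [], [2, 3, 4, 9, 8, 10, 11], [[1, 11], [3], [6]], [[4, 8, 9, 7, 5, 2], [10]]),
    ([], [5, 6, 7, 8, 9, 10, 11], [1, 5, 6, 8], [], [2, 7, 9, 3, 10, 11, 4], [], [[3, 9, 4, 1, 11], [2, 6, 7, 8, 5], [10]]),
    ([], [5, 6, 7, 8, 9, 10, 11], [1, 5, 6, 8], [], [2, 3, 10, 9, 4, 11, 7], [], [[4, 10, 8, 5, 2], [11, 6, 7, 1], [3, 9]]),
    ([], [5, 6, 7, 8, 9, 10, 11], [1, 5, 6, 8], [], [2, 3, 7, 4, 11, 10, 9], [], [[4, 10, 8, 5, 2], [11, 9, 1], [3, 6, 7]]),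
    ([], [5, 6, 7, 8, 9, 10, 11], [1, 5, 6, 7], [], [2, 9, 8, 10, 11, 3, 4], [[1, 11, 4], [3], [6]], [[2, 8, 9, 7, 5], [10]]),
    ([], [5, 6, 7, 8, 9, 10, 11], [1, 5, 6, 11], [], [2, 8, 3, 4, 9, 10, 7], [[3]], [[2, 7, 1, 11, 5], [4, 8], [10, 6], [9]]),
    ([], [5, 6, 7, 8, 9, 10, 11], [1, 5, 6, 11], [], [2, 3, 8, 9, 10, 7, 4], [[1, 11, 5, 2, 4]], [[3, 7], [10, 6], [8], [9]]),
    ([], [5, 6, 7, 8, 9, 10, 11], [3, 5, 1, 2], [], [4, 7, 8, 9, 10, 11, 6], [[1], [2]], [[11, 5, 4, 6, 3], [7], [8], [9], [10]]),
    ([], [5, 6, 7, 8, 9, 10, 11], [1, 5, 6, 8], [], [2, 3, 7, 4, 9, 11, 10], [], [[11, 9, 10, 1], [4, 8, 5, 2], [3, 6, 7]]),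
    ([], [5, 6, 7, 8, 9, 10, 11], [1, 5, 10, 11], [], [2, 7, 6, 8, 9, 3, 4], [[1, 11, 9, 4], [3], [10]], [[2, 6, 7, 5], [8]]),
    ([], [5, 6, 7, 8, 9, 10, 11], [1, 5, 6, 7], [], [2, 3, 10, 11, 9, 4, 8], [[6]], [[4, 7, 5, 2], [11, 8, 1], [3, 9], [10]]),
    ([], [5, 6, 7, 8, 9, 10, 11], [1, 5, 6, 8], [], [2, 3, 7, 4, 9, 10, 11], [[1, 11]], [[4, 8, 5, 2], [3, 6, 7], [9], [10]]),
    ([], [5, 6, 7, 8, 9, 10, 11], [1, 5, 6, 9], [], [2, 3, 8, 7, 4, 10, 11], [[1, 11]], [[4, 9, 5, 2], [3, 7], [8, 6], [10]]),
    ([], [5, 6, 7, 8, 9, 10, 11], [1, 5, 8, 11], [], [2, 6, 10, 9, 7, 3, 4], [[1, 11, 7, 4], [3]], [[2, 5], [6, 9], [10, 8]]),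
    ([], [5, 6, 7, 8, 9, 10, 11], [1, 5, 6, 7], [], [2, 3, 4, 8, 9, 10, 11], [[1, 11], [3], [6]], [[4, 7, 5, 2], [8], [9], [10]]),
    ([], [5, 6, 7, 8, 9, 10, 11], [1, 5, 6, 8], [], [2, 9, 10, 11, 3, 7, 4], [[1, 11, 4]], [[2, 8, 5], [3, 6, 7], [9], [10]]),
    ([], [5, 6, 7, 8, 9, 10, 11], [1, 5, 6, 9], [], [2, 10, 11, 3, 8, 7, 4], [[1, 11, 4]], [[2, 9, 5], [3, 7], [8, 6], [10]]),
    ([], [5, 6, 7, 8, 9, 10, 11], [1, 5, 6, 7], [], [2, 8, 3, 10, 4, 9, 11], [[1, 11], [6]], [[2, 7, 5], [3, 9, 10], [4, 8]]),
    ([], [5, 6, 7, 8, 9, 10, 11], [1, 5, 6, 7], [], [2, 8, 9, 10, 11, 3, 4], [[1, 11, 4], [3], [6]], [[2, 7, 5], [8], [9], [10]]),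
    ([], [5, 6, 7, 8, 9, 10, 11], [1, 5, 6, 9], [], [2, 10, 3, 8, 7, 4, 11], [[1, 11]], [[2, 9, 5], [3, 7], [4, 10], [8, 6]]),
    ([], [5, 6, 7, 8, 9, 10, 11], [1, 5, 6, 7], [], [2, 8, 3, 4, 9, 10, 11], [[1, 11], [3], [6]], [[2, 7, 5], [4, 8], [9], [10]]),
    ([], [5, 6, 7, 8, 9, 10, 11], [1, 5, 7, 8], [], [2, 6, 9, 3, 4, 10, 11], [[1, 11], [3], [7]], [[2, 5], [4, 9], [6, 8], [10]])]"

definition table12 :: "witness list"
  where "table12 = [
    ([12], [5, 6, 7, 8, 9, 10, 11], [1, 5, 6, 8], [2], [3, 7, 9, 4, 10, 11, 12], [], [[4, 9, 3, 6, 7, 8, 5, 2, 1, 11, 12], [10]]),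
    ([12], [5, 6, 7, 8, 9, 10, 11], [1, 5, 6, 8], [2], [3, 7, 9, 4, 10, 12, 11], [], [[4, 9, 3, 6, 7, 8, 5, 2, 1, 11], [12, 10]]),
    ([12], [5, 6, 7, 8, 9, 10, 11], [1, 5, 6, 8], [2], [3, 7, 4, 9, 11, 10, 12], [], [[11, 9, 10, 12, 4, 8, 5, 2, 1], [3, 6, 7]]),
    ([12], [5, 6, 7, 8, 9, 10, 11], [1, 5, 6, 7], [2], [3, 4, 8, 9, 11, 10, 12], [[3], [6]], [[11, 9, 10, 12, 4, 7, 5, 2, 1], [8]]),
    ([12], [5, 6, 7, 8, 9, 10, 11], [1, 5, 6, 8], [2], [3, 7, 9, 11, 4, 10, 12], [], [[3, 6, 7, 8, 5, 2, 1, 11], [4, 9, 10, 12]]),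
    ([12], [5, 6, 7, 8, 9, 10, 11], [1, 5, 6, 11], [3], [2, 4, 7, 8, 9, 12, 10], [], [[4, 6, 10, 1, 11, 5, 2, 3], [12, 9], [7], [8]]),
    ([12], [5, 6, 7, 8, 9, 10, 11], [1, 5, 6, 8], [2], [3, 7, 10, 4, 9, 11, 12], [], [[4, 8, 5, 2, 1, 11, 12], [3, 6, 7, 9, 10]]),
    ([12], [5, 6, 7, 8, 9, 10, 11], [1, 5, 6, 8], [2], [3, 7, 4, 9, 10, 11, 12], [], [[4, 8, 5, 2, 1, 11, 12], [3, 6, 7], [9], [10]]),
    ([12], [5, 6, 7, 8, 9, 10, 11], [1, 5, 6, 9], [2], [3, 8, 7, 4, 10, 11, 12], [], [[4, 9, 5, 2, 1, 11, 12], [3, 7], [8, 6], [10]]),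
    ([12], [5, 6, 7, 8, 9, 10, 11], [1, 5, 6, 7], [2], [3, 4, 8, 9, 10, 11, 12], [[3], [6]], [[4, 7, 5, 2, 1, 11, 12], [8], [9], [10]]),
    ([12], [5, 6, 7, 8, 9, 10, 11], [1, 5, 6, 8], [2], [3, 7, 10, 4, 9, 12, 11], [], [[4, 8, 5, 2, 1, 11], [3, 6, 7, 9, 12, 10]]),
    ([12], [5, 6, 7, 8, 9, 10, 11], [1, 5, 6, 8], [2], [3, 7, 12, 4, 9, 10, 11], [], [[4, 8, 5, 2, 1, 11], [3, 6, 7, 12], [9], [10]]),
    ([12], [5, 6, 7, 8, 9, 10, 11], [1, 5, 6, 8], [2], [3, 7, 4, 9, 10, 12, 11], [], [[4, 8, 5, 2, 1, 11], [3, 6, 7], [12, 10], [9]]),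
    ([12], [5, 6, 7, 8, 9, 10, 11], [1, 5, 6, 9], [2], [3, 8, 7, 4, 10, 12, 11], [], [[4, 9, 5, 2, 1, 11], [3, 7], [8, 6], [12, 10]]),
    ([12], [5, 6, 7, 8, 9, 10, 11], [1, 5, 6, 7], [8], [2, 3, 4, 12, 9, 10, 11], [[1, 11], [3], [6]], [[12, 8, 7, 5, 2, 4], [9], [10]]),
    ([12], [5, 6, 7, 8, 9, 10, 11], [1, 5, 6, 8], [3], [2, 4, 9, 10, 11, 7, 12], [], [[11, 6, 7, 12, 1], [4, 8, 5, 2, 3], [9], [10]]),
    ([12], [5, 6, 7, 8, 9, 10, 11], [1, 5, 6, 8], [2], [3, 7, 12, 4, 10, 11, 9], [], [[11, 8, 5, 2, 1], [3, 6, 7, 12], [4, 9], [10]]),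
    ([12], [5, 6, 7, 8, 9, 10, 11], [1, 5, 6, 8], [2], [3, 7, 4, 10, 11, 9, 12], [], [[11, 8, 5, 2, 1], [3, 6, 7], [4, 9, 12], [10]]),
    ([12], [5, 6, 7, 8, 9, 10, 11], [1, 5, 6, 8], [2], [3, 7, 4, 10, 12, 11, 9], [], [[11, 8, 5, 2, 1], [3, 6, 7], [4, 9], [12, 10]]),
    ([12], [5, 6, 7, 8, 9, 10, 11], [1, 5, 6, 7], [8], [2, 3, 4, 9, 10, 11, 12], [[1, 11, 12], [3], [6]], [[4, 8, 7, 5, 2], [9], [10]]),
    ([12], [5, 6, 7, 8, 9, 10, 11], [1, 5, 6, 7], [8], [2, 3, 4, 9, 10, 12, 11], [[1, 11], [3], [6]], [[4, 8, 7, 5, 2], [12, 10], [9]]),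
    ([12], [5, 6, 7, 8, 9, 10, 11], [3, 5, 1, 2], [4], [6, 7, 8, 9, 10, 11, 12], [[1], [2]], [[12, 5, 4, 3, 11], [6], [7], [8], [9], [10]]),
    ([12], [5, 6, 7, 8, 9, 10, 11], [1, 5, 6, 8], [3], [2, 9, 4, 12, 10, 11, 7], [], [[11, 6, 7, 1], [12, 9, 3, 4], [2, 8, 5], [10]]),
    ([12], [5, 6, 7, 8, 9, 10, 11], [1, 5, 6, 12], [8], [2, 7, 9, 3, 11, 4, 10], [], [[3, 10, 1, 11], [2, 6, 12, 5], [4, 9], [7, 8]]),
    ([12], [5, 6, 7, 8, 9, 10, 11], [1, 5, 6, 7], [8], [2, 9, 10, 11, 3, 4, 12], [[1, 11, 4, 12], [3], [6]], [[2, 8, 7, 5], [9], [10]]),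
    ([12], [5, 6, 7, 8, 9, 10, 11], [1, 5, 6, 8], [3], [2, 9, 4, 10, 12, 11, 7], [], [[11, 6, 7, 1], [2, 8, 5], [4, 9, 3], [12, 10]]),
    ([12], [5, 6, 7, 8, 9, 10, 11], [1, 5, 6, 7], [8], [2, 9, 3, 4, 10, 11, 12], [[1, 11, 12], [3], [6]], [[2, 8, 7, 5], [4, 9], [10]]),
    ([12], [5, 6, 7, 8, 9, 10, 11], [1, 5, 6, 12], [8], [2, 7, 9, 3, 4, 10, 11], [[1, 11], [3]], [[2, 6, 12, 5], [4, 9], [7, 8], [10]]),
    ([12], [5, 6, 7, 8, 9, 10, 11], [1, 5, 6, 8], [7], [2, 3, 12, 4, 9, 10, 11], [[1, 11], [3, 12], [6, 7]], [[4, 8, 5, 2], [9], [10]]),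
    ([12], [5, 6, 7, 8, 9, 10, 11], [1, 5, 7, 8], [10], [2, 6, 9, 11, 3, 4, 12], [[1, 11, 4, 12], [3], [7]], [[2, 5], [6, 8], [9, 10]]),
    ([12], [5, 6, 7, 8, 9, 10, 11], [3, 5, 1, 2], [6], [4, 12, 7, 8, 9, 10, 11], [[3, 11], [1], [2]], [[12, 6, 5, 4], [7], [8], [9], [10]]),
    ([12], [5, 6, 7, 8, 9, 10, 11], [1, 5, 6, 8], [3], [2, 9, 4, 10, 7, 11, 12], [[1, 11, 12]], [[2, 8, 5], [4, 9, 3], [7, 10, 6]]),
    ([12], [5, 6, 7, 8, 9, 10, 11], [1, 5, 6, 7], [9], [2, 8, 3, 4, 10, 11, 12], [[1, 11, 12], [3], [6]], [[2, 7, 5], [4, 9, 8], [10]]),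
    ([12], [5, 6, 7, 8, 9, 10, 11], [1, 5, 7, 8], [3], [2, 6, 9, 4, 10, 11, 12], [[1, 11, 12], [7]], [[4, 9, 3], [2, 5], [6, 8], [10]]),
    ([12], [5, 6, 7, 8, 9, 10, 11], [1, 5, 7, 12], [3], [2, 6, 8, 4, 9, 10, 11], [[1, 11]], [[4, 8, 3], [6, 7, 12], [2, 5], [9], [10]]),
    ([12], [5, 6, 7, 8, 9, 10, 11], [3, 5, 1, 2], [6], [4, 7, 8, 9, 10, 11, 12], [[3, 11, 12], [1], [2]], [[4, 6, 5], [7], [8], [9], [10]]),
    ([12], [5, 6, 7, 8, 9, 10, 11], [1, 5, 7, 8], [3], [2, 6, 9, 4, 10, 12, 11], [[1, 11], [7]], [[4, 9, 3], [2, 5], [6, 8], [12, 10]]),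
    ([12], [5, 6, 7, 8, 9, 10, 11], [1, 5, 6, 8], [7], [2, 9, 3, 12, 4, 10, 11], [[1, 11], [3, 12], [6, 7]], [[2, 8, 5], [4, 9], [10]]),
    ([12], [5, 6, 7, 8, 9, 10, 11], [1, 5, 7, 9], [8], [2, 6, 10, 11, 3, 12, 4], [[1, 11, 4], [3, 12], [7, 8]], [[2, 5], [6, 9], [10]]),
    ([12], [5, 6, 7, 8, 9, 10, 11], [3, 5, 1, 2], [6], [4, 7, 8, 9, 10, 12, 11], [[3, 11], [1], [2]], [[4, 6, 5], [12, 10], [7], [8], [9]]),
    ([12], [5, 6, 7, 8, 9, 10, 11], [1, 5, 7, 9], [8], [2, 6, 10, 3, 12, 4, 11], [[1, 11], [3, 12], [7, 8]], [[2, 5], [4, 10], [6, 9]]),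
    ([12], [5, 6, 7, 8, 9, 10, 11], [3, 5, 1, 2], [7], [4, 6, 8, 9, 10, 12, 11], [[3, 11], [1], [2]], [[4, 5], [6, 7], [12, 10], [8], [9]])]"

lemma table11_ok: "list_all (witness_ok 11) table11"
  by code_simp

lemma table12_ok: "list_all (witness_ok 12) table12"
  by code_simp

text \<open>The type 2^6 1 has no cycle that could be shortened, and removing two of its
  transpositions would lead to degree 9, below the degrees where the induction starts.\<close>

lemma table13_ok: "witness_ok 13 ([], [5, 6, 7, 8, 9, 10, 11, 12, 13], [1, 13, 7, 11], [], [6, 12, 2, 5, 9, 4, 3, 10, 8], [[1, 12], [5, 8], [6, 11], [7, 10], [4]], [[2, 13], [3, 9]])"
  by code_simp

lemma table11_complete: "complete_table 11 table11"
  by code_simp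

lemma table12_complete: "complete_table 12 table12"
  by code_simp

section \<open>Cycle types moving at least five points\<close>

definition even_parts :: "nat multiset \<Rightarrow> bool"
  where "even_parts P \<longleftrightarrow> (\<forall>k\<in>#P. 1 \<le> k) \<and> even (size (filter_mset even P))"

definition moved :: "nat multiset \<Rightarrow> nat"
  where "moved P = sum_mset (filter_mset ((\<le>) 2) P)"

lemma sum_eq_moved: "\<forall>k\<in>#P. 1 \<le> k \<Longrightarrow> sum_mset P = moved P + count P 1"
proof (induction P)
  case (add k P)
  then show ?case by (cases "k = 1") (auto simp: moved_def)
qed (simp add: moved_def)

lemma realizable_unflag_all: "realizable U (S + D) \<Longrightarrow> realizable (U + D) S"
proof (induction D arbitrary: U)
  case (add k D)
  then have "realizable U (add_mset k (S + D))" by simp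
  then have "realizable (add_mset k U) (S + D)" by (rule realizable_unflag)
  from add.IH[OF this] show ?case by simp
qed simp

text \<open>The table entry may have more flags than requested; the surplus D is given up by
  \<open>realizable_unflag_all\<close>.\<close>

lemma realizable_from_table:
  assumes "complete_table n W" "list_all (witness_ok n) W"
    and t: "sorted_wrt (\<ge>) t" "\<forall>k\<in>set t. 1 \<le> k" "sum_list t = n" "even_moving_parts t"
    and S: "S = [] \<or> (length (filter ((=) 1) t) \<le> 2 \<and> S \<in> set (flag_sets t))" "sublist_ms S t"
  shows "realizable (mset t - mset S) (mset S)"
proof -
  let ?tab = "filter (same_parts t) (map witness_lens W)"
  have "\<forall>k\<in>set t. 1 \<le> k \<and> k \<le> n" using t(2,3) member_le_sum_list by auto
  then have "t \<in> set (part_lists n n n)" using part_lists_complete[OF t(1), of n n] t(3) by simp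
  then have cov: "covers ?tab t" using assms(1) t(4) by (auto simp: complete_table_def list_all_iff Let_def)
  have "list_ex (flags S) ?tab"
  proof (cases "S = []")
    case True
    then show ?thesis using cov by (cases ?tab; cases "hd ?tab") (auto simp: covers_def)
  next
    case False
    then show ?thesis using cov S(1) by (auto simp: covers_def list_all_iff)
  qed
  then obtain w where w: "w \<in> set W" "same_parts t (witness_lens w)" "flags S (witness_lens w)"
    by (auto simp: list_ex_iff)
  obtain F M G' F' N uss sss where weq: "w = (F, M, G', F', N, uss, sss)" by (cases w) auto
  have r: "realizable (mset (map length uss)) (mset (map length sss))"
    using witness_ok_realizable assms(2) w(1) weq by (auto simp: list_all_iff simp del: witness_ok.simps)
  have "mset t \<subseteq># mset (map length uss @ map length sss)" "size (mset t) = size (mset (map length uss @ map length sss))"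
    using w(2) weq by (auto simp: sublist_ms_iff)
  then have t: "mset t = mset (map length uss) + mset (map length sss)"
    by (metis mset_append mset_subset_size order_less_irrefl subset_mset.le_imp_less_or_eq)
  have S: "mset S \<subseteq># mset (map length sss)" using w(3) weq by (auto simp: sublist_ms_iff)
  then obtain D where D: "mset (map length sss) = mset S + D" by (metis subset_mset.le_iff_add)
  have "realizable (mset (map length uss) + D) (mset S)"
    by (rule realizable_unflag_all) (use r D in simp)
  then show ?thesis using t D by simp
qed

lemma realizable_base:
  assumes n: "sum_mset (U + S) = n" "n = 11 \<or> n = 12" and ok: "even_parts (U + S)" "5 \<le> moved (U + S)"
    and S: "S = {#} \<or> (count (U + S) 1 \<le> 2 \<and> ((\<exists>a. S = {#a#}) \<or> (\<exists>a b. S = {#a, b#} \<and> (even a \<longleftrightarrow> even b)) \<or> (\<exists>k. S = {#2, 2, k#})))"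
  shows "realizable U S"
proof -
  obtain W where W: "complete_table n W" "list_all (witness_ok n) W"
    using n(2) table11_complete table11_ok table12_complete table12_ok by metis
  define t where "t = rev (sorted_list_of_multiset (U + S))"
  have mt: "mset t = U + S" by (simp add: t_def)
  have st: "sorted_wrt (\<ge>) t" by (simp add: t_def sorted_wrt_rev)
  have sum: "sum_list t = n" using mt n(1) by (metis sum_mset_sum_list)
  have pos: "\<forall>k\<in>set t. 1 \<le> k" using ok(1) mt by (metis even_parts_def set_mset_mset)
  have "mset (filter even t) = filter_mset even (U + S)" "mset (filter ((\<le>) 2) t) = filter_mset ((\<le>) 2) (U + S)"
    by (simp_all add: mt)
  then have "length (filter even t) = size (filter_mset even (U + S))" "sum_list (filter ((\<le>) 2) t) = moved (U + S)"
    unfolding moved_def by (metis size_mset, metis sum_mset_sum_list)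
  then have gen_commutator: "even_moving_parts t" using ok by (simp add: even_moving_parts_def even_parts_def)
  have "length (filter ((=) 1) xs) = count (mset xs) (1::nat)" for xs by (induction xs) auto
  then have one: "length (filter ((=) 1) t) = count (U + S) 1" using mt by simp
  have "\<exists>S'. mset S' = S \<and> (S' = [] \<or> (length (filter ((=) 1) t) \<le> 2 \<and> S' \<in> set (flag_sets t)))"
  proof -
    have sub: "mset S' \<subseteq># mset t" if "mset S' = S" for S' using that mt by simp
    have mem: "a \<in> set t" if "a \<in># S" for a using that mt by (metis UnCI set_mset_mset set_mset_union)
    consider "S = {#}" | a where "S = {#a#}" "count (U + S) 1 \<le> 2"
      | a b where "S = {#a, b#}" "even a \<longleftrightarrow> even b" "count (U + S) 1 \<le> 2"
      | k where "S = {#2, 2, k#}" "count (U + S) 1 \<le> 2"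
      using S by blast
    then show ?thesis
    proof cases
      case 1 then show ?thesis by (intro exI[of _ "[]"]) simp
    next
      case (2 a)
      then show ?thesis using mem[of a] one by (intro exI[of _ "[a]"]) (auto simp: flag_sets_def)
    next
      case (3 a b)
      then have "sublist_ms [a, b] t" using sub[of "[a, b]"] unfolding sublist_ms_iff by simp
      then show ?thesis using 3 mem[of a] mem[of b] one
        by (intro exI[of _ "[a, b]"]) (auto simp: flag_sets_def simp del: sublist_ms.simps)
    next
      case (4 k)
      then have "sublist_ms [2, 2, k] t" using sub[of "[2, 2, k]"] unfolding sublist_ms_iff by simp
      then show ?thesis using 4 mem[of k] one
        by (intro exI[of _ "[2, 2, k]"]) (auto simp: flag_sets_def simp del: sublist_ms.simps)
    qed
  qed
  then obtain S' where S': "mset S' = S" "S' = [] \<or> (length (filter ((=) 1) t) \<le> 2 \<and> S' \<in> set (flag_sets t))"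
    by blast
  have "sublist_ms S' t" unfolding sublist_ms_iff S'(1) mt by simp
  from realizable_from_table[OF W st pos sum gen_commutator S'(2) this] show ?thesis using S'(1) mt by simp
qed

text \<open>The invariant of the induction. The parity clause ensures that flagged cycles end up
  either all as transpositions or all as fixed points, so that they can be removed in pairs.\<close>

definition flaggable :: "nat multiset \<Rightarrow> nat multiset \<Rightarrow> bool"
  where "flaggable U S \<longleftrightarrow> S = {#} \<or> (count (U + S) 1 \<le> 2 \<and> size S \<le> 2 \<and>
    ((\<forall>k\<in>#S. even k) \<or> (\<forall>k\<in>#U + S. odd k)))"

lemma realizable_13: "realizable {#2, 2, 2, 2, 1#} {#2, 2#}"
  using witness_ok_realizable[OF table13_ok] by (simp add: numeral_2_eq_2)

text \<open>The two parts m are taken from the flagged ones as far as possible. The insertion lemmas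
  return both of them flagged, and D collects those that must lose the flag afterwards.\<close>

lemma remove_pair:
  assumes "2 \<le> count (U + S) m"
  obtains U' S' D where "U = U' + D" "S + D = add_mset m (add_mset m S')" "U + S = add_mset m (add_mset m (U' + S'))"
    "S' = S - {#m, m#}"
proof -
  define D where "D = {#m, m#} - S"
  have "D \<subseteq># U" using assms by (intro mset_subset_eqI) (auto simp: D_def)
  then obtain U' where U: "U = U' + D" by (metis add.commute subset_mset.le_iff_add)
  have eq: "S + D = add_mset m (add_mset m (S - {#m, m#}))" by (intro multiset_eqI) (auto simp: D_def)
  have "U + S = U' + (S + D)" using U by (simp add: ac_simps)
  then show thesis using that[OF U eq] eq by simp
qed

lemma flaggable_mono:
  assumes "flaggable U S" "U' + S' \<subseteq># U + S" "S' \<subseteq># S"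
  shows "flaggable U' S'"
proof (cases "S = {#}")
  case False
  have "count (U' + S') 1 \<le> count (U + S) 1" using assms(2) by (rule mset_subset_eq_count)
  moreover have "size S' \<le> size S" using assms(3) by (rule size_mset_mono)
  ultimately show ?thesis
    using False assms(1) mset_subset_eqD[OF assms(2)] mset_subset_eqD[OF assms(3)] unfolding flaggable_def
    by (meson le_trans)
qed (use assms in \<open>auto simp: flaggable_def\<close>)

text \<open>Pairs of fixed points are removed whenever possible. Otherwise a cycle of length at
  least 3 is shortened by two, which flags it. If there are even parts, their number is even, and
  only even cycles are flagged and shortened until two transpositions can be removed. If all parts
  are odd, shortening proceeds towards pairs of fixed points. In either case two flags
  suffice.\<close>

lemma realizable_flaggable:
  assumes "even_parts (U + S)" "5 \<le> moved (U + S)" "11 \<le> sum_mset (U + S)" "flaggable U S"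
  shows "realizable U S"
  using assms
proof (induction "sum_mset (U + S)" arbitrary: U S rule: less_induct)
  case less
  note ep = less.prems(1) and fl = less.prems(4)
  have pos: "\<forall>k\<in>#U + S. 1 \<le> k" using ep by (simp add: even_parts_def)
  have sum: "sum_mset (U + S) = moved (U + S) + count (U + S) 1" by (rule sum_eq_moved[OF pos])
  have small: "S = {#} \<or> (\<exists>a. S = {#a#}) \<or> (\<exists>a b. S = {#a, b#} \<and> (even a \<longleftrightarrow> even b))"
  proof (cases "S = {#}")
    case False
    then have "size S \<le> 2" and par: "(\<forall>k\<in>#S. even k) \<or> (\<forall>k\<in>#U + S. odd k)"
      using fl by (auto simp: flaggable_def)
    obtain a S1 where S1: "S = add_mset a S1" using False by (cases S) auto
    show ?thesis
    proof (cases S1)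
      case (add b S2)
      then have "S2 = {#}" using S1 \<open>size S \<le> 2\<close> by simp
      then show ?thesis using S1 add par by auto
    qed (use S1 in simp)
  qed simp
  show ?case
  proof (cases "sum_mset (U + S) = 11 \<or> sum_mset (U + S) = 12")
    case True
    have "S = {#} \<or> count (U + S) 1 \<le> 2" using fl by (auto simp: flaggable_def)
    then show ?thesis using realizable_base[OF refl True ep less.prems(2)] small by blast
  next
    case False
    then have n13: "13 \<le> sum_mset (U + S)" using less.prems(3) by linarith
    show ?thesis
    proof (cases "2 \<le> count (U + S) 1")
      case True
      then obtain U' S' D where D: "U = U' + D" "S + D = add_mset 1 (add_mset 1 S')"
        "U + S = add_mset 1 (add_mset 1 (U' + S'))" "S' = S - {#1, 1#}" by (rule remove_pair)
      have "realizable U' S'"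
      proof (rule less.hyps)
        show "sum_mset (U' + S') < sum_mset (U + S)" "11 \<le> sum_mset (U' + S')" using D(3) n13 by simp_all
        show "even_parts (U' + S')" using ep unfolding D(3) by (simp add: even_parts_def)
        show "5 \<le> moved (U' + S')" using less.prems(2) unfolding D(3) by (simp add: moved_def)
        show "flaggable U' S'" by (rule flaggable_mono[OF fl]) (use D(3,4) in \<open>auto simp: subset_mset.add_increasing2 intro!: mset_subset_eqI\<close>)
      qed
      then have "realizable U' (S + D)" unfolding D(2) by (rule realizable_two_fixed)
      then show ?thesis unfolding D(1) by (rule realizable_unflag_all)
    next
      case one: False
      \<comment> \<open>The bound on moved points comes for free: the smaller type has degree at
        least 11 and at most two fixed points.\<close>
      have shrink: "realizable U' (add_mset k S')"
        if k: "3 \<le> k" "U + S = add_mset k (U' + S')" "size S' \<le> 1"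
          "(\<forall>j\<in>#add_mset k S'. even j) \<or> (\<forall>j\<in>#U + S. odd j)" for k U' S'
      proof -
        have ep': "even_parts (U' + add_mset (k - 2) S')" using ep k(1) unfolding k(2) by (auto simp: even_parts_def)
        have sum': "sum_mset (U' + add_mset (k - 2) S') + 2 = sum_mset (U + S)" using k(1) unfolding k(2) by simp
        have c1: "count (U' + add_mset (k - 2) S') 1 \<le> 2" using one k(1) unfolding k(2) by auto
        have "realizable U' (add_mset (k - 2) S')"
        proof (rule less.hyps)
          show "sum_mset (U' + add_mset (k - 2) S') < sum_mset (U + S)" "11 \<le> sum_mset (U' + add_mset (k - 2) S')"
            using sum' n13 by linarith+
          show "even_parts (U' + add_mset (k - 2) S')" by (rule ep')
          show "5 \<le> moved (U' + add_mset (k - 2) S')"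
            using sum_eq_moved[of "U' + add_mset (k - 2) S'"] ep' sum' c1 n13 by (auto simp: even_parts_def)
          have "(\<forall>j\<in>#add_mset (k - 2) S'. even j) \<or> (\<forall>j\<in>#U' + add_mset (k - 2) S'. odd j)"
            using k(1,4) unfolding k(2) by auto
          then show "flaggable U' (add_mset (k - 2) S')" using c1 k(3) by (simp add: flaggable_def)
        qed
        moreover have "k - 2 + 2 = k" using k(1) by simp
        ultimately show ?thesis using realizable_lengthen by metis
      qed
      have Spar: "size S \<le> 2" "(\<forall>k\<in>#S. even k) \<or> (\<forall>k\<in>#U + S. odd k)" using fl by (auto simp: flaggable_def)
      show ?thesis
      proof (cases "\<exists>k\<in>#S. 3 \<le> k")
        case True
        then obtain k S' where S': "S = add_mset k S'" "3 \<le> k" by (metis multi_member_split)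
        show ?thesis unfolding S'(1) by (rule shrink[OF S'(2)]) (use S' Spar in auto)
      next
        case Ssmall: False
        show ?thesis
        proof (cases "\<exists>k\<in>#U + S. even k")
          case ev: True
          then have Sev: "\<forall>k\<in>#S. even k" using Spar(2) by blast
          have S2: "k = 2" if "k \<in># S" for k
          proof -
            have "even k" "\<not> 3 \<le> k" "1 \<le> k" using that Sev Ssmall pos by auto
            then show ?thesis by presburger
          qed
          show ?thesis
          proof (cases "size S < 2 \<and> (\<exists>k\<in>#U. even k \<and> 4 \<le> k)")
            case True
            then obtain k U' where k: "U = add_mset k U'" "even k" "4 \<le> k" by (metis multi_member_split)
            have "realizable U' (add_mset k S)"
              by (rule shrink) (use k True Sev in auto)
            then show ?thesis unfolding k(1) by (rule realizable_unflag)
          next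
            case F: False
            have Srep: "S = replicate_mset (size S) 2"
              by (rule set_mset_subset_singletonD) (use S2 in blast)
            \<comment> \<open>Either both flags are used up, by transpositions, or every even part
              is 2, and then the number of these is positive and even.\<close>
            have two: "2 \<le> count (U + S) 2"
            proof (cases "size S < 2")
              case True
              have U2: "k = 2" if "k \<in># U" "even k" for k
              proof -
                have "\<not> 4 \<le> k" "1 \<le> k" using that True F pos by auto
                then show ?thesis using that(2) by presburger
              qed
              have "\<forall>k. k \<in># filter_mset even (U + S) \<longrightarrow> k = 2" using U2 S2 by auto
              then have rep: "filter_mset even (U + S) = replicate_mset (size (filter_mset even (U + S))) 2"
                by (intro set_mset_subset_singletonD) blast
              have "count (U + S) 2 = count (filter_mset even (U + S)) 2" by simp
              also have "\<dots> = size (filter_mset even (U + S))" by (subst rep) simp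
              finally have c2: "count (U + S) 2 = size (filter_mset even (U + S))" .
              have "filter_mset even (U + S) \<noteq> {#}" using ev by (metis empty_iff set_mset_empty mem_Collect_eq set_mset_filter)
              then have "size (filter_mset even (U + S)) \<noteq> 0" by simp
              moreover have "even (size (filter_mset even (U + S)))" using ep by (simp add: even_parts_def)
              ultimately show ?thesis unfolding c2 by presburger
            next
              case False
              have "count S 2 = size S" by (subst Srep) simp
              then show ?thesis using False by simp
            qed
            then obtain U' S' D where D: "U = U' + D" "S + D = add_mset 2 (add_mset 2 S')"
              "U + S = add_mset 2 (add_mset 2 (U' + S'))" "S' = S - {#2, 2#}" by (rule remove_pair)
            have sum2: "sum_mset (U' + S') + 4 = sum_mset (U + S)" unfolding D(3) by simp
            \<comment> \<open>Removing two transpositions costs four points and must leave at least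
              11, hence the bound 15. Degrees 13 and 14 are led back to 11 and 12 by shortening
              another cycle instead.\<close>
            show ?thesis
            proof (cases "15 \<le> sum_mset (U + S)")
              case True
              have "realizable U' S'"
              proof (rule less.hyps)
                show "sum_mset (U' + S') < sum_mset (U + S)" "11 \<le> sum_mset (U' + S')" using sum2 True by linarith+
                show ep': "even_parts (U' + S')" using ep unfolding D(3) by (simp add: even_parts_def)
                have "count (U' + S') 1 \<le> 1" using one unfolding D(3) by simp
                then show "5 \<le> moved (U' + S')"
                  using sum_eq_moved[of "U' + S'"] ep' sum2 True by (auto simp: even_parts_def)
                show "flaggable U' S'" by (rule flaggable_mono[OF fl]) (use D(3,4) in \<open>auto simp: subset_mset.add_increasing2 intro!: mset_subset_eqI\<close>)
              qed
              then have "realizable U' (S + D)" unfolding D(2) by (rule realizable_two_transpositions)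
              then show ?thesis unfolding D(1) by (rule realizable_unflag_all)
            next
              case n14: False
              have n: "sum_mset (U + S) = 13 \<or> sum_mset (U + S) = 14" using n13 n14 by linarith
              have "S \<subseteq># {#2, 2#}"
                by (subst Srep) (use Spar(1) in \<open>auto intro!: mset_subset_eqI\<close>)
              then have S'0: "S' = {#}" unfolding D(4) by (simp add: Diff_eq_empty_iff_mset)
              have P: "U + S = add_mset 2 (add_mset 2 U')" and SD: "S + D = {#2, 2#}" using D(2,3) S'0 by simp_all
              have "realizable U' {#2, 2#}"
              proof (cases "\<exists>k\<in>#U'. 3 \<le> k")
                case True
                then obtain k V where k: "U' = add_mset k V" "3 \<le> k" by (metis multi_member_split)
                \<comment> \<open>A third flag, on the shortened cycle, is needed here in addition
                  to the two transpositions; this is the reason for the triples in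
                  \<open>flag_sets\<close>.\<close>
                let ?Q = "V + {#2, 2, k - 2#}"
                have ep': "even_parts ?Q" using ep k(2) unfolding P k(1) by (auto simp: even_parts_def)
                have s': "sum_mset ?Q + 2 = sum_mset (U + S)" using k(2) unfolding P k(1) by simp
                have c1: "count ?Q 1 \<le> 2" using one k(2) unfolding P k(1) by (auto split: if_splits)
                have s'': "sum_mset ?Q = 11 \<or> sum_mset ?Q = 12" using s' n by linarith
                have m: "5 \<le> moved ?Q" using sum_eq_moved[of ?Q] ep' s' c1 n13 by (auto simp: even_parts_def)
                have "realizable V {#2, 2, k - 2#}" using realizable_base[OF refl s'' ep' m] c1 by blast
                then have "realizable V (add_mset (k - 2) {#2, 2#})" by (simp add: add_mset_commute)
                moreover have "k - 2 + 2 = k" using k(2) by simp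
                ultimately have "realizable V (add_mset k {#2, 2#})" using realizable_lengthen by metis
                then show ?thesis unfolding k(1) by (rule realizable_unflag)
              next
                case False
                have U12: "k = 1 \<or> k = 2" if "k \<in># U'" for k
                proof -
                  have "\<not> 3 \<le> k" using False that by blast
                  moreover have "1 \<le> k" using pos that unfolding P by simp
                  ultimately show ?thesis by linarith
                qed
                have "filter_mset even U' = replicate_mset (size (filter_mset even U')) 2"
                  by (rule set_mset_subset_singletonD) (use U12 in force)
                moreover have "filter_mset odd U' = replicate_mset (size (filter_mset odd U')) 1"
                  by (rule set_mset_subset_singletonD) (use U12 in force)
                moreover obtain c d where cd: "c = size (filter_mset even U')" "d = size (filter_mset odd U')" by blast
                ultimately have U': "U' = replicate_mset c 2 + replicate_mset d 1"
                  using multiset_partition[of U' even] by simp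
                have "even c" using ep unfolding P cd even_parts_def by simp
                moreover have "2 * c + d = sum_mset U'" unfolding U' by simp
                moreover have "sum_mset U' + 4 = sum_mset (U + S)" unfolding P by simp
                moreover have "d \<le> 1" using one unfolding P U' by simp
                \<comment> \<open>With at most one fixed point and an even number c of further
                  transpositions, 2 c + d is 9 or 10 only for c = 4 and d = 1.\<close>
                ultimately have "c = 4" "d = 1" using n by presburger+
                then have "U' = {#2, 2, 2, 2, 1#}" unfolding U' by (simp add: eval_nat_numeral)
                then show ?thesis using realizable_13 by simp
              qed
              then have "realizable U' (S + D)" unfolding SD .
              then show ?thesis unfolding D(1) by (rule realizable_unflag_all)
            qed
          qed
        next
          case odd: False
          have S1: "k = 1" if "k \<in># S" for k
          proof -
            have "odd k" "\<not> 3 \<le> k" using that odd Ssmall by auto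
            then show ?thesis by presburger
          qed
          have "S = replicate_mset (size S) 1"
            by (rule set_mset_subset_singletonD) (use S1 in blast)
          then have "count S 1 = size S" by (metis count_replicate_mset)
          then have size: "size S \<le> 1" using one by simp
          have "\<exists>k\<in>#U. 3 \<le> k"
          proof (rule ccontr)
            assume "\<not> ?thesis"
            have "\<not> 2 \<le> k" if "k \<in># U + S" for k
            proof -
              have "odd k" "\<not> 3 \<le> k" using that odd Ssmall \<open>\<not> (\<exists>k\<in>#U. 3 \<le> k)\<close> by auto
              then show ?thesis by presburger
            qed
            then have "filter_mset ((\<le>) 2) (U + S) = {#}" by (auto simp: filter_mset_eq_conv)
            then have "moved (U + S) = 0" unfolding moved_def by simp
            then show False using less.prems(2) by simp
          qed
          then obtain k U' where k: "U = add_mset k U'" "3 \<le> k" by (metis multi_member_split)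
          have "realizable U' (add_mset k S)"
            by (rule shrink) (use k size odd in auto)
          then show ?thesis unfolding k(1) by (rule realizable_unflag)
        qed
      qed
    qed
  qed
qed

section \<open>Small degrees\<close>

text \<open>For small degrees generation is certified directly: \<open>w\<close> is a word in the generators \<open>A\<close> (letter 0) and
  \<open>B\<close> (other letters) that yields the 3-cycle \<open>T\<close>, and conjugating \<open>T\<close> by the words \<open>gs\<close> one after the
  other links all points to \<open>T\<close>.\<close>

fun word_apply :: "nat list list \<Rightarrow> nat list list \<Rightarrow> nat list \<Rightarrow> nat \<Rightarrow> nat"
  where "word_apply A B [] x = x"
  | "word_apply A B (k # w) x = apply_cycles (if k = 0 then A else B) (word_apply A B w x)"

fun word_agrees :: "nat list list \<Rightarrow> nat list list \<Rightarrow> nat list \<Rightarrow> nat list list \<Rightarrow> nat list \<Rightarrow> bool"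
  where "word_agrees A B w C [] \<longleftrightarrow> True"
  | "word_agrees A B w C (v # vs) \<longleftrightarrow> word_apply A B w v = apply_cycles C v \<and> word_agrees A B w C vs"

text \<open>The commutator equation in the form B A C = A B, which needs no inverses.\<close>

fun commutator_agrees :: "nat list list \<Rightarrow> nat list list \<Rightarrow> nat list list \<Rightarrow> nat list \<Rightarrow> bool"
  where "commutator_agrees A B C [] \<longleftrightarrow> True"
  | "commutator_agrees A B C (v # vs) \<longleftrightarrow>
      apply_cycles B (apply_cycles A (apply_cycles C v)) = apply_cycles A (apply_cycles B v) \<and>
      commutator_agrees A B C vs"

fun grow :: "nat list list \<Rightarrow> nat list list \<Rightarrow> nat list \<Rightarrow> nat list \<Rightarrow> nat list list \<Rightarrow> nat list"
  where "grow A B T L [] = L"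
  | "grow A B T L (g # gs) =
      (let T' = map (word_apply A B g) T
       in grow A B T (if list_ex (\<lambda>v. v \<in> set L) T' then T' @ L else L) gs)"

type_synonym word_witness = "nat list list \<times> nat list list \<times> nat list list \<times> nat list \<times> nat list \<times> nat list list"

definition even_cycles :: "nat \<Rightarrow> nat list list \<Rightarrow> bool"
  where "even_cycles n A \<longleftrightarrow> distinct (concat A) \<and> list_all (\<lambda>v. 1 \<le> v \<and> v \<le> n) (concat A) \<and>
    even (sum_list (map (\<lambda>cs. length cs - 1) A))"

fun word_witness_ok :: "nat \<Rightarrow> word_witness \<Rightarrow> bool"
  where "word_witness_ok n (A, B, C, T, w, gs) \<longleftrightarrow>
    even_cycles n A \<and> even_cycles n B \<and> perm_list n (concat C) \<and> commutator_agrees A B C (concat C) \<and>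
    length T = 3 \<and> distinct T \<and> list_all (\<lambda>v. 1 \<le> v \<and> v \<le> n) T \<and> word_agrees A B w [T] (concat C) \<and>
    list_all (\<lambda>v. v \<in> set (grow A B T T gs)) (concat C)"

fun word_perm :: "(nat \<Rightarrow> nat) \<Rightarrow> (nat \<Rightarrow> nat) \<Rightarrow> nat list \<Rightarrow> nat \<Rightarrow> nat"
  where "word_perm a b [] = id"
  | "word_perm a b (k # w) = (if k = 0 then a else b) \<circ> word_perm a b w"

lemma word_apply_eq:
  assumes "distinct (concat A)" "distinct (concat B)"
  shows "word_apply A B w x = word_perm (cycs A) (cycs B) w x"
  by (induction w) (simp_all add: cycs_apply_cycles assms)

lemma word_perm_in: "perm_closed H \<Longrightarrow> a \<in> H \<Longrightarrow> b \<in> H \<Longrightarrow> word_perm a b w \<in> H"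
  by (induction w) (auto simp del: o_apply intro: perm_closedD)

lemma even_cycles_alt_group: "even_cycles n A \<Longrightarrow> cycs A \<in> carrier (alt_group n)"
proof -
  assume A: "even_cycles n A"
  then have "set (concat A) \<subseteq> {1..n}" by (auto simp: even_cycles_def list_all_iff)
  then have "cycs A permutes {1..n}" by (rule permutes_subset[OF cycs_permutes])
  moreover have "evenperm (cycs A)" using A by (simp add: even_cycles_def evenperm_cycs)
  ultimately show ?thesis by (simp add: alt_group_carrier)
qed

lemma commutator_agrees_iff:
  assumes "distinct (concat A)" "distinct (concat B)" "distinct (concat C)"
  shows "commutator_agrees A B C vs \<longleftrightarrow> (\<forall>v\<in>set vs. cycs B (cycs A (cycs C v)) = cycs A (cycs B v))"
  by (induction vs) (simp_all add: cycs_apply_cycles assms)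

lemma word_agrees_iff:
  assumes "distinct (concat A)" "distinct (concat B)" "distinct (concat C)"
  shows "word_agrees A B w C vs \<longleftrightarrow> (\<forall>v\<in>set vs. word_perm (cycs A) (cycs B) w v = cycs C v)"
  by (induction vs) (simp_all add: word_apply_eq[OF assms(1,2)] cycs_apply_cycles[OF assms(3)])

lemma permutes_eqI:
  assumes "p permutes S" "q permutes S" "\<And>v. v \<in> S \<Longrightarrow> p v = q v"
  shows "p = q"
  using assms permutes_not_in by (metis ext)

lemma grow_linked:
  assumes H: "perm_closed H" and ab: "cycs A \<in> H" "cycs B \<in> H" "distinct (concat A)" "distinct (concat B)"
    and T: "\<And>u v. u \<in> set T \<Longrightarrow> v \<in> set T \<Longrightarrow> linked H u v"
    and L: "\<And>v. v \<in> set L \<Longrightarrow> linked H u v"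
  shows "v \<in> set (grow A B T L gs) \<Longrightarrow> linked H u v"
  using L
proof (induction gs arbitrary: L)
  case (Cons g gs)
  let ?g = "word_perm (cycs A) (cycs B) g"
  have gH: "?g \<in> H" using word_perm_in[OF H ab(1,2)] .
  define T' where "T' = map (word_apply A B g) T"
  have T': "linked H v v'" if "v \<in> set T'" "v' \<in> set T'" for v v'
    using that T linked_conj[OF H gH] by (auto simp: T'_def word_apply_eq ab)
  define L' where "L' = (if list_ex (\<lambda>v. v \<in> set L) T' then T' @ L else L)"
  have "linked H u v" if v: "v \<in> set L'" for v
  proof (cases "v \<in> set L")
    case False
    then obtain m where m: "m \<in> set T'" "m \<in> set L" "v \<in> set T'"
      using v by (auto simp: L'_def list_ex_iff split: if_splits)
    show ?thesis by (rule linked_trans[OF H Cons.prems(2)[OF m(2)] T'[OF m(1,3)]])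
  qed (rule Cons.prems(2))
  moreover have "v \<in> set (grow A B T L' gs)" using Cons.prems(1) by (simp only: grow.simps Let_def L'_def T'_def)
  ultimately show ?case by (rule Cons.IH[rotated])
qed simp

lemma word_witness_gen_commutator:
  assumes "word_witness_ok n (A, B, C, T, w, gs)"
  shows "gen_commutator n (cycs C)"
proof -
  have ev: "even_cycles n A" "even_cycles n B" and C: "perm_list n (concat C)"
    and com: "commutator_agrees A B C (concat C)" and T: "length T = 3" "distinct T" "list_all (\<lambda>v. 1 \<le> v \<and> v \<le> n) T"
    and w: "word_agrees A B w [T] (concat C)" and gr: "list_all (\<lambda>v. v \<in> set (grow A B T T gs)) (concat C)"
    using assms by simp_all
  have d: "distinct (concat A)" "distinct (concat B)" "distinct (concat C)"
    using ev C by (auto simp: even_cycles_def perm_list_def)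
  have setC: "set (concat C) = {1..n}" using C set_eq_atLeastAtMost unfolding perm_list_def by blast
  note ab = even_cycles_alt_group[OF ev(1)] even_cycles_alt_group[OF ev(2)]
  have p: "cycs A permutes {1..n}" "cycs B permutes {1..n}" using ab by (simp_all add: alt_group_carrier)
  have pc: "cycs C permutes {1..n}" using cycs_permutes[of C] setC by simp
  have bij: "bij (cycs A)" "bij (cycs B)" using p permutes_bij by blast+
  have "cycs B \<circ> (cycs A \<circ> cycs C) = cycs A \<circ> cycs B"
  proof (rule permutes_eqI)
    show "cycs B \<circ> (cycs A \<circ> cycs C) permutes {1..n}" "cycs A \<circ> cycs B permutes {1..n}"
      using p pc permutes_compose by metis+
    fix v assume "v \<in> {1..n}"
    then show "(cycs B \<circ> (cycs A \<circ> cycs C)) v = (cycs A \<circ> cycs B) v"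
      using com unfolding commutator_agrees_iff[OF d] setC by simp
  qed
  then have "cycs C = inv' (cycs A) \<circ> (inv' (cycs B) \<circ> (cycs A \<circ> cycs B))"
    using bij by (metis bij_is_inj comp_assoc id_comp inv_o_cancel)
  then have eq: "cycs C = inv' (cycs A) \<circ> inv' (cycs B) \<circ> cycs A \<circ> cycs B" by (simp only: comp_assoc)
  have "carrier (alt_group n) \<subseteq> H" if H: "perm_closed H" "cycs A \<in> H" "cycs B \<in> H" for H
  proof (rule alt_group_subset_if_linked[OF H(1)])
    obtain i j k where ijk: "T = [i, j, k]" using T(1) by (auto simp: length_Suc_conv eval_nat_numeral)
    let ?w = "word_perm (cycs A) (cycs B) w"
    have "?w = cycs [T]"
    proof (rule permutes_eqI)
      show "?w permutes {1..n}"
        using p by (induction w) (auto simp del: o_apply simp: permutes_id intro: permutes_compose)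
      show "cycs [T] permutes {1..n}"
        by (rule permutes_subset[OF cycs_permutes]) (use T(3) in \<open>auto simp: list_all_iff\<close>)
      have dT: "distinct (concat [T])" using T(2) by simp
      fix v assume "v \<in> {1..n}"
      then show "?w v = cycs [T] v" using w unfolding word_agrees_iff[OF d(1,2) dT] setC by blast
    qed
    then have "cycle_of_list T \<in> H" using word_perm_in[OF H, of w] by (simp only: cycs_simps comp_id)
    then have 3: "three_in H i j k" using T(2) unfolding three_in_def ijk by blast
    have l: "linked H i j" "linked H j k" "linked H k i"
      using 3 three_in_rotate[OF 3] three_in_rotate[OF three_in_rotate[OF 3]] unfolding linked_def by blast+
    have refl: "linked H v v" for v by (simp add: linked_def)
    have T': "linked H u v" if "u \<in> set T" "v \<in> set T" for u v
      using that l refl linked_sym[OF H(1)] unfolding ijk by auto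
    have all: "linked H i v" if v: "v \<in> {1..n}" for v
    proof (rule grow_linked[OF H d(1,2) T'])
      show "v \<in> set (grow A B T T gs)" using gr v unfolding list_all_iff setC by blast
      show "linked H i v" if "v \<in> set T" for v by (rule T'[OF _ that]) (simp add: ijk)
    qed
    show "linked H x y" if "x \<in> {1..n}" "y \<in> {1..n}" for x y
      using linked_trans[OF H(1) linked_sym[OF H(1) all[OF that(1)]] all[OF that(2)]] .
  qed
  then show ?thesis unfolding gen_commutator_def using ab eq by blast
qed

fun word_lens :: "word_witness \<Rightarrow> nat list"
  where "word_lens (A, B, C, T, w, gs) = map length C"

section \<open>Witnesses for degrees 5 to 10\<close>

definition words5 :: "word_witness list"
  where "words5 = [
    ([[2, 4, 3]], [[1, 5, 4, 3, 2]], [[1], [2, 3, 5], [4]], [2, 4, 3], [0], [[1, 1]]),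
    ([[1, 2, 4, 3, 5]], [[1, 3, 2]], [[1, 3, 2, 4, 5]], [1, 3, 2], [1], [[0]])]"

definition words6 :: "word_witness list"
  where "words6 = [
    ([[1, 4, 3, 2, 6]], [[1, 3], [2, 4, 6, 5]], [[1, 5], [2, 6], [3], [4]], [2, 3, 5], [1, 0, 0], [[1], [0]]),
    ([[1, 4, 5, 2, 3]], [[1, 3, 4, 2, 6]], [[1, 6, 2, 5], [3, 4]], [2, 4, 3], [1, 1, 0, 1, 0, 0], [[0], [1]]),
    ([[1, 3, 5], [2, 4, 6]], [[1, 2, 3]], [[1, 2, 3, 6, 5], [4]], [1, 2, 3], [1], [[0], [0, 0]])]"

definition words7 :: "word_witness list"
  where "words7 = [
    ([[1, 5], [2, 6], [3, 7, 4]], [[1, 3], [2, 4, 7, 6]], [[1, 7, 2, 5, 4, 6, 3]], [3, 4, 7], [0, 0], [[1], [0, 1]]),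
    ([[2, 7, 6]], [[1, 2, 3, 5, 6, 7, 4]], [[1, 7, 2, 6, 5], [3], [4]], [2, 7, 6], [0], [[1], [1, 1]]),
    ([[1, 4, 2, 7, 6]], [[1, 3, 7], [2, 6], [4, 5]], [[1, 6, 3, 4], [2], [5, 7]], [1, 7, 3], [1, 1], [[0], [1, 0]]),
    ([[1, 7, 4, 2, 3, 6, 5]], [[1, 4, 5, 2, 3, 7, 6]], [[1, 6, 2], [3, 5, 4], [7]], [1, 3, 4], [1, 0, 0, 0], [[1], [0]]),
    ([[1, 4], [2, 5, 3], [6, 7]], [[1, 2, 7], [4, 6, 5]], [[1, 7, 2], [3, 4], [5, 6]], [2, 3, 5], [0, 0], [[1], [0, 1]]),
    ([[1, 4, 7, 2, 5, 6, 3]], [[1, 6], [2, 7, 4], [3, 5]], [[1, 2], [3], [4, 6], [5], [7]], [2, 4, 7], [1, 1], [[0, 0], [1, 0, 0]])]"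

text \<open>The type $2^4$ is missing on purpose: these elements of $A_8$ are not commutators of generating pairs,
  which is why products of two elements are tabulated for degree 8 as well.\<close>

definition words8 :: "word_witness list"
  where "words8 = [
    ([[1, 8], [2, 6, 7], [3, 5]], [[1, 6, 7, 8, 2, 3, 4]], [[1, 2, 3, 5, 7, 4, 6], [8]], [2, 7, 6], [0, 0], [[1], [0, 1], [1, 1]]),
    ([[1, 4], [2, 7, 8], [5, 6]], [[1, 8, 6, 2, 7, 4, 3]], [[1, 5, 7, 3, 2, 4], [6, 8]], [2, 8, 7], [0, 0], [[1], [0, 1], [1, 1]]),
    ([[2, 5, 8], [4, 6, 7]], [[1, 5], [2, 7, 8], [3, 4]], [[1, 6, 8], [2, 3, 4, 7, 5]], [2, 8, 7], [1, 1], [[0], [1, 0], [0, 0]]),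
    ([[1, 3, 6, 4], [2, 5, 7, 8]], [[1, 5, 2, 8, 7], [3, 4, 6]], [[1, 7, 3, 5, 4], [2], [6], [8]], [1, 4, 5], [1, 0], [[0], [1], [0, 0]]),
    ([[1, 3], [2, 4, 8], [5, 7]], [[1, 3, 4, 7, 6, 5, 8]], [[1, 4, 6, 2], [3, 7, 5, 8]], [2, 8, 4], [0, 0], [[1], [0, 1], [1, 1]]),
    ([[1, 7], [2, 6, 4], [3, 5]], [[1, 5, 4], [2, 3, 6, 7, 8]], [[1, 4, 2, 7], [3], [5, 8], [6]], [2, 4, 6], [0, 0], [[1, 1], [0, 1], [1]]),
    ([[1, 2, 7, 6, 3, 4], [5, 8]], [[1, 4, 3], [2, 8, 5, 6, 7]], [[1, 6, 8], [2, 5, 3], [4], [7]], [1, 8, 6], [1, 0], [[0, 0], [1, 1], [0]]),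
    ([[1, 5], [2, 8, 6, 3, 4, 7]], [[1, 7, 2, 3, 8, 4, 5]], [[1, 4], [2], [3, 8, 5], [6, 7]], [3, 7, 5], [1, 0, 1, 0], [[0, 1], [1], [0]]),
    ([[1, 8, 4, 6], [2, 3, 5, 7]], [[1, 2, 6, 7, 4, 5, 3]], [[1, 3], [2], [4], [5, 8], [6], [7]], [1, 8, 3], [1, 1, 0], [[0], [0, 0], [1]])]"

text \<open>The single entry has type 2^4 1, the one type needed in degree 9 that
  \<open>table9\<close> does not contain.\<close>

definition words9 :: "word_witness list"
  where "words9 = [
    ([[2, 7, 6, 5], [3, 8, 9, 4]], [[1, 7, 4], [2, 3], [5, 8, 6, 9]], [[1, 3], [2, 6], [4, 9], [5, 7], [8]], [1, 7, 4], [1, 1, 1, 1], [[0], [0, 0], [1, 0]])]"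

text \<open>No cycle is flagged here or in degree 10, because the insertions start only at degree
  11.\<close>

definition table9 :: "witness list"
  where "table9 = [
    ([], [5, 6, 7, 8, 9], [1, 5, 6, 8], [], [2, 3, 7, 9, 4], [[1, 9, 3, 6, 7, 8, 5, 2, 4]], []),
    ([], [5, 6, 7, 8, 9], [1, 5, 6, 7], [], [2, 3, 4, 9, 8], [[1, 9, 7, 5, 2, 4, 8], [3], [6]], []),
    ([], [5, 6, 7, 8, 9], [1, 5, 6, 7], [], [2, 3, 8, 4, 9], [[2, 4, 8, 3, 7, 5], [1, 9], [6]], []),
    ([], [5, 6, 7, 8, 9], [1, 5, 6, 7], [], [2, 8, 3, 9, 4], [[1, 9, 3, 8, 4], [2, 7, 5], [6]], []),
    ([], [5, 6, 7, 8, 9], [1, 5, 6, 9], [], [2, 3, 8, 7, 4], [[1, 9, 5, 2, 4], [3, 7], [6, 8]], []),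
    ([], [5, 6, 7, 8, 9], [3, 5, 1, 2], [], [4, 7, 8, 9, 6], [[3, 9, 5, 4, 6], [1], [2], [7], [8]], []),
    ([], [5, 6, 7, 8, 9], [1, 5, 6, 7], [], [2, 3, 9, 4, 8], [[1, 9, 3, 8], [2, 4, 7, 5], [6]], []),
    ([], [5, 6, 7, 8, 9], [1, 5, 6, 8], [], [2, 3, 7, 4, 9], [[2, 4, 8, 5], [3, 6, 7], [1, 9]], []),
    ([], [5, 6, 7, 8, 9], [1, 5, 6, 7], [], [2, 3, 4, 8, 9], [[2, 4, 7, 5], [1, 9], [3], [6], [8]], []),
    ([], [5, 6, 7, 8, 9], [1, 5, 6, 8], [], [2, 9, 3, 7, 4], [[1, 9, 4], [2, 8, 5], [3, 6, 7]], []),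
    ([], [5, 6, 7, 8, 9], [1, 5, 6, 7], [], [2, 8, 9, 3, 4], [[1, 9, 4], [2, 7, 5], [3], [6], [8]], []),
    ([], [5, 6, 7, 8, 9], [1, 5, 6, 7], [], [2, 8, 3, 4, 9], [[2, 7, 5], [1, 9], [4, 8], [3], [6]], [])]"

definition table10 :: "witness list"
  where "table10 = [
    ([10], [5, 6, 7, 8, 9], [1, 5, 6, 7], [2], [3, 8, 4, 9, 10], [[1, 9, 10, 4, 8, 3, 7, 5, 2], [6]], []),
    ([10], [5, 6, 7, 8, 9], [1, 5, 6, 8], [2], [3, 7, 9, 4, 10], [[1, 9, 3, 6, 7, 8, 5, 2], [4, 10]], []),
    ([10], [5, 6, 7, 8, 9], [1, 5, 6, 8], [2], [3, 7, 4, 9, 10], [[1, 9, 10, 4, 8, 5, 2], [3, 6, 7]], []),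
    ([10], [5, 6, 7, 8, 9], [1, 5, 6, 7], [2], [3, 4, 8, 9, 10], [[1, 9, 10, 4, 7, 5, 2], [3], [6], [8]], []),
    ([10], [5, 6, 7, 8, 9], [1, 5, 6, 8], [2], [3, 7, 10, 4, 9], [[1, 9, 4, 8, 5, 2], [3, 6, 7, 10]], []),
    ([10], [5, 6, 7, 8, 9], [1, 5, 6, 7], [2], [3, 4, 8, 10, 9], [[1, 9, 4, 7, 5, 2], [8, 10], [3], [6]], []),
    ([10], [5, 6, 7, 8, 9], [1, 5, 6, 8], [3], [2, 4, 9, 7, 10], [[1, 9, 6, 7, 10], [2, 3, 4, 8, 5]], []),
    ([10], [5, 6, 7, 8, 9], [1, 5, 6, 7], [2], [3, 4, 9, 8, 10], [[1, 9, 7, 5, 2], [4, 8, 10], [3], [6]], []),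
    ([10], [5, 6, 7, 8, 9], [1, 5, 6, 7], [2], [3, 9, 8, 4, 10], [[1, 9, 7, 5, 2], [3, 8], [4, 10], [6]], []),
    ([10], [5, 6, 7, 8, 9], [3, 5, 1, 2], [4], [6, 7, 8, 9, 10], [[3, 9, 10, 5, 4], [1], [2], [6], [7], [8]], []),
    ([10], [5, 6, 7, 8, 9], [1, 5, 6, 7], [3], [2, 10, 8, 9, 4], [[1, 9, 3, 4], [2, 10, 7, 5], [6], [8]], []),
    ([10], [5, 6, 7, 8, 9], [1, 5, 6, 7], [3], [2, 8, 4, 10, 9], [[3, 4, 10, 8], [2, 7, 5], [1, 9], [6]], []),
    ([10], [5, 6, 7, 8, 9], [1, 5, 6, 8], [7], [2, 3, 10, 4, 9], [[2, 4, 8, 5], [1, 9], [3, 10], [6, 7]], []),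
    ([10], [5, 6, 7, 8, 9], [3, 5, 1, 2], [4], [6, 7, 8, 10, 9], [[3, 9, 5, 4], [8, 10], [1], [2], [6], [7]], []),
    ([10], [5, 6, 7, 8, 9], [1, 5, 6, 7], [3], [2, 8, 4, 9, 10], [[1, 9, 10], [2, 7, 5], [3, 4, 8], [6]], []),
    ([10], [5, 6, 7, 8, 9], [1, 5, 6, 8], [7], [2, 9, 3, 10, 4], [[1, 9, 4], [2, 8, 5], [3, 10], [6, 7]], []),
    ([10], [5, 6, 7, 8, 9], [3, 5, 1, 2], [6], [4, 7, 8, 9, 10], [[3, 9, 10], [4, 6, 5], [1], [2], [7], [8]], []),
    ([10], [5, 6, 7, 8, 9], [3, 5, 1, 2], [6], [4, 7, 8, 10, 9], [[4, 6, 5], [3, 9], [8, 10], [1], [2], [7]], []),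
    ([10], [5, 6, 7, 8, 9], [3, 5, 1, 2], [7], [4, 6, 8, 10, 9], [[3, 9], [4, 5], [6, 7], [8, 10], [1], [2]], [])]"

lemma words_ok:
  "list_all (word_witness_ok 5) words5" "list_all (word_witness_ok 6) words6" "list_all (word_witness_ok 7) words7"
  "list_all (word_witness_ok 8) words8" "list_all (word_witness_ok 9) words9"
  by code_simp+

lemma tables_ok: "list_all (witness_ok 9) table9" "list_all (witness_ok 10) table10"
  by code_simp+

section \<open>Products of two nontrivial classes in degrees 5, 6 and 8\<close>

type_synonym product_witness = "nat list list \<times> nat list list \<times> nat list list"

fun same_multiset :: "nat list \<Rightarrow> nat list \<Rightarrow> bool"
  where "same_multiset t l \<longleftrightarrow> length t = length l \<and> sublist_ms t l"

fun product_ok :: "nat \<Rightarrow> nat list list \<Rightarrow> product_witness \<Rightarrow> bool"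
  where "product_ok n L (G, C, P) \<longleftrightarrow>
    perm_list n (concat G) \<and> perm_list n (concat C) \<and> perm_list n (concat P) \<and>
    agree_on G C P (concat P) \<and> list_ex (same_multiset (map length P)) L"

text \<open>One order of the two factors is enough, because x y and y x are conjugate.\<close>

fun product_lens :: "nat list \<Rightarrow> nat list \<Rightarrow> product_witness \<Rightarrow> bool"
  where "product_lens s t (G, C, P) \<longleftrightarrow>
    same_multiset s (map length G) \<and> same_multiset t (map length C) \<or>
    same_multiset s (map length C) \<and> same_multiset t (map length G)"

definition nontrivial_even :: "nat \<Rightarrow> nat list list"
  where "nontrivial_even n = filter (\<lambda>t. even (length (filter even t)) \<and> list_ex ((\<le>) 2) t) (part_lists n n n)"

definition products_complete :: "nat \<Rightarrow> product_witness list \<Rightarrow> bool"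
  where "products_complete n Q \<longleftrightarrow>
    list_all (\<lambda>s. list_all (\<lambda>t. list_ex (product_lens s t) Q) (nontrivial_even n)) (nontrivial_even n)"

definition products5 :: "product_witness list"
  where "products5 = [
    ([[1, 2, 3, 4, 5]], [[1, 5, 2, 4, 3]], [[1], [2, 5, 3], [4]]),
    ([[1, 2, 3, 4, 5]], [[1, 5, 2], [3], [4]], [[1], [2], [3, 4, 5]]),
    ([[1, 2, 3, 4, 5]], [[1, 5], [2], [3, 4]], [[1], [2, 3, 5], [4]]),
    ([[1, 2, 3], [4], [5]], [[1], [2], [3, 4, 5]], [[1, 2, 3, 4, 5]]),
    ([[1, 2, 3], [4], [5]], [[1, 2], [3, 4], [5]], [[1, 3, 4], [2], [5]]),
    ([[1, 2], [3, 4], [5]], [[1, 5], [2, 3], [4]], [[1, 5, 2, 4, 3]])]"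

definition products6 :: "product_witness list"
  where "products6 = [
    ([[1, 2, 3, 4, 5], [6]], [[1], [2, 6, 3, 5, 4]], [[1, 2, 6, 4, 3], [5]]),
    ([[1, 2, 3, 4, 5], [6]], [[1, 5, 2, 6], [3, 4]], [[1], [2, 6], [3, 5], [4]]),
    ([[1, 2, 3, 4, 5], [6]], [[1, 3, 6], [2, 5, 4]], [[1, 4, 3, 6, 2], [5]]),
    ([[1, 2, 3, 4, 5], [6]], [[1], [2, 4, 5], [3], [6]], [[1, 2, 5, 3, 4], [6]]),
    ([[1, 2, 3, 4, 5], [6]], [[1, 4], [2, 3], [5], [6]], [[1, 5], [2, 4], [3], [6]]),
    ([[1, 2, 3, 4], [5, 6]], [[1, 4], [2, 3, 5, 6]], [[1], [2, 4], [3, 6], [5]]),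
    ([[1, 2, 3, 4], [5, 6]], [[1, 6, 4], [2, 3, 5]], [[1, 5, 3, 6], [2, 4]]),
    ([[1, 2, 3, 4], [5, 6]], [[1], [2, 4, 3], [5], [6]], [[1, 2], [3], [4], [5, 6]]),
    ([[1, 2, 3, 4], [5, 6]], [[1, 6], [2, 4], [3], [5]], [[1, 5, 6, 2], [3, 4]]),
    ([[1, 2, 3], [4, 5, 6]], [[1, 4, 2], [3, 5, 6]], [[1, 5, 4, 3, 6], [2]]),
    ([[1, 2, 3], [4, 5, 6]], [[1, 2, 4], [3], [5], [6]], [[1, 3], [2, 5, 6, 4]]),
    ([[1, 2, 3], [4, 5, 6]], [[1, 2], [3], [4], [5, 6]], [[1, 3], [2], [4, 5], [6]]),
    ([[1, 2, 3], [4], [5], [6]], [[1], [2, 4, 6], [3], [5]], [[1, 2, 4, 6, 3], [5]]),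
    ([[1, 2, 3], [4], [5], [6]], [[1], [2, 6], [3, 5], [4]], [[1, 2, 6, 3, 5], [4]]),
    ([[1, 2], [3, 4], [5], [6]], [[1, 2], [3], [4], [5, 6]], [[1], [2], [3, 4], [5, 6]])]"

definition products8 :: "product_witness list"
  where "products8 = [
    ([[1, 2, 3, 4, 5, 6, 7], [8]], [[1, 4, 3, 2, 6, 7, 5], [8]], [[1, 5, 2, 7, 6], [3], [4], [8]]),
    ([[1, 2, 3, 4, 5, 6, 7], [8]], [[1, 4, 2, 6, 5, 7], [3, 8]], [[1, 5], [2, 7], [3, 8, 4], [6]]),
    ([[1, 2, 3, 4, 5, 6, 7], [8]], [[1, 7, 2], [3, 6, 4, 8, 5]], [[1], [2], [3, 7], [4, 8, 6, 5]]),
    ([[1, 2, 3, 4, 5, 6, 7], [8]], [[1, 6, 4, 7, 8], [2], [3], [5]], [[1, 7, 8, 2, 3, 4], [5, 6]]),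
    ([[1, 2, 3, 4, 5, 6, 7], [8]], [[1, 4, 8, 7], [2, 6, 3, 5]], [[1, 5, 3, 6, 4, 8], [2, 7]]),
    ([[1, 2, 3, 4, 5, 6, 7], [8]], [[1, 5, 4, 7], [2], [3], [6, 8]], [[1, 6, 8, 7, 2, 3, 4], [5]]),
    ([[1, 2, 3, 4, 5, 6, 7], [8]], [[1], [2], [3, 8, 5], [4, 6, 7]], [[1, 2, 3, 8, 6], [4, 7, 5]]),
    ([[1, 2, 3, 4, 5, 6, 7], [8]], [[1, 7], [2, 8, 4], [3, 6], [5]], [[1], [2, 8, 5, 6, 4, 3, 7]]),
    ([[1, 2, 3, 4, 5, 6, 7], [8]], [[1, 6, 2], [3], [4], [5], [7], [8]], [[1, 7], [2], [3, 4, 5, 6], [8]]),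
    ([[1, 2, 3, 4, 5, 6, 7], [8]], [[1, 2], [3, 6], [4, 5], [7, 8]], [[1, 3, 7, 8], [2], [4, 6], [5]]),
    ([[1, 2, 3, 4, 5, 6, 7], [8]], [[1], [2, 7], [3, 6], [4], [5], [8]], [[1, 2], [3, 7], [4, 5, 6], [8]]),
    ([[1, 2, 3, 4, 5, 6], [7, 8]], [[1, 6], [2, 7, 3, 5, 4, 8]], [[1], [2, 8, 3, 6], [4, 7], [5]]),
    ([[1, 2, 3, 4, 5, 6], [7, 8]], [[1, 7, 4], [2, 8, 6, 3, 5]], [[1, 8], [2, 7, 5, 3, 6, 4]]),
    ([[1, 2, 3, 4, 5, 6], [7, 8]], [[1], [2, 5, 3, 7, 4], [6], [8]], [[1, 2, 6], [3, 8, 7, 5, 4]]),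
    ([[1, 2, 3, 4, 5, 6], [7, 8]], [[1, 8, 6, 4], [2, 5, 7, 3]], [[1, 7, 4, 2, 6, 5, 8], [3]]),
    ([[1, 2, 3, 4, 5, 6], [7, 8]], [[1, 5], [2, 3, 7, 8], [4], [6]], [[1, 6], [2, 4, 5], [3, 8], [7]]),
    ([[1, 2, 3, 4, 5, 6], [7, 8]], [[1, 8, 7], [2], [3, 4, 5], [6]], [[1, 7, 2, 3, 5, 4, 6], [8]]),
    ([[1, 2, 3, 4, 5, 6], [7, 8]], [[1, 2], [3, 8, 7], [4], [5, 6]], [[1, 3, 7, 4, 5], [2], [6], [8]]),
    ([[1, 2, 3, 4, 5, 6], [7, 8]], [[1], [2], [3, 8, 6], [4], [5], [7]], [[1, 2, 3, 7, 8], [4, 5, 6]]),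
    ([[1, 2, 3, 4, 5, 6], [7, 8]], [[1, 7], [2, 3], [4, 6], [5, 8]], [[1, 8, 6, 5, 7, 2, 4], [3]]),
    ([[1, 2, 3, 4, 5, 6], [7, 8]], [[1], [2, 6], [3], [4], [5, 7], [8]], [[1, 2], [3, 4, 5, 8, 7, 6]]),
    ([[1, 2, 3, 4, 5], [6, 7, 8]], [[1, 2, 7], [3, 6, 4, 8, 5]], [[1, 3, 7, 2, 8], [4, 6, 5]]),
    ([[1, 2, 3, 4, 5], [6, 7, 8]], [[1, 7, 4, 5, 6], [2], [3], [8]], [[1, 8, 6, 2, 3, 4], [5, 7]]),
    ([[1, 2, 3, 4, 5], [6, 7, 8]], [[1, 8, 4, 2], [3, 5, 7, 6]], [[1, 6, 4, 3], [2], [5, 8], [7]]),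
    ([[1, 2, 3, 4, 5], [6, 7, 8]], [[1], [2, 5], [3, 8, 4, 6], [7]], [[1, 2], [3, 6, 4, 7, 8, 5]]),
    ([[1, 2, 3, 4, 5], [6, 7, 8]], [[1, 8, 3], [2], [4, 6, 7], [5]], [[1, 6, 8, 4, 7, 5], [2, 3]]),
    ([[1, 2, 3, 4, 5], [6, 7, 8]], [[1], [2, 6, 7], [3, 8], [4, 5]], [[1, 2, 7, 3, 6, 8, 4], [5]]),
    ([[1, 2, 3, 4, 5], [6, 7, 8]], [[1, 2, 3], [4], [5], [6], [7], [8]], [[1, 3, 2, 4, 5], [6, 7, 8]]),
    ([[1, 2, 3, 4, 5], [6, 7, 8]], [[1, 2], [3, 7], [4, 5], [6, 8]], [[1, 3, 8, 7, 4], [2], [5], [6]]),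
    ([[1, 2, 3, 4, 5], [6, 7, 8]], [[1], [2], [3], [4, 5], [6, 8], [7]], [[1, 2, 3, 4], [5], [6], [7, 8]]),
    ([[1, 2, 3, 4, 5], [6], [7], [8]], [[1, 8, 5, 3, 7], [2], [4], [6]], [[1, 8], [2, 3, 7], [4, 5], [6]]),
    ([[1, 2, 3, 4, 5], [6], [7], [8]], [[1, 7, 5, 6], [2, 8, 3, 4]], [[1, 7], [2, 8, 4, 3, 5, 6]]),
    ([[1, 2, 3, 4, 5], [6], [7], [8]], [[1, 8], [2, 6, 3, 5], [4], [7]], [[1, 8, 2, 6, 4, 5, 3], [7]]),
    ([[1, 2, 3, 4, 5], [6], [7], [8]], [[1, 6, 3], [2], [4, 8, 5], [7]], [[1, 6, 4, 8], [2, 3], [5], [7]]),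
    ([[1, 2, 3, 4, 5], [6], [7], [8]], [[1, 2, 4], [3, 5], [6, 7], [8]], [[1, 3], [2, 5, 4], [6, 7], [8]]),
    ([[1, 2, 3, 4, 5], [6], [7], [8]], [[1], [2, 3, 8], [4], [5], [6], [7]], [[1, 2, 4, 5], [3, 8], [6], [7]]),
    ([[1, 2, 3, 4, 5], [6], [7], [8]], [[1, 2], [3, 7], [4, 6], [5, 8]], [[1, 3, 7, 4, 6, 5, 8], [2]]),
    ([[1, 2, 3, 4, 5], [6], [7], [8]], [[1, 7], [2, 3], [4], [5], [6], [8]], [[1, 7, 2, 4, 5], [3], [6], [8]]),
    ([[1, 2, 3, 4], [5, 6, 7, 8]], [[1, 4, 5, 6], [2, 7, 3, 8]], [[1], [2, 8, 3, 5, 7, 4, 6]]),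
    ([[1, 2, 3, 4], [5, 6, 7, 8]], [[1, 5, 3, 4], [2, 6], [7], [8]], [[1, 6, 3], [2, 7, 8, 5, 4]]),
    ([[1, 2, 3, 4], [5, 6, 7, 8]], [[1, 8, 7], [2, 4, 5], [3], [6]], [[1, 5, 3, 4, 6, 7, 2], [8]]),
    ([[1, 2, 3, 4], [5, 6, 7, 8]], [[1, 3, 7], [2, 4], [5, 6], [8]], [[1, 4, 3, 8, 5, 7, 2], [6]]),
    ([[1, 2, 3, 4], [5, 6, 7, 8]], [[1, 8, 7], [2], [3], [4], [5], [6]], [[1, 5, 6, 7, 2, 3, 4], [8]]),
    ([[1, 2, 3, 4], [5, 6, 7, 8]], [[1, 3], [2, 4], [5, 7], [6, 8]], [[1, 4, 3, 2], [5, 8, 7, 6]]),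
    ([[1, 2, 3, 4], [5, 6, 7, 8]], [[1], [2, 8], [3], [4], [5, 7], [6]], [[1, 2, 5, 8, 3, 4], [6, 7]]),
    ([[1, 2, 3, 4], [5, 6], [7], [8]], [[1, 5, 7, 6], [2, 8], [3], [4]], [[1, 6, 2, 8, 3, 4], [5, 7]]),
    ([[1, 2, 3, 4], [5, 6], [7], [8]], [[1, 6, 5], [2, 3, 7], [4], [8]], [[1, 5, 2, 4], [3, 7], [6], [8]]),
    ([[1, 2, 3, 4], [5, 6], [7], [8]], [[1, 4], [2, 3, 5], [6, 8], [7]], [[1], [2, 4], [3, 6, 8, 5], [7]]),
    ([[1, 2, 3, 4], [5, 6], [7], [8]], [[1, 4, 6], [2], [3], [5], [7], [8]], [[1], [2, 3, 4, 5, 6], [7], [8]]),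
    ([[1, 2, 3, 4], [5, 6], [7], [8]], [[1, 6], [2, 4], [3, 5], [7, 8]], [[1, 5, 4, 3, 6, 2], [7, 8]]),
    ([[1, 2, 3, 4], [5, 6], [7], [8]], [[1], [2], [3, 7], [4], [5, 8], [6]], [[1, 2, 3, 7, 4], [5, 8, 6]]),
    ([[1, 2, 3], [4, 5, 6], [7], [8]], [[1, 3, 6], [2, 8, 4], [5], [7]], [[1], [2, 8, 5, 6], [3, 4], [7]]),
    ([[1, 2, 3], [4, 5, 6], [7], [8]], [[1], [2, 7, 5], [3, 8], [4, 6]], [[1, 2, 7, 6, 5, 3, 8], [4]]),
    ([[1, 2, 3], [4, 5, 6], [7], [8]], [[1, 7, 3], [2], [4], [5], [6], [8]], [[1, 7], [2, 3], [4, 5, 6], [8]]),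
    ([[1, 2, 3], [4, 5, 6], [7], [8]], [[1, 6], [2, 8], [3, 7], [4, 5]], [[1, 4, 6, 2, 8, 3, 7], [5]]),
    ([[1, 2, 3], [4, 5, 6], [7], [8]], [[1], [2, 6], [3], [4, 7], [5], [8]], [[1, 2, 4, 7, 5, 6, 3], [8]]),
    ([[1, 2, 3], [4, 5], [6, 7], [8]], [[1, 3], [2, 6, 4], [5], [7, 8]], [[1], [2, 7, 8, 6, 5, 4, 3]]),
    ([[1, 2, 3], [4, 5], [6, 7], [8]], [[1], [2], [3], [4, 7, 5], [6], [8]], [[1, 2, 3], [4, 6, 7], [5], [8]]),
    ([[1, 2, 3], [4, 5], [6, 7], [8]], [[1, 5], [2, 7], [3, 8], [4, 6]], [[1, 4, 7, 3, 8], [2, 6, 5]]),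
    ([[1, 2, 3], [4, 5], [6, 7], [8]], [[1, 2], [3, 4], [5], [6], [7], [8]], [[1, 3, 5, 4], [2], [6, 7], [8]]),
    ([[1, 2, 3], [4], [5], [6], [7], [8]], [[1, 5, 6], [2], [3], [4], [7], [8]], [[1, 5, 6, 2, 3], [4], [7], [8]]),
    ([[1, 2, 3], [4], [5], [6], [7], [8]], [[1, 3], [2, 6], [4, 7], [5, 8]], [[1], [2, 6, 3], [4, 7], [5, 8]]),
    ([[1, 2, 3], [4], [5], [6], [7], [8]], [[1], [2, 8], [3], [4], [5], [6, 7]], [[1, 2, 8, 3], [4], [5], [6, 7]]),
    ([[1, 2], [3, 4], [5, 6], [7, 8]], [[1, 4], [2, 5], [3, 7], [6, 8]], [[1, 3, 8, 5], [2, 6, 7, 4]]),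
    ([[1, 2], [3, 4], [5, 6], [7, 8]], [[1], [2, 7], [3], [4, 6], [5], [8]], [[1, 2, 8, 7], [3, 4, 5, 6]]),
    ([[1, 2], [3, 4], [5], [6], [7], [8]], [[1], [2, 3], [4, 7], [5], [6], [8]], [[1, 2, 4, 7, 3], [5], [6], [8]])]"

lemma products_ok:
  "list_all (product_ok 5 (map word_lens words5)) products5"
  "list_all (product_ok 6 (map word_lens words6)) products6"
  "list_all (product_ok 8 (map word_lens words8)) products8"
  by code_simp+

lemma products_complete: "products_complete 5 products5" "products_complete 6 products6" "products_complete 8 products8"
  by code_simp+

definition all_covered :: "nat \<Rightarrow> nat list list \<Rightarrow> bool"
  where "all_covered n L \<longleftrightarrow> list_all (\<lambda>t. even_moving_parts t \<longrightarrow> list_ex (same_multiset t) L) (part_lists n n n)"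

fun all_lens :: "nat list \<times> nat list \<Rightarrow> nat list"
  where "all_lens (u, s) = u @ s"

lemma all_covered_7_9_10:
  "all_covered 7 (map word_lens words7)"
  "all_covered 9 (map word_lens words9 @ map (all_lens \<circ> witness_lens) table9)"
  "all_covered 10 (map (all_lens \<circ> witness_lens) table10)"
  by code_simp+

section \<open>From permutations to cycle types\<close>

definition cycle_lens :: "nat list list \<Rightarrow> nat multiset"
  where "cycle_lens css = mset (map length css)"

text \<open>Fixed points are listed as cycles of length one, so the lengths form a partition of
  n.\<close>

definition cycle_form :: "nat \<Rightarrow> nat list list \<Rightarrow> bool"
  where "cycle_form n css \<longleftrightarrow> distinct (concat css) \<and> [] \<notin> set css \<and> set (concat css) = {1..n}"

lemma cycle_form_exists:
  assumes "p permutes {1..n}"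
  obtains css where "cycle_form n css" "cycs css = p"
  using cycs_exists[OF assms] unfolding cycle_form_def by blast

lemma sum_cycle_lens: "cycle_form n css \<Longrightarrow> sum_mset (cycle_lens css) = n"
proof -
  assume "cycle_form n css"
  then have "length (concat css) = n" using distinct_card[of "concat css"] by (simp add: cycle_form_def)
  then show ?thesis unfolding cycle_lens_def sum_mset_sum_list by (simp only: length_concat)
qed

lemma cycle_lens_pos: "cycle_form n css \<Longrightarrow> \<forall>k\<in>#cycle_lens css. 1 \<le> k"
  by (auto simp: cycle_form_def cycle_lens_def Suc_le_eq)

lemma cycle_lens_part_lists:
  assumes "cycle_form n css"
  obtains t where "t \<in> set (part_lists n n n)" "mset t = cycle_lens css"
proof -
  define t where "t = rev (sorted_list_of_multiset (cycle_lens css))"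
  have mt: "mset t = cycle_lens css" by (simp add: t_def)
  have st: "sorted_wrt (\<ge>) t" by (simp add: t_def sorted_wrt_rev)
  have sum: "sum_list t = n" using mt sum_cycle_lens[OF assms] by (metis sum_mset_sum_list)
  have "\<forall>k\<in>set t. 1 \<le> k" using cycle_lens_pos[OF assms] mt by (metis set_mset_mset)
  then have "\<forall>k\<in>set t. 1 \<le> k \<and> k \<le> n" using member_le_sum_list sum by auto
  then have "t \<in> set (part_lists n (sum_list t) n)" by (rule part_lists_complete[OF st]) (simp add: sum)
  then show thesis using that mt sum by simp
qed

lemma evenperm_cycle_lens:
  assumes "cycle_form n css"
  shows "evenperm (cycs css) \<longleftrightarrow> even (size (filter_mset even (cycle_lens css)))"
proof -
  have "even (\<Sum>cs\<leftarrow>css. length cs - 1) \<longleftrightarrow> even (size (filter_mset even (cycle_lens css)))"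
    if "[] \<notin> set css"
    using that by (induction css) (auto simp: cycle_lens_def)
  then show ?thesis using assms evenperm_cycs[of css] unfolding cycle_form_def by metis
qed

lemma card_fixed_cycle_lens:
  assumes "cycle_form n css"
  shows "card {x \<in> {1..n}. cycs css x = x} + moved (cycle_lens css) = n"
proof -
  have "card {x \<in> {1..n}. cycs css x = x} = length (filter (\<lambda>cs. length cs = 1) css)"
    using card_fixed_cycs[of css] assms unfolding cycle_form_def by metis
  also have "\<dots> = count (cycle_lens css) 1"
    unfolding cycle_lens_def by (induction css) auto
  finally show ?thesis using sum_eq_moved[OF cycle_lens_pos[OF assms]] sum_cycle_lens[OF assms] by simp
qed

lemma even_moving_parts_iff: "even_moving_parts t \<longleftrightarrow> even (size (filter_mset even (mset t))) \<and> 5 \<le> moved (mset t)"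
  unfolding even_moving_parts_def moved_def by (simp flip: mset_filter add: sum_mset_sum_list)

lemma same_multiset_iff: "same_multiset t l \<longleftrightarrow> mset t = mset l"
proof
  assume "same_multiset t l"
  then have "mset t \<subseteq># mset l" "size (mset t) = size (mset l)" by (auto simp: sublist_ms_iff)
  then show "mset t = mset l" by (metis mset_subset_size order_less_irrefl subset_mset.le_imp_less_or_eq)
next
  assume "mset t = mset l"
  then show "same_multiset t l" using mset_eq_length by (auto simp: sublist_ms_iff)
qed

declare same_multiset.simps [simp del]

lemma perm_list_set: "perm_list n xs \<Longrightarrow> distinct xs \<and> set xs = {1..n}"
  using set_eq_atLeastAtMost by (auto simp: perm_list_def)

lemma gen_commutator_from_words:
  assumes "list_all (word_witness_ok n) W" "list_ex (same_multiset t) (map word_lens W)"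
    and dss: "distinct (concat dss)" "set (concat dss) = {1..n}" "cycle_lens dss = mset t"
  shows "gen_commutator n (cycs dss)"
proof -
  obtain v where v: "v \<in> set W" "mset t = mset (word_lens v)" using assms(2) by (auto simp: list_ex_iff same_multiset_iff)
  obtain A B C T w gs where veq: "v = (A, B, C, T, w, gs)" by (cases v) auto
  have ok: "word_witness_ok n (A, B, C, T, w, gs)" using assms(1) v(1) unfolding veq list_all_iff by blast
  then have "perm_list n (concat C)" by simp
  then have C: "distinct (concat C)" "set (concat C) = {1..n}" using perm_list_set by blast+
  have "mset (map length C) = mset (map length dss)" using dss(3) v(2) unfolding veq cycle_lens_def by simp
  from gen_commutator_same_type[OF word_witness_gen_commutator[OF ok] C(1) dss(1) C(2) dss(2) this] show ?thesis .
qed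

lemma gen_commutator_from_table:
  assumes "list_all (witness_ok n) W" "list_ex (same_multiset t) (map (all_lens \<circ> witness_lens) W)"
    and dss: "cycle_form n dss" "cycle_lens dss = mset t"
  shows "gen_commutator n (cycs dss)"
proof -
  obtain v where v: "v \<in> set W" "mset t = mset (all_lens (witness_lens v))"
    using assms(2) by (auto simp: list_ex_iff same_multiset_iff)
  obtain F M G' F' N uss sss where veq: "v = (F, M, G', F', N, uss, sss)" by (cases v) auto
  have "witness_ok n (F, M, G', F', N, uss, sss)" using assms(1) v(1) unfolding veq list_all_iff by blast
  from realizable_gen_commutator[OF witness_ok_realizable[OF this], of dss n] show ?thesis
    using dss v(2) unfolding cycle_form_def cycle_lens_def veq by simp
qed

theorem gen_commutator_if_moved:
  assumes n: "7 \<le> n" "n \<noteq> 8" and p: "p \<in> carrier (alt_group n)" "card {x \<in> {1..n}. p x = x} + 5 \<le> n"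
  shows "gen_commutator n p"
proof -
  obtain css where css: "cycle_form n css" "cycs css = p"
    using cycle_form_exists p(1) by (metis alt_group_carrier)
  have ev: "even (size (filter_mset even (cycle_lens css)))"
    using p(1) evenperm_cycle_lens[OF css(1)] css(2) by (simp add: alt_group_carrier)
  have mv: "5 \<le> moved (cycle_lens css)" using card_fixed_cycle_lens[OF css(1)] css(2) p(2) by simp
  obtain t where t: "t \<in> set (part_lists n n n)" "mset t = cycle_lens css"
    using cycle_lens_part_lists[OF css(1)] .
  have gp: "even_moving_parts t" using ev mv t(2) by (simp add: even_moving_parts_iff)
  have all: "list_ex (same_multiset t) L" if "all_covered n L" for L
    using that t(1) gp by (auto simp: all_covered_def list_all_iff)
  consider "n = 7" | "n = 9" | "n = 10" | "11 \<le> n" using n by linarith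
  then show ?thesis
  proof cases
    case 1
    then have "list_ex (same_multiset t) (map word_lens words7)" using all all_covered_7_9_10(1) by blast
    from gen_commutator_from_words[OF words_ok(3) this, of css] show ?thesis using 1 css t(2) by (simp add: cycle_form_def)
  next
    case 2
    then have "list_ex (same_multiset t) (map word_lens words9) \<or> list_ex (same_multiset t) (map (all_lens \<circ> witness_lens) table9)"
      using all all_covered_7_9_10(2) by fastforce
    then show ?thesis
      using gen_commutator_from_words[OF words_ok(5), of t css] gen_commutator_from_table[OF tables_ok(1), of t css] 2 css t(2)
      by (auto simp: cycle_form_def)
  next
    case 3
    then have "list_ex (same_multiset t) (map (all_lens \<circ> witness_lens) table10)" using all all_covered_7_9_10(3) by blast
    from gen_commutator_from_table[OF tables_ok(2) this, of css] show ?thesis using 3 css t(2) by simp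
  next
    case 4
    \<comment> \<open>The induction is entered with no flags; it requests them only on its way
      down.\<close>
    have "realizable (cycle_lens css) {#}"
    proof (rule realizable_flaggable)
      show "even_parts (cycle_lens css + {#})" using ev cycle_lens_pos[OF css(1)] by (simp add: even_parts_def)
      show "5 \<le> moved (cycle_lens css + {#})" "11 \<le> sum_mset (cycle_lens css + {#})"
        using mv 4 sum_cycle_lens[OF css(1)] by simp_all
    qed (simp add: flaggable_def)
    from realizable_gen_commutator[OF this, of css n] show ?thesis using css by (simp add: cycle_form_def cycle_lens_def)
  qed
qed

lemma nontrivial_cycle_form:
  assumes p: "p \<in> carrier (alt_group n)" "p \<noteq> id"
  obtains css t where "cycle_form n css" "cycs css = p" "t \<in> set (nontrivial_even n)" "mset t = cycle_lens css"
proof -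
  obtain css where css: "cycle_form n css" "cycs css = p"
    using cycle_form_exists p(1) by (metis alt_group_carrier)
  obtain t where t: "t \<in> set (part_lists n n n)" "mset t = cycle_lens css"
    using cycle_lens_part_lists[OF css(1)] .
  have "even (size (filter_mset even (mset t)))"
    using p(1) evenperm_cycle_lens[OF css(1)] css(2) t(2) by (simp add: alt_group_carrier)
  then have ev: "even (length (filter even t))" by (metis mset_filter size_mset)
  have "list_ex ((\<le>) 2) t"
  proof (rule ccontr)
    assume "\<not> list_ex ((\<le>) 2) t"
    then have none: "\<forall>k\<in>#cycle_lens css. \<not> 2 \<le> k" unfolding t(2)[symmetric] by (simp add: list_ex_iff)
    have one: "length cs = 1" if "cs \<in> set css" for cs
    proof -
      have "length cs \<in># cycle_lens css" using that by (auto simp: cycle_lens_def)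
      then have "\<not> 2 \<le> length cs" "1 \<le> length cs" using none cycle_lens_pos[OF css(1)] by blast+
      then show ?thesis by linarith
    qed
    have "cycs css ^^ 1 = id" by (rule funpow_cycs) (use css(1) one in \<open>auto simp: cycle_form_def\<close>)
    then show False using p(2) css(2) by simp
  qed
  then show thesis using that css t ev by (auto simp: nontrivial_even_def)
qed

lemma product_gen_commutator_small:
  assumes Q: "list_all (product_ok n (map word_lens W)) Q" "products_complete n Q" "list_all (word_witness_ok n) W"
    and g: "g \<in> carrier (alt_group n)" "g \<noteq> id" and c: "c \<in> carrier (alt_group n)" "c \<noteq> id"
  obtains h where "h permutes {1..n}" "gen_commutator n (g \<circ> (h \<circ> c \<circ> inv' h))"
proof -
  obtain gss s where gs: "cycle_form n gss" "cycs gss = g" "s \<in> set (nontrivial_even n)" "mset s = cycle_lens gss"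
    using nontrivial_cycle_form[OF g] .
  obtain css t where cs: "cycle_form n css" "cycs css = c" "t \<in> set (nontrivial_even n)" "mset t = cycle_lens css"
    using nontrivial_cycle_form[OF c] .
  obtain q where q: "q \<in> set Q" "product_lens s t q"
    using Q(2) gs(3) cs(3) unfolding products_complete_def list_all_iff list_ex_iff by blast
  obtain G C P where qeq: "q = (G, C, P)" by (cases q) auto
  have ok: "product_ok n (map word_lens W) (G, C, P)" using Q(1) q(1) unfolding qeq list_all_iff by blast
  have sets: "distinct (concat G)" "set (concat G) = {1..n}" "distinct (concat C)" "set (concat C) = {1..n}"
    "distinct (concat P)" "set (concat P) = {1..n}"
    using ok perm_list_set[of n "concat G"] perm_list_set[of n "concat C"] perm_list_set[of n "concat P"] by simp_all
  have perms: "cycs G permutes {1..n}" "cycs C permutes {1..n}" "cycs P permutes {1..n}"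
    using cycs_permutes[of G] cycs_permutes[of C] cycs_permutes[of P] unfolding sets by blast+
  have GC: "cycs G \<circ> cycs C = cycs P"
  proof (rule permutes_eqI)
    show "cycs G \<circ> cycs C permutes {1..n}" using perms permutes_compose by metis
    show "cycs P permutes {1..n}" by (rule perms)
    have ag: "agree_on G C P (concat P)" using ok by simp
    show "(cycs G \<circ> cycs C) v = cycs P v" if "v \<in> {1..n}" for v
      using ag that unfolding agree_on_iff[OF sets(1,5,3)] sets(6) by simp
  qed
  have P': "gen_commutator n (cycs P)"
    by (rule gen_commutator_from_words[OF Q(3), of "map length P"]) (use ok sets in \<open>simp_all add: cycle_lens_def\<close>)
  note obtained = that
  have main: thesis if k: "k permutes {1..n}" "k \<circ> p \<circ> inv' k = g" and m: "m permutes {1..n}" "m \<circ> c \<circ> inv' m = q"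
    and XY: "gen_commutator n (p \<circ> q)" for k m p q
  proof (rule obtained)
    have bk: "bij k" and bm: "bij m" using k(1) m(1) permutes_bij by blast+
    show "k \<circ> m permutes {1..n}" using permutes_compose[OF m(1) k(1)] .
    \<comment> \<open>The product for g and c is the conjugate by k of the product of the two
      tabulated representatives.\<close>
    have "g \<circ> ((k \<circ> m) \<circ> c \<circ> inv' (k \<circ> m)) = k \<circ> (p \<circ> q) \<circ> inv' k"
      unfolding k(2)[symmetric] m(2)[symmetric] o_inv_distrib[OF bk bm]
      using bk by (auto simp: fun_eq_iff bij_is_inj)
    then show "gen_commutator n (g \<circ> ((k \<circ> m) \<circ> c \<circ> inv' (k \<circ> m)))" using gen_commutator_conj[OF XY k(1)] by simp
  qed
  have form: "distinct (concat gss)" "set (concat gss) = {1..n}" "distinct (concat css)" "set (concat css) = {1..n}"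
    using gs(1) cs(1) by (auto simp: cycle_form_def)
  consider "mset s = mset (map length G)" "mset t = mset (map length C)"
    | "mset s = mset (map length C)" "mset t = mset (map length G)"
    using q(2) unfolding qeq product_lens.simps same_multiset_iff by blast
  then show thesis
  proof cases
    case 1
    obtain k where k: "k permutes {1..n}" "k \<circ> cycs G \<circ> inv' k = cycs gss"
      by (rule cycs_conjugate[OF sets(1) form(1) sets(2) form(2)]) (use 1 gs(4) in \<open>simp_all add: cycle_lens_def\<close>)
    obtain m where m: "m permutes {1..n}" "m \<circ> cycs css \<circ> inv' m = cycs C"
      by (rule cycs_conjugate[OF form(3) sets(3) form(4) sets(4)]) (use 1 cs(4) in \<open>simp_all add: cycle_lens_def\<close>)
    show thesis by (rule main[of k "cycs G" m "cycs C"]) (use k m gs(2) cs(2) GC P' in auto)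
  next
    case 2
    obtain k where k: "k permutes {1..n}" "k \<circ> cycs C \<circ> inv' k = cycs gss"
      by (rule cycs_conjugate[OF sets(3) form(1) sets(4) form(2)]) (use 2 gs(4) in \<open>simp_all add: cycle_lens_def\<close>)
    obtain m where m: "m permutes {1..n}" "m \<circ> cycs css \<circ> inv' m = cycs G"
      by (rule cycs_conjugate[OF form(3) sets(1) form(4) sets(2)]) (use 2 cs(4) in \<open>simp_all add: cycle_lens_def\<close>)
    have bC: "bij (cycs C)" using perms(2) permutes_bij by blast
    \<comment> \<open>The tabulated order is G C; conjugating it by C gives C G.\<close>
    have "cycs C \<circ> cycs G = cycs C \<circ> cycs P \<circ> inv' (cycs C)"
      unfolding GC[symmetric] using bC by (auto simp: fun_eq_iff bij_is_surj surj_f_inv_f)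
    then have "gen_commutator n (cycs C \<circ> cycs G)" using gen_commutator_conj[OF P' perms(2)] by simp
    then show thesis by (intro main[of k "cycs C" m "cycs G"]) (use k m gs(2) cs(2) in auto)
  qed
qed

section \<open>Products of two nontrivial elements\<close>

text \<open>Averaging over all conjugates: \<open>N i j\<close> counts the conjugates of \<open>c\<close> that map \<open>i\<close> to \<open>j\<close>, and takes only two
  values, one for \<open>i = j\<close> and one for \<open>i \<noteq> j\<close>.\<close>

lemma exists_conjugate_few_fixed:
  fixes g c :: "nat \<Rightarrow> nat"
  assumes n: "7 \<le> n" and g: "g permutes {1..n}" and c: "c permutes {1..n}"
    and fg: "card {x \<in> {1..n}. g x = x} + 3 \<le> n" and fc: "card {x \<in> {1..n}. c x = x} + 3 \<le> n"
  obtains h where "h permutes {1..n}" "card {x \<in> {1..n}. (g \<circ> (h \<circ> c \<circ> inv' h)) x = x} + 5 \<le> n"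
proof (rule ccontr)
  assume contra: "\<not> thesis"
  note obtained = that
  define S where "S = {1..n}"
  define P where "P = {u. u permutes S}"
  define N where "N i j = card {u \<in> P. c (u i) = u j}" for i j
  define r where "r = inv' g"
  have finS: "finite S" and cardS: "card S = n" by (auto simp: S_def)
  have finP: "finite P" unfolding P_def by (rule finite_permutations[OF finS])
  have rp: "r permutes S" unfolding r_def S_def using g by (rule permutes_inv)
  have cp: "c permutes S" using c by (simp add: S_def)
  have bij: "bij u" "\<And>x. u x \<in> S \<longleftrightarrow> x \<in> S" if "u \<in> P" for u
  proof -
    have "u permutes S" using that by (simp add: P_def)
    then show "bij u" "\<And>x. u x \<in> S \<longleftrightarrow> x \<in> S" by (rule permutes_bij, rule permutes_in_image)
  qed
  have card_if: "card {u \<in> A. Q u} = (\<Sum>u\<in>A. if Q u then 1 else 0)" if "finite A" for A :: "'b set" and Q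
    using that by (simp add: sum.If_cases Int_def)
  \<comment> \<open>Replacing u by its composition with a permutation of the points only renumbers i
    and j, so N depends only on whether i = j.\<close>
  have N_conj: "N (\<pi> i) (\<pi> j) = N i j" if \<pi>: "\<pi> \<in> P" for \<pi> i j
  proof -
    have "bij_betw (\<lambda>u. u \<circ> \<pi>) {u \<in> P. c (u (\<pi> i)) = u (\<pi> j)} {u \<in> P. c (u i) = u j}"
    proof (rule bij_betw_byWitness[where f' = "\<lambda>u. u \<circ> inv' \<pi>"])
      have b: "bij \<pi>" using bij(1)[OF \<pi>] .
      have ip: "inv' \<pi> permutes S" using \<pi> permutes_inv unfolding P_def by blast
      show "\<forall>u\<in>{u \<in> P. c (u (\<pi> i)) = u (\<pi> j)}. (u \<circ> \<pi>) \<circ> inv' \<pi> = u"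
        using b by (auto simp: fun_eq_iff bij_is_surj surj_f_inv_f)
      show "\<forall>u\<in>{u \<in> P. c (u i) = u j}. (u \<circ> inv' \<pi>) \<circ> \<pi> = u"
        using b by (auto simp: fun_eq_iff bij_is_inj)
      show "(\<lambda>u. u \<circ> \<pi>) ` {u \<in> P. c (u (\<pi> i)) = u (\<pi> j)} \<subseteq> {u \<in> P. c (u i) = u j}"
        using \<pi> permutes_compose unfolding P_def by fastforce
      show "(\<lambda>u. u \<circ> inv' \<pi>) ` {u \<in> P. c (u i) = u j} \<subseteq> {u \<in> P. c (u (\<pi> i)) = u (\<pi> j)}"
        using permutes_compose[OF ip] b unfolding P_def by (auto simp: bij_is_inj)
    qed
    then show ?thesis unfolding N_def by (rule bij_betw_same_card)
  qed
  have tr: "transpose i j \<in> P" if "i \<in> S" "j \<in> S" for i j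
    unfolding P_def mem_Collect_eq using that by (rule permutes_swap_id)
  have N1: "N i i = N 1 1" if "i \<in> S" for i
  proof -
    have "1 \<in> S" using n by (simp add: S_def)
    from N_conj[OF tr[OF this that], of 1 1] show ?thesis by simp
  qed
  have N2: "N i j = N 1 2" if ij: "i \<in> S" "j \<in> S" "i \<noteq> j" for i j
  proof -
    have S12: "1 \<in> S" "2 \<in> S" using n by (auto simp: S_def)
    define k where "k = transpose 1 i 2"
    have k: "k \<in> S" using bij(2)[OF tr[OF S12(1) ij(1)]] S12(2) by (simp add: k_def)
    have ki: "k \<noteq> i" by (simp add: k_def transpose_def)
    let ?\<pi> = "transpose k j \<circ> transpose 1 i"
    have "?\<pi> \<in> P" using permutes_compose tr[OF k ij(2)] tr[OF S12(1) ij(1)] unfolding P_def mem_Collect_eq by metis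
    moreover have "?\<pi> 1 = i" "?\<pi> 2 = j" using ki ij(3) k_def by simp_all
    ultimately show ?thesis using N_conj[of ?\<pi> 1 2] by simp
  qed
  have swap: "(\<Sum>i\<in>S. card {u \<in> P. Q u i}) = (\<Sum>u\<in>P. card {i \<in> S. Q u i})" for Q
    unfolding card_if[OF finP] card_if[OF finS] by (rule sum.swap)
  have row: "(\<Sum>j\<in>S. N i j) = card P" if i: "i \<in> S" for i
  proof -
    have "card {j \<in> S. c (u i) = u j} = 1" if u: "u \<in> P" for u
    proof -
      have "u i \<in> S" using bij(2)[OF u] i by blast
      then have "c (u i) \<in> S" using permutes_in_image[OF cp] by blast
      moreover have "u (inv' u (c (u i))) = c (u i)" using bij(1)[OF u] by (simp add: bij_is_surj surj_f_inv_f)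
      ultimately have "inv' u (c (u i)) \<in> S" using bij(2)[OF u] by metis
      then have "{j \<in> S. c (u i) = u j} = {inv' u (c (u i))}"
        using bij(1)[OF u] by (auto simp: bij_is_surj surj_f_inv_f bij_is_inj)
      then show ?thesis by simp
    qed
    then show ?thesis unfolding N_def swap by simp
  qed
  have fixc: "card {i \<in> S. c (u i) = u i} = card {x \<in> S. c x = x}" if u: "u \<in> P" for u
  proof -
    have im: "u ` {i \<in> S. c (u i) = u i} = {x \<in> S. c x = x}"
    proof
      show "u ` {i \<in> S. c (u i) = u i} \<subseteq> {x \<in> S. c x = x}" using bij(2)[OF u] by auto
      show "{x \<in> S. c x = x} \<subseteq> u ` {i \<in> S. c (u i) = u i}"
      proof
        fix x assume x: "x \<in> {x \<in> S. c x = x}"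
        obtain i where i: "x = u i" using bij(1)[OF u] by (metis bij_is_surj surjD)
        then show "x \<in> u ` {i \<in> S. c (u i) = u i}" using x bij(2)[OF u] by blast
      qed
    qed
    have "inj_on u {i \<in> S. c (u i) = u i}" using bij_is_inj[OF bij(1)[OF u]] by (rule inj_on_subset) simp
    from card_image[OF this] show ?thesis by (simp only: im)
  qed
  define a b where "a = card {x \<in> S. g x = x}" and "b = card {x \<in> S. c x = x}"
  \<comment> \<open>With the next fact this determines both values: N 1 1 = |P| b / n, and N 1 2 =
    |P| (n - b) / (n (n - 1)).\<close>
  have e1: "n * N 1 1 = card P * b"
  proof -
    have "(\<Sum>i\<in>S. N i i) = (\<Sum>u\<in>P. card {i \<in> S. c (u i) = u i})" unfolding N_def by (rule swap)
    also have "\<dots> = card P * b" using fixc by (simp add: b_def)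
    finally show ?thesis using N1 cardS by simp
  qed
  have e2: "N 1 1 + (n - 1) * N 1 2 = card P"
  proof -
    have S1: "1 \<in> S" using n by (simp add: S_def)
    have "(\<Sum>j\<in>S. N 1 j) = N 1 1 + (\<Sum>j\<in>S - {1}. N 1 j)" using finS S1 by (rule sum.remove)
    also have "(\<Sum>j\<in>S - {1}. N 1 j) = (\<Sum>j\<in>S - {1}. N 1 2)" by (rule sum.cong) (use N2[OF S1] in auto)
    also have "\<dots> = (n - 1) * N 1 2" using cardS S1 finS by simp
    finally show ?thesis using row[OF S1] by simp
  qed
  have rfix: "r i = i \<longleftrightarrow> g i = i" for i
    unfolding r_def using permutes_bij[OF g] by (metis bij_inv_eq_iff)
  have e3: "(\<Sum>i\<in>S. N i (r i)) = a * N 1 1 + (n - a) * N 1 2"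
  proof -
    have "(\<Sum>i\<in>S. N i (r i)) = (\<Sum>i\<in>S. if g i = i then N 1 1 else N 1 2)"
    proof (rule sum.cong)
      fix i assume i: "i \<in> S"
      have "r i \<in> S" using permutes_in_image[OF rp] i by blast
      then show "N i (r i) = (if g i = i then N 1 1 else N 1 2)"
        using N1[OF i] N2[OF i, of "r i"] rfix[of i] by (cases "g i = i") auto
    qed simp
    also have "\<dots> = a * N 1 1 + card {x \<in> S. g x \<noteq> x} * N 1 2"
      using finS by (simp add: sum.If_cases a_def Int_def Collect_neg_eq[symmetric])
    also have "card {x \<in> S. g x \<noteq> x} = n - a"
    proof -
      have "{x \<in> S. g x \<noteq> x} = S - {x \<in> S. g x = x}" by auto
      then show ?thesis using cardS finS by (simp add: a_def card_Diff_subset)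
    qed
    finally show ?thesis .
  qed
  \<comment> \<open>The product of g with the conjugate of c by u^{-1} fixes i exactly if c (u i) =
    u (r i). By the assumption to be refuted, this happens for at least n - 4 points for every
    u.\<close>
  have e4: "card P * (n - 4) \<le> (\<Sum>i\<in>S. N i (r i))"
  proof -
    have "n - 4 \<le> card {i \<in> S. c (u i) = u (r i)}" if u: "u \<in> P" for u
    proof -
      have ip: "inv' u permutes {1..n}" using u permutes_inv unfolding P_def S_def by blast
      have bu: "bij u" using bij(1)[OF u] .
      have bg: "bij g" using g permutes_bij by blast
      have "\<not> card {x \<in> {1..n}. (g \<circ> (inv' u \<circ> c \<circ> inv' (inv' u))) x = x} + 5 \<le> n"
        using contra obtained ip by blast
      moreover have "(g \<circ> (inv' u \<circ> c \<circ> inv' (inv' u))) x = x \<longleftrightarrow> c (u x) = u (r x)" for x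
      proof -
        have "(g \<circ> (inv' u \<circ> c \<circ> inv' (inv' u))) x = x \<longleftrightarrow> inv' u (c (u x)) = r x"
          unfolding r_def inv_inv_eq[OF bu] comp_apply using bg by (metis bij_inv_eq_iff)
        also have "\<dots> \<longleftrightarrow> c (u x) = u (r x)" using bu by (metis bij_inv_eq_iff)
        finally show ?thesis .
      qed
      ultimately show ?thesis unfolding S_def by simp
    qed
    then have "card P * (n - 4) \<le> (\<Sum>u\<in>P. card {i \<in> S. c (u i) = u (r i)})"
      using sum_bounded_below[of P "n - 4"] by simp
    then show ?thesis unfolding N_def swap .
  qed
  have id: "id \<in> P" by (simp add: P_def permutes_id)
  have p: "0 < card P" using finP id by (auto simp: card_gt_0_iff)
  have ab: "a + 3 \<le> n" "b + 3 \<le> n" using fg fc by (simp_all add: a_def b_def S_def)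
  define p' n' a' b' x y where "p' = int (card P)" and "n' = int n" and "a' = int a" and "b' = int b"
    and "x = int (N 1 1)" and "y = int (N 1 2)"
  have i1: "n' * x = p' * b'" using e1 unfolding p'_def n'_def b'_def x_def by (metis of_nat_mult)
  have i2: "x + (n' - 1) * y = p'"
  proof -
    have "int (N 1 1 + (n - 1) * N 1 2) = p'" unfolding p'_def e2 ..
    then show ?thesis using n by (simp add: x_def y_def n'_def of_nat_diff)
  qed
  have i3: "p' * (n' - 4) \<le> a' * x + (n' - a') * y"
  proof -
    have "int (card P * (n - 4)) \<le> int (a * N 1 1 + (n - a) * N 1 2)"
      using e4 unfolding e3 by (simp only: of_nat_le_iff)
    then show ?thesis using n ab by (simp add: p'_def n'_def a'_def x_def y_def of_nat_diff)
  qed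
  have b: "7 \<le> n'" "0 \<le> a'" "0 \<le> b'" "a' \<le> n' - 3" "b' \<le> n' - 3" "0 < p'"
    using n ab p by (simp_all add: n'_def a'_def b'_def p'_def)
  \<comment> \<open>After division by n (n - 1) |P| this says that the average number of fixed
    points is 1 + (a - 1)(b - 1)/(n - 1). Working with the integer identity avoids
    fractions.\<close>
  have "n' * (n' - 1) * (a' * x + (n' - a') * y) = a' * (n' - 1) * (n' * x) + (n' - a') * n' * ((n' - 1) * y)"
    by (simp add: algebra_simps)
  also have "(n' - 1) * y = p' - x" using i2 by simp
  also have "a' * (n' - 1) * (n' * x) + (n' - a') * n' * (p' - x) = a' * (n' - 1) * (n' * x) + (n' - a') * (n' * p' - n' * x)"
    by (simp add: algebra_simps)
  also have "\<dots> = p' * (n' * ((a' - 1) * (b' - 1) + (n' - 1)))"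
    unfolding i1 by (simp add: algebra_simps)
  finally have eq: "n' * (n' - 1) * (a' * x + (n' - a') * y) = p' * (n' * ((a' - 1) * (b' - 1) + (n' - 1)))" .
  have "n' * (n' - 1) * (p' * (n' - 4)) \<le> n' * (n' - 1) * (a' * x + (n' - a') * y)"
    using i3 b(1) by (intro mult_left_mono) auto
  then have "(n' * p') * ((n' - 1) * (n' - 4)) \<le> (n' * p') * ((a' - 1) * (b' - 1) + (n' - 1))"
    unfolding eq by (simp add: algebra_simps)
  moreover have "0 < n' * p'" using b by simp
  ultimately have le: "(n' - 1) * (n' - 4) \<le> (a' - 1) * (b' - 1) + (n' - 1)" by (simp only: mult_le_cancel_left_pos)
  \<comment> \<open>Absolute values are needed because a or b may be 0. The resulting bound 3 (n -
    4) \<le> n - 1 is false for n at least 7.\<close>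
  have "\<bar>a' - 1\<bar> * \<bar>b' - 1\<bar> \<le> (n' - 4) * (n' - 4)" using b by (intro mult_mono) auto
  then have "(a' - 1) * (b' - 1) \<le> (n' - 4) * (n' - 4)" by (metis abs_ge_self abs_mult order_trans)
  then have "(n' - 1) * (n' - 4) \<le> (n' - 4) * (n' - 4) + (n' - 1)" using le by linarith
  moreover have "(n' - 1) * (n' - 4) = (n' - 4) * (n' - 4) + 3 * (n' - 4)" by (simp add: algebra_simps)
  ultimately have "3 * (n' - 4) \<le> n' - 1" by linarith
  then show False using b(1) by presburger
qed

text \<open>A single transposition is odd, so there is a cycle of length at least 3, or a
  transposition together with another cycle of even length.\<close>

lemma alt_group_fixed:
  assumes "p \<in> carrier (alt_group n)" "p \<noteq> id"
  shows "card {x \<in> {1..n}. p x = x} + 3 \<le> n"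
proof -
  obtain css t where css: "cycle_form n css" "cycs css = p" "t \<in> set (nontrivial_even n)" "mset t = cycle_lens css"
    using nontrivial_cycle_form[OF assms] .
  let ?L = "cycle_lens css"
  have ev: "even (size (filter_mset even ?L))"
    using assms(1) evenperm_cycle_lens[OF css(1)] css(2) by (simp add: alt_group_carrier)
  have "\<exists>k\<in>#?L. 2 \<le> k"
    using css(3) unfolding css(4)[symmetric] by (auto simp: nontrivial_even_def list_ex_iff)
  then obtain k L where k: "?L = add_mset k L" "2 \<le> k" by (metis multi_member_split)
  have "3 \<le> moved ?L"
  proof (cases "k = 2")
    case True
    have "filter_mset even L \<noteq> {#}"
    proof
      assume "filter_mset even L = {#}"
      then have "size (filter_mset even ?L) = 1" unfolding k(1) using True by simp
      then show False using ev by simp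
    qed
    then obtain j where "j \<in># filter_mset even L" by (meson multiset_nonemptyE)
    then have j: "j \<in># L" "even j" by auto
    then have "1 \<le> j" using cycle_lens_pos[OF css(1)] k(1) by auto
    then have "2 \<le> j" using j(2) by presburger
    obtain L' where "L = add_mset j L'" using j(1) by (metis multi_member_split)
    then show ?thesis using k True \<open>2 \<le> j\<close> by (simp add: moved_def)
  next
    case False
    then show ?thesis using k by (simp add: moved_def)
  qed
  then show ?thesis using card_fixed_cycle_lens[OF css(1)] css(2) by simp
qed

section \<open>The exceptional signatures\<close>

text \<open>Permutations are represented by their lists of values on \<open>ms\<close>, sorted by
  parity e. A permutation that moves m to i is (m i) composed with one of opposite parity that fixes
  m, so in the value list i goes in front and m takes its place.\<close>

primrec signed_perm_lists :: "nat list \<Rightarrow> bool \<Rightarrow> nat list list"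
  where "signed_perm_lists [] e = (if e then [[]] else [])"
  | "signed_perm_lists (m # ms) e = map (\<lambda>l. m # l) (signed_perm_lists ms e) @
      concat (map (\<lambda>l. map (\<lambda>i. i # map (\<lambda>v. if v = i then m else v) l) ms) (signed_perm_lists ms (\<not> e)))"

lemma signed_perm_lists_complete:
  assumes "distinct ms" "p permutes set ms" "evenperm p = e"
  shows "map p ms \<in> set (signed_perm_lists ms e)"
  using assms
proof (induction ms arbitrary: p e)
  case Nil
  then show ?case by simp
next
  case (Cons m ms)
  define q where "q = transpose m (p m) \<circ> p"
  have p: "p permutes insert m (set ms)" using Cons.prems by simp
  have q: "q permutes set ms" unfolding q_def by (rule permutes_insert_lemma[OF p])
  have perm: "permutation p" using p permutation_permutes by blast
  show ?case
  proof (cases "p m = m")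
    case True
    then have "q = p" by (simp add: q_def)
    then show ?thesis using Cons.IH[of p e] q Cons.prems True by simp
  next
    case False
    have pm: "p m \<in> set ms" using permutes_in_image[OF p, of m] False by auto
    have "evenperm q \<longleftrightarrow> (evenperm (transpose m (p m)) \<longleftrightarrow> evenperm p)"
      unfolding q_def by (rule evenperm_comp[OF permutation_swap_id perm])
    then have "evenperm q = (\<not> e)" using False Cons.prems(3) by (auto simp: evenperm_swap)
    then have mem: "map q ms \<in> set (signed_perm_lists ms (\<not> e))" using Cons.IH[OF _ q] Cons.prems(1) by simp
    have "p v = (if q v = p m then m else q v)" if "v \<in> set ms" for v
    proof -
      have "p v \<noteq> p m" using that Cons.prems(1) permutes_inj[OF p] by (auto dest: injD)
      then show ?thesis by (auto simp: q_def transpose_def)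
    qed
    then have "map p (m # ms) = p m # map (\<lambda>v. if v = p m then m else v) (map q ms)" by simp
    then show ?thesis using mem pm by (auto intro!: bexI[of _ "map q ms"])
  qed
qed

section \<open>Permutations as association lists and invariant families of sets\<close>

fun assoc_apply :: "(nat \<times> nat) list \<Rightarrow> nat \<Rightarrow> nat"
  where "assoc_apply [] v = v"
  | "assoc_apply ((x, y) # ps) v = (if v = x then y else assoc_apply ps v)"

lemma assoc_apply_zip: "v \<in> set xs \<Longrightarrow> assoc_apply (zip xs (map f xs)) v = f v"
  by (induction xs) auto

lemma assoc_apply_map: "v \<in> set xs \<Longrightarrow> inj f \<Longrightarrow> assoc_apply (zip (map f xs) (map g xs)) (f v) = g v"
  by (induction xs) (auto dest: injD)

primrec assoc_power :: "(nat \<times> nat) list \<Rightarrow> nat \<Rightarrow> nat \<Rightarrow> nat"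
  where "assoc_power d 0 v = v"
  | "assoc_power d (Suc k) v = assoc_apply d (assoc_power d k v)"

fun power_fixes :: "(nat \<times> nat) list \<Rightarrow> nat \<Rightarrow> nat list \<Rightarrow> bool"
  where "power_fixes d k [] \<longleftrightarrow> True"
  | "power_fixes d k (v # vs) \<longleftrightarrow> assoc_power d k v = v \<and> power_fixes d k vs"

lemma power_fixes_iff: "power_fixes d k vs \<longleftrightarrow> (\<forall>v\<in>set vs. assoc_power d k v = v)"
  by (induction vs) auto

lemma perm_closed_family:
  assumes fin: "finite Q"
  shows "perm_closed {p. bij p \<and> (\<forall>t\<in>Q. p ` t \<in> Q)}" (is "perm_closed ?K")
  unfolding perm_closed_def
proof (intro conjI ballI)
  fix p assume "p \<in> ?K"
  then have p: "bij p" "(\<lambda>t. p ` t) ` Q \<subseteq> Q" by auto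
  have "inj_on (\<lambda>t. p ` t) Q" by (rule inj_onI) (simp add: inj_image_eq_iff[OF bij_is_inj[OF p(1)]])
  then have eq: "(\<lambda>t. p ` t) ` Q = Q" using fin p(2) by (intro endo_inj_surj)
  have "inv' p ` t \<in> Q" if t: "t \<in> Q" for t
  proof -
    have "t \<in> (\<lambda>t. p ` t) ` Q" using t eq by simp
    then obtain t' where "t' \<in> Q" "t = p ` t'" by blast
    then show ?thesis using p(1) by (simp add: bij_is_inj image_inv_f_f)
  qed
  then show "inv' p \<in> ?K" using p(1) bij_imp_bij_inv by blast
qed (auto intro: bij_comp simp del: o_apply simp: image_comp[symmetric])

fun family_mem :: "nat list \<Rightarrow> nat list list \<Rightarrow> bool"
  where "family_mem t [] \<longleftrightarrow> False"
  | "family_mem t (u # us) \<longleftrightarrow> same_multiset t u \<or> family_mem t us"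

fun family_maps :: "(nat \<times> nat) list \<Rightarrow> nat list list \<Rightarrow> nat list list \<Rightarrow> bool"
  where "family_maps B [] Q \<longleftrightarrow> True"
  | "family_maps B (t # ts) Q \<longleftrightarrow> family_mem (map (assoc_apply B) t) Q \<and> family_maps B ts Q"

lemma family_mem_iff: "family_mem t Q \<longleftrightarrow> (\<exists>u\<in>set Q. mset t = mset u)"
  by (induction t Q rule: family_mem.induct) (auto simp: same_multiset_iff)

lemma family_maps_iff: "family_maps B ts Q \<longleftrightarrow> (\<forall>t\<in>set ts. family_mem (map (assoc_apply B) t) Q)"
  by (induction B ts Q rule: family_maps.induct) auto

text \<open>For a representative \<open>al\<close> of each class, every \<open>bl\<close> either has the wrong commutator with it or preserves one
  of the families \<open>Qs\<close> of sets (points, blocks, or a system of triples), which some 3-cycle does not preserve.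
  The product \<open>a \<circ> b\<close> is compared with \<open>b \<circ> a\<close> because their quotient is conjugate to the commutator.\<close>

fun refuted :: "nat list \<Rightarrow> nat \<Rightarrow> nat list \<Rightarrow> nat list list list \<Rightarrow> nat list \<Rightarrow> bool"
  where "refuted ms k al Qs bl \<longleftrightarrow>
    (let A = zip ms al; B = zip ms bl; ab = map (assoc_apply A) bl; ba = map (assoc_apply B) al
     in ab = ba \<or> \<not> power_fixes (zip ba ab) k ms \<or> list_ex (\<lambda>Q. family_maps B Q Q) Qs)"

fun separates :: "nat \<Rightarrow> nat list \<Rightarrow> nat list list \<Rightarrow> bool"
  where "separates n al Q \<longleftrightarrow> list_all distinct Q \<and> list_all (list_all (\<lambda>v. 1 \<le> v \<and> v \<le> n)) Q \<and>
    family_maps (zip [1..<Suc n] al) Q Q \<and>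
    list_ex (\<lambda>j. \<not> family_maps [(1, 2), (2, j), (j, 1)] Q Q) [3..<Suc n]"

fun rep_refuted :: "nat \<Rightarrow> nat \<Rightarrow> nat list list \<times> nat list list list \<Rightarrow> bool"
  where "rep_refuted n k (A, Qs) \<longleftrightarrow> perm_list n (concat A) \<and>
    (let al = map (apply_cycles A) [1..<Suc n]
     in list_all (separates n al) Qs \<and>
        list_all (refuted [1..<Suc n] k al Qs) (signed_perm_lists [1..<Suc n] True))"

fun rep_lens :: "nat list list \<times> nat list list list \<Rightarrow> nat list"
  where "rep_lens (A, Qs) = map length A"

definition refutation :: "nat \<Rightarrow> nat \<Rightarrow> (nat list list \<times> nat list list list) list \<Rightarrow> bool"
  where "refutation n k R \<longleftrightarrow> list_all (rep_refuted n k) R \<and>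
    list_all (\<lambda>t. list_ex (same_multiset t) (map rep_lens R)) (nontrivial_even n)"

text \<open>The empty list for the 5-cycle means that no element has a commutator of order 2 with
  it, so there is nothing to be refuted by an invariant family.\<close>

definition reps5 :: "(nat list list \<times> nat list list list) list"
  where "reps5 = [
    ([[1, 2], [3, 4], [5]],
     [[[5]]]),
    ([[1, 2, 3], [4], [5]],
     [[[4]],
      [[5]]]),
    ([[1, 2, 3, 4, 5]],
     [])]"

text \<open>The systems of ten triples are 2-(6,3,2) designs: each pair of points lies in exactly
  two triples. Such a design is preserved by a transitive subgroup isomorphic to A_5, for which
  points, pairs and blocks give no obstruction.\<close>

definition reps6 :: "(nat list list \<times> nat list list list) list"
  where "reps6 = [
    ([[1, 2], [3, 4], [5], [6]],
     [[[1, 2, 5], [3, 4, 6]],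
      [[1, 2, 6], [3, 4, 5]],
      [[5]],
      [[6]],
      [[1, 2]],
      [[3, 4]],
      [[1, 3], [2, 4], [5, 6]],
      [[1, 4], [2, 3], [5, 6]],
      [[1, 2, 5], [1, 2, 6], [1, 3, 4], [1, 3, 6], [1, 4, 5], [2, 3, 4], [2, 3, 5], [2, 4, 6], [3, 5, 6], [4, 5, 6]],
      [[1, 2, 5], [1, 2, 6], [1, 3, 4], [1, 3, 5], [1, 4, 6], [2, 3, 4], [2, 3, 6], [2, 4, 5], [3, 5, 6], [4, 5, 6]]]),
    ([[1, 2, 3], [4], [5], [6]],
     [[[1, 2, 3], [4, 5, 6]],
      [[4]],
      [[5]],
      [[6]],
      [[4, 5]],
      [[4, 6]],
      [[5, 6]]]),
    ([[1, 2, 3], [4, 5, 6]],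
     [[[1, 2, 3], [4, 5, 6]],
      [[1, 2, 3], [1, 2, 5], [1, 3, 4], [1, 4, 6], [1, 5, 6], [2, 3, 6], [2, 4, 5], [2, 4, 6], [3, 4, 5], [3, 5, 6]],
      [[1, 2, 4], [1, 2, 5], [1, 3, 4], [1, 3, 6], [1, 5, 6], [2, 3, 5], [2, 3, 6], [2, 4, 6], [3, 4, 5], [4, 5, 6]],
      [[1, 2, 5], [1, 2, 6], [1, 3, 4], [1, 3, 5], [1, 4, 6], [2, 3, 4], [2, 3, 6], [2, 4, 5], [3, 5, 6], [4, 5, 6]],
      [[1, 4], [2, 5], [3, 6]],
      [[1, 5], [2, 6], [3, 4]],
      [[1, 6], [2, 4], [3, 5]]]),
    ([[1, 2, 3, 4], [5, 6]],
     [[[1, 3, 5], [2, 4, 6]],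
      [[1, 3, 6], [2, 4, 5]],
      [[5, 6]],
      [[1, 3], [2, 4], [5, 6]]]),
    ([[1, 2, 3, 4, 5], [6]],
     [[[6]],
      [[1, 2, 3], [1, 2, 5], [1, 3, 6], [1, 4, 5], [1, 4, 6], [2, 3, 4], [2, 4, 6], [2, 5, 6], [3, 4, 5], [3, 5, 6]]])]"

lemma refutation_5: "refutation 5 2 reps5"
  by code_simp

lemma refutation_6: "refutation 6 3 reps6"
  by code_simp

lemma funpow_conj:
  assumes "bij h"
  shows "(h \<circ> p \<circ> inv' h) ^^ k = h \<circ> p ^^ k \<circ> inv' h"
proof (induction k)
  case 0
  then show ?case using assms by (auto simp: fun_eq_iff bij_is_surj surj_f_inv_f)
next
  case (Suc k)
  then show ?case using assms by (auto simp: fun_eq_iff bij_is_inj)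
qed

text \<open>The pair a, b is conjugated simultaneously so that a becomes a listed representative.
  The stabilizer of the family found for it omits some 3-cycle, and its preimage under the
  conjugation is the required H.\<close>

lemma refutation_subgroup:
  assumes R: "refutation n k R" and n: "3 \<le> n"
    and a: "a \<in> carrier (alt_group n)" and b: "b \<in> carrier (alt_group n)"
    and c: "c = inv' a \<circ> inv' b \<circ> a \<circ> b" "c \<noteq> id" "c ^^ k = id"
  obtains H where "perm_closed H" "a \<in> H" "b \<in> H" "\<not> carrier (alt_group n) \<subseteq> H"
proof -
  have perm: "a permutes {1..n}" "b permutes {1..n}" using a b by (simp_all add: alt_group_carrier)
  have "a \<noteq> id"
  proof
    assume "a = id"
    have "c = inv' b \<circ> b" unfolding c(1) \<open>a = id\<close> by (simp only: inv_id id_comp comp_id)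
    then have "c = id" using inv_o_cancel[OF permutes_inj[OF perm(2)]] by simp
    then show False using c(2) by simp
  qed
  then obtain css t where css: "cycle_form n css" "cycs css = a" "t \<in> set (nontrivial_even n)" "mset t = cycle_lens css"
    using nontrivial_cycle_form[OF a] by metis
  then obtain r where r: "r \<in> set R" "same_multiset t (rep_lens r)"
    using R unfolding refutation_def list_all_iff list_ex_iff by (metis (no_types, lifting) image_iff list.set_map)
  obtain A Qs where req: "r = (A, Qs)" by (cases r)
  define ms where "ms = [1..<Suc n]"
  have ms: "set ms = {1..n}" "distinct ms" by (auto simp: ms_def)
  define al where "al = map (apply_cycles A) ms"
  have rr: "rep_refuted n k (A, Qs)" using R r(1) unfolding req refutation_def list_all_iff by blast
  then have sep: "separates n al Q" if "Q \<in> set Qs" for Q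
    using that unfolding rep_refuted.simps Let_def al_def ms_def list_all_iff by blast
  have ref: "refuted ms k al Qs bl" if "bl \<in> set (signed_perm_lists ms True)" for bl
    using rr that unfolding rep_refuted.simps Let_def al_def ms_def list_all_iff by blast
  have A: "distinct (concat A)" "set (concat A) = {1..n}"
    using rr perm_list_set[of n "concat A"] by (simp_all del: upt_Suc)
  have "mset (map length css) = mset (map length A)"
    using css(4) r(2) unfolding req by (simp add: same_multiset_iff cycle_lens_def)
  then obtain h where h: "h permutes {1..n}" "h \<circ> cycs css \<circ> inv' h = cycs A"
    using cycs_conjugate[of css A "{1..n}"] css(1) A unfolding cycle_form_def by metis
  have bh: "bij h" using h(1) by (rule permutes_bij)
  define a0 b0 where "a0 = h \<circ> a \<circ> inv' h" and "b0 = h \<circ> b \<circ> inv' h"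
  have a0: "a0 = cycs A" using h(2) css(2) by (simp add: a0_def)
  have b0c: "b0 \<in> carrier (alt_group n)" unfolding b0_def by (rule alt_group_conj[OF b h(1)])
  have a0p: "a0 permutes {1..n}" using cycs_permutes[of A] A(2) a0 by simp
  have b0p: "b0 permutes {1..n}" using b0c by (simp add: alt_group_carrier)
  have al: "al = map a0 ms" using cycs_apply_cycles[OF A(1)] unfolding al_def a0 by simp
  define bl where "bl = map b0 ms"
  have "bl \<in> set (signed_perm_lists ms True)"
    unfolding bl_def by (rule signed_perm_lists_complete) (use ms b0c in \<open>auto simp: alt_group_carrier\<close>)
  note ref = ref[OF this]
  have Aap: "assoc_apply (zip ms al) v = a0 v" and Bap: "assoc_apply (zip ms bl) v = b0 v" if "v \<in> {1..n}" for v
    using that assoc_apply_zip[of v ms] ms(1) by (simp_all add: al bl_def)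
  have in_a: "a0 v \<in> {1..n} \<longleftrightarrow> v \<in> {1..n}" and in_b: "b0 v \<in> {1..n} \<longleftrightarrow> v \<in> {1..n}" for v
    using permutes_in_image[OF a0p] permutes_in_image[OF b0p] by blast+
  have ab: "map (assoc_apply (zip ms al)) bl = map (a0 \<circ> b0) ms"
    unfolding bl_def map_map by (rule map_cong) (use Aap in_b ms(1) in auto)
  have ba: "map (assoc_apply (zip ms bl)) al = map (b0 \<circ> a0) ms"
    unfolding al map_map by (rule map_cong) (use Bap in_a ms(1) in auto)
  have bij: "bij a" "bij b" "bij a0" "bij b0" using perm a0p b0p permutes_bij by blast+
  have bj: "bij (b0 \<circ> a0)" using bij bij_comp by blast
  define D where "D = (a0 \<circ> b0) \<circ> inv' (b0 \<circ> a0)"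
  have Dperm: "D permutes {1..n}" unfolding D_def
    by (intro permutes_compose permutes_inv a0p b0p)
  \<comment> \<open>From c = a^{-1} b^{-1} a b one has b a c = a b, so D has the same order as
    c.\<close>
  have Dconj: "D = (b0 \<circ> a0 \<circ> h) \<circ> c \<circ> inv' (b0 \<circ> a0 \<circ> h)"
  proof -
    have hb: "bij (b0 \<circ> a0 \<circ> h)" using bj bh bij_comp by blast
    have "(b0 \<circ> a0 \<circ> h) \<circ> c = (a0 \<circ> b0) \<circ> h"
      unfolding c(1) a0_def b0_def using bij(1,2) bh by (auto simp: fun_eq_iff bij_is_inj bij_is_surj surj_f_inv_f)
    then have "(b0 \<circ> a0 \<circ> h) \<circ> c \<circ> inv' (b0 \<circ> a0 \<circ> h) = (a0 \<circ> b0) \<circ> h \<circ> (inv' h \<circ> inv' (b0 \<circ> a0))"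
      unfolding o_inv_distrib[OF bj bh] by simp
    also have "\<dots> = D" unfolding D_def using bh by (auto simp: fun_eq_iff bij_is_surj surj_f_inv_f)
    finally show ?thesis ..
  qed
  define m where "m = b0 \<circ> a0 \<circ> h"
  have bm: "bij m" unfolding m_def using bj bh bij_comp by blast
  have Dm: "D = m \<circ> c \<circ> inv' m" unfolding m_def by (rule Dconj)
  have Dk: "D ^^ k = id"
    unfolding Dm funpow_conj[OF bm] c(3) using bm by (auto simp: fun_eq_iff bij_is_surj surj_f_inv_f)
  have Dne: "map (a0 \<circ> b0) ms \<noteq> map (b0 \<circ> a0) ms"
  proof
    assume eq: "map (a0 \<circ> b0) ms = map (b0 \<circ> a0) ms"
    have "a0 \<circ> b0 = b0 \<circ> a0"
      by (rule permutes_eqI[of _ "{1..n}"]) (use eq ms(1) permutes_compose[OF b0p a0p] permutes_compose[OF a0p b0p] in auto)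
    then have "D = id" unfolding D_def using bj by (metis bij_is_surj surj_iff)
    have "c = inv' m \<circ> D \<circ> m" unfolding Dm using bm by (auto simp: fun_eq_iff bij_is_inj)
    then have "c = id" unfolding \<open>D = id\<close> using bm by (auto simp: fun_eq_iff bij_is_inj)
    then show False using c(2) by simp
  qed
  \<comment> \<open>The pairs of values of b0 a0 and a0 b0 form the graph of D, so no inverse has to
    be computed.\<close>
  define d where "d = zip (map (b0 \<circ> a0) ms) (map (a0 \<circ> b0) ms)"
  have Dap: "assoc_apply d v = D v" if v: "v \<in> {1..n}" for v
  proof -
    define u where "u = inv' (b0 \<circ> a0) v"
    have "u \<in> {1..n}" unfolding u_def using permutes_in_image[OF permutes_inv[OF permutes_compose[OF a0p b0p]]] v by blast
    moreover have "v = (b0 \<circ> a0) u" unfolding u_def using bj by (simp add: bij_is_surj surj_f_inv_f del: o_apply)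
    ultimately show ?thesis
      using assoc_apply_map[of u ms "b0 \<circ> a0" "a0 \<circ> b0"] ms(1) bij_is_inj[OF bj] unfolding D_def d_def u_def by (metis comp_apply)
  qed
  have pow: "assoc_power d j v = (D ^^ j) v \<and> (D ^^ j) v \<in> {1..n}"
    if v: "v \<in> {1..n}" for j v
  proof (induction j)
    case (Suc j)
    then show ?case using Dap permutes_in_image[OF Dperm, of "(D ^^ j) v"] by simp
  qed (use v in simp)
  have "power_fixes d k ms"
    unfolding power_fixes_iff using pow Dk ms(1) by (metis id_apply)
  then obtain Q where Q: "Q \<in> set Qs" "family_maps (zip ms bl) Q Q"
    using ref Dne unfolding refuted.simps Let_def ab ba list_ex_iff d_def by blast
  have sepQ: "list_all (list_all (\<lambda>v. 1 \<le> v \<and> v \<le> n)) Q" "family_maps (zip ms al) Q Q"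
    "list_ex (\<lambda>j. \<not> family_maps [(1, 2), (2, j), (j, 1)] Q Q) [3..<Suc n]" and dQ: "list_all distinct Q"
    using sep[OF Q(1)] unfolding separates.simps ms_def by blast+
  have sets: "p ` t \<in> set ` set Q" if pt: "family_maps ps Q Q" "\<And>v. v \<in> {1..n} \<Longrightarrow> assoc_apply ps v = p v" "t \<in> set ` set Q" for ps p t
  proof -
    obtain l where l: "l \<in> set Q" "t = set l" using pt(3) by blast
    have "\<forall>v\<in>set l. assoc_apply ps v = p v" using pt(2) sepQ(1) l(1) by (auto simp: list_all_iff)
    then have eq: "map (assoc_apply ps) l = map p l" by simp
    obtain u where "u \<in> set Q" "mset (map p l) = mset u"
      using pt(1) l(1) unfolding family_maps_iff family_mem_iff eq[symmetric] by blast
    then show ?thesis using l(2) by (metis image_eqI list.set_map set_mset_mset)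
  qed
  let ?H = "{p. bij p \<and> (\<forall>t\<in>set ` set Q. p ` t \<in> set ` set Q)}"
  have H: "perm_closed ?H" by (rule perm_closed_family) simp
  have aH: "a0 \<in> ?H" using bij(3) sets[OF sepQ(2) Aap] by blast
  have bH: "b0 \<in> ?H" using bij(4) sets[OF Q(2) Bap] by blast
  obtain j where j0: "j \<in> set [3..<Suc n]" "\<not> family_maps [(1, 2), (2, j), (j, 1)] Q Q"
    using sepQ(3) unfolding list_ex_iff by blast
  have j: "j \<in> {3..n}" "\<not> family_maps [(1, 2), (2, j), (j, 1)] Q Q" using j0 by auto
  let ?z = "cycle_of_list [1, 2, j]"
  have dj: "distinct [1, 2, j]" using j(1) by auto
  have z: "?z \<in> carrier (alt_group n)"
  proof -
    have "?z \<in> three_cycles n" using dj j(1) by (intro CollectI exI[of _ "[1, 2, j]"]) auto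
    then show ?thesis using three_cycles_incl by blast
  qed
  have zap: "assoc_apply [(1, 2), (2, j), (j, 1)] v = ?z v" for v
    using dj by (auto simp: transpose_def)
  have "?z \<notin> ?H"
  proof
    assume zH: "?z \<in> ?H"
    have bz: "bij ?z" using zH by blast
    have "family_mem (map ?z l) Q" if l: "l \<in> set Q" for l
    proof -
      have "?z ` set l \<in> set ` set Q" using zH l by blast
      then obtain u where u: "u \<in> set Q" "set (map ?z l) = set u" by auto
      \<comment> \<open>\<open>family_mem\<close> compares multisets; since the listed sets have no
        repetitions, equality of sets is enough.\<close>
      have "distinct (map ?z l)" "distinct u"
        using dQ l u(1) bij_is_inj[OF bz] by (auto simp: list_all_iff distinct_map intro: inj_on_subset)
      then have "mset (map ?z l) = mset u" using u(2) set_eq_iff_mset_eq_distinct by blast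
      then show ?thesis using u(1) unfolding family_mem_iff by blast
    qed
    moreover have "assoc_apply [(1, 2), (2, j), (j, 1)] = ?z" using zap by blast
    ultimately have "family_maps [(1, 2), (2, j), (j, 1)] Q Q" unfolding family_maps_iff by simp
    then show False using j(2) by blast
  qed
  let ?K = "{p. bij p \<and> h \<circ> p \<circ> inv' h \<in> ?H}"
  have K: "perm_closed ?K" by (rule perm_closed_conj[OF H bh])
  have "a \<in> ?K" "b \<in> ?K" using bij(1,2) aH bH unfolding a0_def b0_def by blast+
  moreover have "\<not> carrier (alt_group n) \<subseteq> ?K"
  proof
    assume sub: "carrier (alt_group n) \<subseteq> ?K"
    have "inv' h \<circ> ?z \<circ> inv' (inv' h) \<in> carrier (alt_group n)"
      by (rule alt_group_conj[OF z permutes_inv[OF h(1)]])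
    then have "h \<circ> (inv' h \<circ> ?z \<circ> inv' (inv' h)) \<circ> inv' h \<in> ?H" using sub by blast
    moreover have "h \<circ> (inv' h \<circ> ?z \<circ> inv' (inv' h)) \<circ> inv' h = ?z"
      unfolding inv_inv_eq[OF bh] using bh by (auto simp: fun_eq_iff bij_is_surj surj_f_inv_f)
    ultimately show False using \<open>?z \<notin> ?H\<close> by metis
  qed
  ultimately show thesis using that[OF K] by blast
qed

section \<open>Elements of prescribed order\<close>

lemma alt_group_pow:
  fixes k :: nat
  assumes "p \<in> carrier (alt_group n)"
  shows "p [^]\<^bsub>alt_group n\<^esub> k = p ^^ k"
proof -
  interpret group "alt_group n" by (rule alt_group_is_group)
  show ?thesis
  proof (induction k)
    case 0
    show ?case by (simp only: nat_pow_0 alt_group_one funpow.simps)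
  next
    case (Suc k)
    show ?case by (simp only: nat_pow_Suc Suc alt_group_mult funpow_Suc_right)
  qed
qed

lemma alt_group_ord_dvd_iff:
  assumes "p \<in> carrier (alt_group n)"
  shows "group.ord (alt_group n) p dvd k \<longleftrightarrow> p ^^ k = id"
  using group.pow_eq_id[OF alt_group_is_group assms, of k] alt_group_pow[OF assms] alt_group_one by metis

lemma alt_group_ord_conj:
  assumes "p \<in> carrier (alt_group n)" "h permutes {1..n}"
  shows "group.ord (alt_group n) (h \<circ> p \<circ> inv' h) = group.ord (alt_group n) p"
proof -
  have h: "bij h" using assms(2) by (rule permutes_bij)
  have q: "h \<circ> p \<circ> inv' h \<in> carrier (alt_group n)" by (rule alt_group_conj[OF assms])
  have iff: "(h \<circ> p \<circ> inv' h) ^^ k = id \<longleftrightarrow> p ^^ k = id" for k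
  proof
    assume "(h \<circ> p \<circ> inv' h) ^^ k = id"
    then have eq: "h \<circ> p ^^ k \<circ> inv' h = id" unfolding funpow_conj[OF h] .
    have "(p ^^ k) x = x" for x
    proof -
      have "h ((p ^^ k) x) = h x" using fun_cong[OF eq, of "h x"] h by (simp add: bij_is_inj)
      then show ?thesis using h by (simp add: bij_is_inj inj_eq)
    qed
    then show "p ^^ k = id" by (auto simp: fun_eq_iff)
  next
    assume "p ^^ k = id"
    then show "(h \<circ> p \<circ> inv' h) ^^ k = id"
      unfolding funpow_conj[OF h] using h by (auto simp: fun_eq_iff bij_is_surj surj_f_inv_f)
  qed
  have "group.ord (alt_group n) (h \<circ> p \<circ> inv' h) dvd k \<longleftrightarrow> group.ord (alt_group n) p dvd k" for k
    unfolding alt_group_ord_dvd_iff[OF q] alt_group_ord_dvd_iff[OF assms(1)] by (rule iff)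
  then show ?thesis using dvd_antisym dvd_refl by blast
qed

lemma alt_group_ord_eq_1_iff:
  assumes "p \<in> carrier (alt_group n)"
  shows "group.ord (alt_group n) p = 1 \<longleftrightarrow> p = id"
  using alt_group_ord_dvd_iff[OF assms, of 1] by simp

lemma alt_group_ord_prime:
  assumes "p \<in> carrier (alt_group n)" "p \<noteq> id" "p ^^ q = id" "Factorial_Ring.prime q"
  shows "group.ord (alt_group n) p = q"
proof -
  have "group.ord (alt_group n) p dvd q" using alt_group_ord_dvd_iff[OF assms(1)] assms(3) by simp
  moreover have "group.ord (alt_group n) p \<noteq> 1" using alt_group_ord_eq_1_iff[OF assms(1)] assms(2) by simp
  ultimately show ?thesis using assms(4) unfolding prime_nat_iff by blast
qed

lemma perm_closed_centralizer: "perm_closed {p. bij p \<and> (\<forall>q\<in>Q. \<forall>v. p (q v) = q (p v))}" (is "perm_closed ?K")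
  unfolding perm_closed_def
proof (intro conjI ballI)
  show "id \<in> ?K" by simp
next
  fix p assume "p \<in> ?K"
  then show "bij p" by blast
next
  fix p assume p: "p \<in> ?K"
  have "inv' p (q v) = q (inv' p v)" if "q \<in> Q" for q v
  proof -
    have "p (inv' p x) = x" for x using p by (simp add: bij_is_surj surj_f_inv_f)
    moreover have "p (q (inv' p v)) = q (p (inv' p v))" using p that by simp
    ultimately have "p (inv' p (q v)) = p (q (inv' p v))" by simp
    then show ?thesis using p by (simp add: bij_is_inj inj_eq)
  qed
  then show "inv' p \<in> ?K" using p bij_imp_bij_inv by blast
next
  fix p p' assume "p \<in> ?K" "p' \<in> ?K"
  then show "p \<circ> p' \<in> ?K" by (simp add: bij_comp del: o_apply) simp
qed

text \<open>If the generators commute, the centralizer of both contains the whole group. Hence each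
  generator commutes with every element, and the centralizer of the group contains the group, which
  contradicts (1 2 3) and (1 2 4) not commuting.\<close>

lemma gen_commutator_neq_id:
  assumes "gen_commutator n c" "4 \<le> n"
  shows "c \<noteq> id"
proof
  assume "c = id"
  obtain a b where ab: "a \<in> carrier (alt_group n)" "b \<in> carrier (alt_group n)" and c: "c = inv' a \<circ> inv' b \<circ> a \<circ> b"
    and gen: "\<And>H. perm_closed H \<Longrightarrow> a \<in> H \<Longrightarrow> b \<in> H \<Longrightarrow> carrier (alt_group n) \<subseteq> H"
    using assms(1) unfolding gen_commutator_def by blast
  have bij: "bij p" if "p \<in> carrier (alt_group n)" for p using that permutes_bij by (auto simp: alt_group_carrier)
  have "b (a (c v)) = a (b v)" for v
    unfolding c using bij[OF ab(1)] bij[OF ab(2)] by (simp add: bij_is_surj surj_f_inv_f)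
  then have com: "a (b v) = b (a v)" for v unfolding \<open>c = id\<close> by simp
  let ?C = "\<lambda>Q. {p. bij p \<and> (\<forall>q\<in>Q. \<forall>v. p (q v) = q (p v))}"
  have sub: "carrier (alt_group n) \<subseteq> ?C {a, b}"
    by (rule gen[OF perm_closed_centralizer]) (use com bij ab in auto)
  have "carrier (alt_group n) \<subseteq> ?C (carrier (alt_group n))"
  proof (rule gen[OF perm_closed_centralizer])
    have "a (q v) = q (a v)" "b (q v) = q (b v)" if "q \<in> carrier (alt_group n)" for q v
      using sub that by (metis (mono_tags, lifting) insertCI mem_Collect_eq subsetD)+
    then show "a \<in> ?C (carrier (alt_group n))" "b \<in> ?C (carrier (alt_group n))" using bij ab by blast+
  qed
  then have all: "p (q v) = q (p v)" if "p \<in> carrier (alt_group n)" "q \<in> carrier (alt_group n)" for p q v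
    using that by blast
  have "cycle_of_list [1, 2, k] \<in> carrier (alt_group n)" if "k \<in> {3, 4}" for k
  proof -
    have "cycle_of_list [1, 2, k] \<in> three_cycles n" using that assms(2) by (intro CollectI exI[of _ "[1, 2, k]"]) auto
    then show ?thesis using three_cycles_incl by blast
  qed
  then have "cycle_of_list [1, 2, 3] \<in> carrier (alt_group n)" "cycle_of_list [1, 2, 4] \<in> carrier (alt_group n)" by blast+
  from all[OF this, of 1] show False by (simp add: transpose_def)
qed

lemma product_gen_commutator:
  assumes n: "5 \<le> n" and g: "g \<in> carrier (alt_group n)" "g \<noteq> id" and c: "c \<in> carrier (alt_group n)" "c \<noteq> id"
  obtains h where "h permutes {1..n}" "gen_commutator n (g \<circ> (h \<circ> c \<circ> inv' h))"
proof -
  consider "n = 5" | "n = 6" | "n = 8" | "7 \<le> n" "n \<noteq> 8" using n by linarith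
  then show thesis
  proof cases
    case 1
    then show thesis using product_gen_commutator_small[OF products_ok(1) products_complete(1) words_ok(1)] g c that by metis
  next
    case 2
    then show thesis using product_gen_commutator_small[OF products_ok(2) products_complete(2) words_ok(2)] g c that by metis
  next
    case 3
    then show thesis using product_gen_commutator_small[OF products_ok(3) products_complete(3) words_ok(4)] g c that by metis
  next
    case 4
    have p: "g permutes {1..n}" "c permutes {1..n}" using g(1) c(1) by (simp_all add: alt_group_carrier)
    obtain h where h: "h permutes {1..n}" "card {x \<in> {1..n}. (g \<circ> (h \<circ> c \<circ> inv' h)) x = x} + 5 \<le> n"
      using exists_conjugate_few_fixed[OF 4(1) p alt_group_fixed[OF g] alt_group_fixed[OF c]] .
    have "g \<circ> (h \<circ> c \<circ> inv' h) \<in> carrier (alt_group n)"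
      using monoid.m_closed[OF group.is_monoid[OF alt_group_is_group] g(1) alt_group_conj[OF c(1) h(1)]]
      unfolding alt_group_mult .
    then show thesis using that[OF h(1)] gen_commutator_if_moved[OF 4 _ h(2)] by blast
  qed
qed

text \<open>A type that is not tabulated has only parts 1 and 2 or only parts 1 and 3, so its
  elements have order 2 or 3. In degrees 5 and 6 this order is the excluded one; in degrees 7 and 8
  another, tabulated class has the same order.\<close>

lemma word_types:
  "list_all (\<lambda>t. list_ex (same_multiset t) (map word_lens words5) \<or> list_all (\<lambda>k. k \<in> {1, 2}) t) (nontrivial_even 5)"
  "list_all (\<lambda>t. list_ex (same_multiset t) (map word_lens words6) \<or> list_all (\<lambda>k. k \<in> {1, 3}) t) (nontrivial_even 6)"
  "list_all (\<lambda>t. list_ex (same_multiset t) (map word_lens words7) \<or> list_all (\<lambda>k. k \<in> {1, 3}) t) (nontrivial_even 7)"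
  "list_all (\<lambda>t. list_ex (same_multiset t) (map word_lens words8) \<or> list_all (\<lambda>k. k \<in> {1, 2}) t \<or> list_all (\<lambda>k. k \<in> {1, 3}) t)
    (nontrivial_even 8)"
  by code_simp+

lemma word_types_7_8:
  "list_ex (same_multiset (map length [[1::nat, 2, 3], [4, 5, 6], [7]])) (map word_lens words7)"
  "list_ex (same_multiset (map length [[1::nat, 2], [3, 4], [5], [6], [7], [8]])) (map word_lens words8)"
  "list_ex (same_multiset (map length [[1::nat, 2, 3], [4, 5, 6], [7], [8]])) (map word_lens words8)"
  by code_simp+

lemma funpow_types:
  assumes "cycle_form n css" "mset t = cycle_lens css" "list_all (\<lambda>k. k \<in> {1, q}) t"
  shows "cycs css ^^ q = id"
proof (rule funpow_cycs)
  show "distinct (concat css)" using assms(1) by (simp add: cycle_form_def)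
  fix cs assume "cs \<in> set css"
  then have "length cs \<in># mset t" unfolding assms(2) by (auto simp: cycle_lens_def)
  then show "length cs dvd q" using assms(3) by (auto simp: list_all_iff)
qed

lemma disjoint_cycles_gen_commutator:
  assumes n: "9 \<le> n" and css: "distinct (concat css)" "set (concat css) \<subseteq> {1..n}" "5 \<le> length (concat css)"
    "\<forall>cs\<in>set css. 2 \<le> length cs" "even (\<Sum>cs\<leftarrow>css. length cs - 1)"
  shows "cycs css \<in> carrier (alt_group n)" "gen_commutator n (cycs css)"
proof -
  show c: "cycs css \<in> carrier (alt_group n)"
    using permutes_subset[OF cycs_permutes css(2)] css(1,5) by (simp add: alt_group_carrier evenperm_cycs)
  have "{x \<in> {1..n}. cycs css x = x} \<subseteq> {1..n} - set (concat css)"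
    using cycs_fixed_iff[OF css(1)] css(4) by fastforce
  then have "card {x \<in> {1..n}. cycs css x = x} \<le> card ({1..n} - set (concat css))" by (intro card_mono) auto
  also have "\<dots> = n - length (concat css)"
    using card_Diff_subset[OF _ css(2)] distinct_card[OF css(1)] by simp
  finally have "card {x \<in> {1..n}. cycs css x = x} + 5 \<le> n" using css(3) n by linarith
  then show "gen_commutator n (cycs css)" using gen_commutator_if_moved[of n, OF _ _ c] n by linarith
qed

lemma small_moved_types:
  assumes "\<forall>k\<in>#P. 1 \<le> k" "even (size (filter_mset even P))" "moved P \<le> 4"
  shows "(\<forall>k\<in>#P. k \<in> {1, 2}) \<or> (\<forall>k\<in>#P. k \<in> {1, 3})"
proof (cases "\<exists>k\<in>#P. 3 \<le> k")
  case True
  then obtain k L where k: "P = add_mset k L" "3 \<le> k" by (metis multi_member_split)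
  have L: "j = 1" if j: "j \<in># L" for j
  proof (rule ccontr)
    assume "j \<noteq> 1"
    then have "2 \<le> j" using assms(1) j k(1) by (metis One_nat_def Suc_1 Suc_leI le_neq_implies_less union_iff add_mset_add_single)
    obtain L' where "L = add_mset j L'" using j by (metis multi_member_split)
    then show False using assms(3) k \<open>2 \<le> j\<close> by (simp add: moved_def)
  qed
  have "k \<le> 4" using assms(3) k by (simp add: moved_def)
  moreover have "k \<noteq> 4"
  proof
    assume "k = 4"
    moreover have "filter_mset even L = {#}" by (auto simp: filter_mset_eq_conv dest!: L)
    ultimately have "size (filter_mset even P) = 1" using k(1) by simp
    then show False using assms(2) by simp
  qed
  ultimately have "k = 3" using k(2) by linarith
  then show ?thesis using L k(1) by auto
next
  case False
  have "k \<in> {1, 2}" if "k \<in># P" for k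
  proof -
    have "1 \<le> k" "\<not> 3 \<le> k" using that False assms(1) by auto
    then have "k = 1 \<or> k = 2" by linarith
    then show ?thesis by simp
  qed
  then show ?thesis by blast
qed

lemma cycs_prime_order:
  assumes "cycs css \<in> carrier (alt_group n)" "distinct (concat css)" "\<forall>cs\<in>set css. length cs dvd q" "Factorial_Ring.prime q"
    "cs \<in> set css" "2 \<le> length cs"
  shows "group.ord (alt_group n) (cycs css) = q"
proof (rule alt_group_ord_prime[OF assms(1)])
  show "cycs css ^^ q = id" by (rule funpow_cycs[OF assms(2)]) (use assms(3) in blast)
  have "hd cs \<in> set cs" using assms(6) by (cases cs) auto
  from cycs_fixed_iff[OF assms(2,5) this] assms(6) show "cycs css \<noteq> id" by auto
qed (rule assms(4))

text \<open>An element whose type is not known to work has order 2 or 3 and is traded for another of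
  the same order. In degree at least 9 there is room for four disjoint transpositions or two
  disjoint 3-cycles.\<close>

lemma gen_commutator_of_order:
  assumes n: "5 \<le> n" and m: "m \<in> nontrivial_orders (alt_group n)" "\<not> (n = 5 \<and> m = 2)" "\<not> (n = 6 \<and> m = 3)"
  obtains c where "c \<in> carrier (alt_group n)" "group.ord (alt_group n) c = m" "gen_commutator n c"
proof -
  note obtained = that
  obtain c where c: "c \<in> carrier (alt_group n)" "group.ord (alt_group n) c = m" "m \<noteq> 1"
    using m(1) by (auto simp: nontrivial_orders_def)
  have cid: "c \<noteq> id" using alt_group_ord_eq_1_iff[OF c(1)] c(2,3) by blast
  obtain css t where css: "cycle_form n css" "cycs css = c" "t \<in> set (nontrivial_even n)" "mset t = cycle_lens css"
    using nontrivial_cycle_form[OF c(1) cid] .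
  have primes: "Factorial_Ring.prime (2::nat)" "Factorial_Ring.prime (3::nat)" by simp_all
  have ord: "m = q" if q: "list_all (\<lambda>k. k \<in> {1, q}) t" "Factorial_Ring.prime q" for q
    using alt_group_ord_prime[OF c(1) cid _ q(2)] funpow_types[OF css(1,4) q(1)] css(2) c(2) by simp
  have ord2: "m = 2" if "list_all (\<lambda>k. k \<in> {1, 2}) t" using ord[OF that primes(1)] .
  have ord3: "m = 3" if "list_all (\<lambda>k. k \<in> {1, 3}) t" using ord[OF that primes(2)] .
  have words: thesis if W: "list_all (word_witness_ok n) W" "list_ex (same_multiset t) (map word_lens W)" for W
    using gen_commutator_from_words[OF W, of css] css(1,2,4) obtained[OF c(1,2)] by (simp add: cycle_form_def)
  have special: thesis if W: "list_all (word_witness_ok n) W" "list_ex (same_multiset (map length dss)) (map word_lens W)"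
    and dss: "perm_list n (concat dss)" "\<forall>cs\<in>set dss. length cs dvd m" "Factorial_Ring.prime m"
      "even (\<Sum>cs\<leftarrow>dss. length cs - 1)" "cs \<in> set dss" "2 \<le> length cs"
    for W dss cs
  proof -
    have d: "distinct (concat dss)" "set (concat dss) = {1..n}" using perm_list_set[OF dss(1)] by blast+
    have cd: "cycs dss \<in> carrier (alt_group n)"
      using cycs_permutes[of dss] d dss(4) by (simp add: alt_group_carrier evenperm_cycs)
    show thesis
      by (rule obtained[OF cd cycs_prime_order[OF cd d(1) dss(2,3,5,6)] gen_commutator_from_words[OF W d]])
        (simp add: cycle_lens_def)
  qed
  have large: thesis if "9 \<le> n" and dss: "distinct (concat dss)" "set (concat dss) \<subseteq> {1..n}" "5 \<le> length (concat dss)"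
    "\<forall>cs\<in>set dss. 2 \<le> length cs" "even (\<Sum>cs\<leftarrow>dss. length cs - 1)" and m: "\<forall>cs\<in>set dss. length cs dvd m" "Factorial_Ring.prime m" "dss \<noteq> []"
    for dss
  proof -
    note gen_commutator = disjoint_cycles_gen_commutator[OF that(1) dss]
    have "hd dss \<in> set dss" using m(3) by simp
    then show thesis using cycs_prime_order[OF gen_commutator(1) dss(1) m(1,2)] dss(4) gen_commutator obtained by metis
  qed
  consider "n = 5" | "n = 6" | "n = 7" | "n = 8" | "9 \<le> n" using n by linarith
  then show thesis
  proof cases
    case 1
    then have "list_ex (same_multiset t) (map word_lens words5) \<or> list_all (\<lambda>k. k \<in> {1, 2}) t"
      using word_types(1) css(3) unfolding list_all_iff by blast
    then show thesis using words[of words5] words_ok(1) ord2 m(2) 1 by blast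
  next
    case 2
    then have "list_ex (same_multiset t) (map word_lens words6) \<or> list_all (\<lambda>k. k \<in> {1, 3}) t"
      using word_types(2) css(3) unfolding list_all_iff by blast
    then show thesis using words[of words6] words_ok(2) ord3 m(3) 2 by blast
  next
    case 3
    then have "list_ex (same_multiset t) (map word_lens words7) \<or> list_all (\<lambda>k. k \<in> {1, 3}) t"
      using word_types(3) css(3) unfolding list_all_iff by blast
    then show thesis
    proof
      assume "list_all (\<lambda>k. k \<in> {1, 3}) t"
      then have "m = 3" by (rule ord3)
      show thesis
        by (rule special[of words7 "[[1, 2, 3], [4, 5, 6], [7]]" "[1, 2, 3]"])
          (use 3 words_ok(3) \<open>m = 3\<close> in \<open>simp_all only: word_types_7_8, simp_all add: perm_list_def numeral_2_eq_2[symmetric]\<close>)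
    qed (use words[of words7] words_ok(3) 3 in blast)
  next
    case 4
    then have "list_ex (same_multiset t) (map word_lens words8) \<or> list_all (\<lambda>k. k \<in> {1, 2}) t \<or> list_all (\<lambda>k. k \<in> {1, 3}) t"
      using word_types(4) css(3) unfolding list_all_iff by blast
    then show thesis
    proof (elim disjE)
      assume "list_all (\<lambda>k. k \<in> {1, 2}) t"
      then have "m = 2" by (rule ord2)
      show thesis
        by (rule special[of words8 "[[1, 2], [3, 4], [5], [6], [7], [8]]" "[1, 2]"])
          (use 4 words_ok(4) \<open>m = 2\<close> in \<open>simp_all only: word_types_7_8, simp_all add: perm_list_def numeral_2_eq_2[symmetric]\<close>)
    next
      assume "list_all (\<lambda>k. k \<in> {1, 3}) t"
      then have "m = 3" by (rule ord3)
      show thesis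
        by (rule special[of words8 "[[1, 2, 3], [4, 5, 6], [7], [8]]" "[1, 2, 3]"])
          (use 4 words_ok(4) \<open>m = 3\<close> in \<open>simp_all only: word_types_7_8, simp_all add: perm_list_def numeral_2_eq_2[symmetric]\<close>)
    qed (use words[of words8] words_ok(4) 4 in blast)
  next
    case 5
    show thesis
    proof (cases "card {x \<in> {1..n}. c x = x} + 5 \<le> n")
      case True
      then have "gen_commutator n c" using gen_commutator_if_moved[of n, OF _ _ c(1)] 5 by linarith
      then show thesis using obtained c(1,2) by blast
    next
      case False
      then have "moved (cycle_lens css) \<le> 4" using card_fixed_cycle_lens[OF css(1)] css(2) by simp
      moreover have "even (size (filter_mset even (cycle_lens css)))"
        using c(1) evenperm_cycle_lens[OF css(1)] css(2) by (simp add: alt_group_carrier)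
      ultimately have "(\<forall>k\<in>#cycle_lens css. k \<in> {1, 2}) \<or> (\<forall>k\<in>#cycle_lens css. k \<in> {1, 3})"
        using small_moved_types cycle_lens_pos[OF css(1)] by blast
      then have "list_all (\<lambda>k. k \<in> {1, 2}) t \<or> list_all (\<lambda>k. k \<in> {1, 3}) t"
        unfolding css(4)[symmetric] list_all_iff by simp
      then show thesis
      proof
        assume "list_all (\<lambda>k. k \<in> {1, 2}) t"
        then have "m = 2" by (rule ord2)
        show thesis by (rule large[of "[[1, 2], [3, 4], [5, 6], [7, 8]]"]) (use 5 \<open>m = 2\<close> in \<open>simp_all add: numeral_2_eq_2[symmetric]\<close>)
      next
        assume "list_all (\<lambda>k. k \<in> {1, 3}) t"
        then have "m = 3" by (rule ord3)
        show thesis by (rule large[of "[[1, 2, 3], [4, 5, 6]]"]) (use 5 \<open>m = 3\<close> in \<open>simp_all add: numeral_2_eq_2[symmetric]\<close>)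
      qed
    qed
  qed
qed

section \<open>Signatures\<close>

lemma alt_group_commutator:
  assumes "a \<in> carrier (alt_group n)" "b \<in> carrier (alt_group n)"
  shows "group_commutator (alt_group n) a b = inv' a \<circ> inv' b \<circ> a \<circ> b"
  unfolding group_commutator_def alt_group_mult using assms by (simp add: alt_group_inv_equality)

lemma perm_closed_generate:
  assumes "S \<subseteq> carrier (alt_group n)"
  shows "perm_closed (generate (alt_group n) S)"
proof -
  interpret group "alt_group n" by (rule alt_group_is_group)
  have sub: "generate (alt_group n) S \<subseteq> carrier (alt_group n)" by (rule generate_incl[OF assms])
  show ?thesis
    unfolding perm_closed_def
  proof (intro conjI ballI)
    show "id \<in> generate (alt_group n) S" using generate.one[of "alt_group n" S] unfolding alt_group_one .
  next
    fix p assume p: "p \<in> generate (alt_group n) S"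
    then have c: "p \<in> carrier (alt_group n)" using sub by blast
    then show "bij p" using permutes_bij by (auto simp: alt_group_carrier)
    show "inv' p \<in> generate (alt_group n) S"
      using generate_m_inv_closed[OF assms p] alt_group_inv_equality[OF c] by simp
  next
    fix p q assume "p \<in> generate (alt_group n) S" "q \<in> generate (alt_group n) S"
    then have "p \<otimes>\<^bsub>alt_group n\<^esub> q \<in> generate (alt_group n) S" by (rule generate.eng)
    then show "p \<circ> q \<in> generate (alt_group n) S" unfolding alt_group_mult .
  qed
qed

lemma generate_subset_perm_closed:
  assumes "S \<subseteq> carrier (alt_group n)" "perm_closed H" "S \<subseteq> H"
  shows "generate (alt_group n) S \<subseteq> H"
proof
  fix p assume "p \<in> generate (alt_group n) S"
  then show "p \<in> H"
  proof induction
    case one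
    show ?case using perm_closedD(1)[OF assms(2)] unfolding alt_group_one .
  next
    case (incl p)
    then show ?case using assms(3) by blast
  next
    case (inv p)
    then show ?case using alt_group_inv_equality assms(1,3) perm_closedD(3)[OF assms(2)] by (metis subsetD)
  next
    case (eng p q)
    then show ?case using perm_closedD(4)[OF assms(2)] unfolding alt_group_mult by blast
  qed
qed

text \<open>The product relation requires the commutator to be the inverse of the product of the
  elements c_j. Exchanging a and b inverts their commutator, hence the vector starts with b.\<close>

lemma generating_vector_if_gen_commutator:
  assumes gen_commutator: "gen_commutator n (foldr (\<circ>) cs id)" and len: "length cs = length ns" and cs: "set cs \<subseteq> carrier (alt_group n)"
    and ord: "\<forall>j < length ns. group.ord (alt_group n) (cs ! j) = ns ! j"
  shows "\<exists>as bs cs. generating_vector (alt_group n) 1 ns as bs cs"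
proof -
  define D where "D = foldr (\<circ>) cs id"
  obtain a b where ab: "a \<in> carrier (alt_group n)" "b \<in> carrier (alt_group n)" and D: "D = inv' a \<circ> inv' b \<circ> a \<circ> b"
    and gen: "\<And>H. perm_closed H \<Longrightarrow> a \<in> H \<Longrightarrow> b \<in> H \<Longrightarrow> carrier (alt_group n) \<subseteq> H"
    using gen_commutator unfolding gen_commutator_def D_def by blast
  let ?S = "set [b] \<union> set [a] \<union> set cs"
  have S: "?S \<subseteq> carrier (alt_group n)" using ab cs by simp
  have "carrier (alt_group n) \<subseteq> generate (alt_group n) ?S"
    by (rule gen[OF perm_closed_generate[OF S]]) (simp_all add: generate.incl)
  then have full: "generate (alt_group n) ?S = carrier (alt_group n)"
    using group.generate_incl[OF alt_group_is_group S] by blast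
  have bij: "bij a" "bij b" using ab permutes_bij by (auto simp: alt_group_carrier)
  have "inv' b \<circ> inv' a \<circ> b \<circ> a \<circ> D = id"
    unfolding D using bij by (auto simp: fun_eq_iff bij_is_inj bij_is_surj surj_f_inv_f)
  then have "foldr (\<otimes>\<^bsub>alt_group n\<^esub>) (map2 (group_commutator (alt_group n)) [b] [a] @ cs) \<one>\<^bsub>alt_group n\<^esub> = \<one>\<^bsub>alt_group n\<^esub>"
    unfolding alt_group_mult alt_group_one D_def using alt_group_commutator[OF ab(2,1)] by simp
  then have "generating_vector (alt_group n) 1 ns [b] [a] cs"
    unfolding generating_vector_def using S full len ord by simp
  then show ?thesis by blast
qed

text \<open>The list is built from its end, each new element being conjugated suitably. The product
  must stay nontrivial for the next step, and \<open>gen_commutator_neq_id\<close> ensures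
  this.\<close>

lemma gen_commutator_product_list:
  assumes n: "5 \<le> n" and ns: "ns \<noteq> []" "set ns \<subseteq> nontrivial_orders (alt_group n)"
  obtains cs where "length cs = length ns" "set cs \<subseteq> carrier (alt_group n)"
    "\<forall>j < length ns. group.ord (alt_group n) (cs ! j) = ns ! j"
    "foldr (\<circ>) cs id \<in> carrier (alt_group n)" "foldr (\<circ>) cs id \<noteq> id"
    "2 \<le> length ns \<Longrightarrow> gen_commutator n (foldr (\<circ>) cs id)"
  using ns
proof (induction ns arbitrary: thesis rule: list_nonempty_induct)
  case (single m)
  obtain c where c: "c \<in> carrier (alt_group n)" "group.ord (alt_group n) c = m" "m \<noteq> 1"
    using single(2) by (auto simp: nontrivial_orders_def)
  have "c \<noteq> id" using alt_group_ord_eq_1_iff[OF c(1)] c(2,3) by blast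
  then show thesis using c by (intro single(1)[of "[c]"]) (simp_all add: id_def)
next
  case (cons m ns)
  obtain cs where cs: "length cs = length ns" "set cs \<subseteq> carrier (alt_group n)"
    "\<forall>j < length ns. group.ord (alt_group n) (cs ! j) = ns ! j"
    "foldr (\<circ>) cs id \<in> carrier (alt_group n)" "foldr (\<circ>) cs id \<noteq> id"
  proof (rule cons.IH)
    show "set ns \<subseteq> nontrivial_orders (alt_group n)" using cons.prems(2) by simp
  qed (rule that)
  define D where "D = foldr (\<circ>) cs id"
  obtain c where c: "c \<in> carrier (alt_group n)" "group.ord (alt_group n) c = m" "m \<noteq> 1"
    using cons.prems(2) by (auto simp: nontrivial_orders_def)
  have "c \<noteq> id" using alt_group_ord_eq_1_iff[OF c(1)] c(2,3) by blast
  then obtain h where h: "h permutes {1..n}" and gen_commutator: "gen_commutator n (D \<circ> (h \<circ> c \<circ> inv' h))"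
    using product_gen_commutator[OF n cs(4,5) c(1)] unfolding D_def by metis
  define d where "d = h \<circ> c \<circ> inv' h"
  have d: "d \<in> carrier (alt_group n)" "group.ord (alt_group n) d = m"
    unfolding d_def using alt_group_conj[OF c(1) h] alt_group_ord_conj[OF c(1) h] c(2) by simp_all
  then have dp: "d permutes {1..n}" by (simp add: alt_group_carrier)
  \<comment> \<open>The conjugate d was chosen for the product D d, but the list is extended at the
    front; conjugation by d converts D d into d D.\<close>
  have "gen_commutator n (d \<circ> (D \<circ> d) \<circ> inv' d)" using gen_commutator_conj[OF gen_commutator dp] h unfolding d_def by blast
  moreover have "d \<circ> (D \<circ> d) \<circ> inv' d = d \<circ> D"
    using permutes_bij[OF dp] by (auto simp: fun_eq_iff bij_is_surj surj_f_inv_f)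
  ultimately have g: "gen_commutator n (d \<circ> D)" by simp
  have car: "d \<circ> D \<in> carrier (alt_group n)"
    using monoid.m_closed[OF group.is_monoid[OF alt_group_is_group] d(1) cs(4)] unfolding alt_group_mult D_def .
  have prod: "foldr (\<circ>) (d # cs) id = d \<circ> D" by (simp only: foldr.simps o_apply D_def)
  show thesis
  proof (rule cons.prems(1)[of "d # cs", unfolded prod])
    show "\<forall>j < length (m # ns). group.ord (alt_group n) ((d # cs) ! j) = (m # ns) ! j"
      using cs(3) d(2) by (auto simp: nth_Cons split: nat.splits)
    show "d \<circ> D \<noteq> id" using gen_commutator_neq_id[OF g] n by linarith
  qed (use cs(1,2) d(1) in \<open>simp_all del: o_apply\<close>, rule car, rule g)
qed

text \<open>This rules out the empty list of periods, since a potential signature has genus at least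
  2.\<close>

lemma signature_genus_torus: "signature_genus G 1 [] = 1"
  by (simp add: signature_genus_def)

lemma actual_signature_alt_group:
  assumes n: "5 \<le> n" and pot: "potential_signature (alt_group n) 1 ns"
    and "\<not> (n = 5 \<and> ns = [2])" "\<not> (n = 6 \<and> ns = [3])"
  shows "actual_signature (alt_group n) 1 ns"
proof -
  have sub: "set ns \<subseteq> nontrivial_orders (alt_group n)" and ne: "ns \<noteq> []"
    using pot signature_genus_torus[of "alt_group n"] by (auto simp: potential_signature_def)
  have "\<exists>as bs cs. generating_vector (alt_group n) 1 ns as bs cs"
  proof (cases "length ns = 1")
    case True
    then obtain m where m: "ns = [m]" by (auto simp: length_Suc_conv)
    obtain c where c: "c \<in> carrier (alt_group n)" "group.ord (alt_group n) c = m" "gen_commutator n c"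
      by (rule gen_commutator_of_order[OF n, of m]) (use sub assms(3,4) m in auto)
    then show ?thesis by (intro generating_vector_if_gen_commutator[of n "[c]"]) (simp_all add: m)
  next
    case False
    then have "2 \<le> length ns" using ne by (cases ns) (auto simp: Suc_le_eq)
    then show ?thesis using gen_commutator_product_list[OF n ne sub] generating_vector_if_gen_commutator by metis
  qed
  then show ?thesis using pot by (simp add: actual_signature_def)
qed

text \<open>The relation makes c the inverse of the commutator of a and b, so c lies in every closed
  set that contains a and b and cannot help to generate the group.\<close>

lemma not_actual_signature_if_refutation:
  assumes R: "refutation n k R" and n: "3 \<le> n" and k: "k \<noteq> 1"
  shows "\<not> actual_signature (alt_group n) 1 [k]"
proof
  assume "actual_signature (alt_group n) 1 [k]"
  then obtain as bs cs where gv: "generating_vector (alt_group n) 1 [k] as bs cs"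
    by (auto simp: actual_signature_def)
  then obtain a b c where eq: "as = [a]" "bs = [b]" "cs = [c]"
    unfolding generating_vector_def by (metis One_nat_def length_0_conv length_Suc_conv)
  have car: "a \<in> carrier (alt_group n)" "b \<in> carrier (alt_group n)" "c \<in> carrier (alt_group n)"
    and gen: "generate (alt_group n) {a, b, c} = carrier (alt_group n)"
    and ord: "group.ord (alt_group n) c = k"
    and rel: "group_commutator (alt_group n) a b \<circ> c = id"
    using gv unfolding generating_vector_def eq by (auto simp: alt_group_mult alt_group_one insert_commute)
  define d where "d = inv' a \<circ> inv' b \<circ> a \<circ> b"
  have dc: "d \<circ> c = id" using rel alt_group_commutator[OF car(1,2)] by (simp add: d_def)
  have bc: "bij c" using car(3) permutes_bij by (auto simp: alt_group_carrier)
  have "d = d \<circ> c \<circ> inv' c" using bc by (auto simp: fun_eq_iff bij_is_surj surj_f_inv_f)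
  then have d: "d = inv' c" using dc by simp
  have c: "c = inv' d" unfolding d using inv_inv_eq[OF bc] by simp
  have "c \<noteq> id" using alt_group_ord_eq_1_iff[OF car(3)] ord k by blast
  then have "d \<noteq> id" using c inv_id by metis
  have ck: "c ^^ k = id" using alt_group_ord_dvd_iff[OF car(3), of k] ord by simp
  have "d \<circ> c = c \<circ> d" unfolding d using bc by (auto simp: fun_eq_iff bij_is_inj bij_is_surj surj_f_inv_f)
  from funpow_comp_commute[OF this, of k] have "d ^^ k = id" using dc ck by simp
  with \<open>d \<noteq> id\<close> obtain H where H: "perm_closed H" "a \<in> H" "b \<in> H" "\<not> carrier (alt_group n) \<subseteq> H"
    using refutation_subgroup[OF R n car(1,2) d_def] by metis
  then have "d \<in> H" unfolding d_def using perm_closedD(3,4) by metis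
  then have "c \<in> H" unfolding c by (rule perm_closedD(3)[OF H(1)])
  then have "generate (alt_group n) {a, b, c} \<subseteq> H"
    using generate_subset_perm_closed[OF _ H(1), of "{a, b, c}"] H(2,3) car by blast
  then show False using gen H(4) by blast
qed

lemma potential_signature_5: "potential_signature (alt_group 5) 1 [2]"
proof -
  let ?css = "[[1, 2], [3, 4]] :: nat list list"
  have c: "cycs ?css \<in> carrier (alt_group 5)"
    using permutes_subset[OF cycs_permutes[of ?css], of "{1..5}"] evenperm_cycs[of ?css]
    by (simp add: alt_group_carrier)
  have "group.ord (alt_group 5) (cycs ?css) = 2"
    by (rule cycs_prime_order[OF c, of _ "[1, 2]"]) (simp_all add: numeral_2_eq_2[symmetric])
  then have "2 \<in> nontrivial_orders (alt_group 5)" using c by (force simp: nontrivial_orders_def)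
  moreover have "order (alt_group 5) = 60"
    using alt_group_card_carrier[of 5] by (simp add: order_def fact_numeral)
  ultimately show ?thesis by (simp add: potential_signature_def signature_genus_def)
qed

lemma potential_signature_6: "potential_signature (alt_group 6) 1 [3]"
proof -
  let ?css = "[[1, 2, 3]] :: nat list list"
  have c: "cycs ?css \<in> carrier (alt_group 6)"
    using permutes_subset[OF cycs_permutes[of ?css], of "{1..6}"] evenperm_cycs[of ?css]
    by (simp add: alt_group_carrier)
  have "group.ord (alt_group 6) (cycs ?css) = 3"
    by (rule cycs_prime_order[OF c, of _ "[1, 2, 3]"]) (simp_all add: numeral_2_eq_2[symmetric])
  then have "3 \<in> nontrivial_orders (alt_group 6)" using c by (force simp: nontrivial_orders_def)
  moreover have "order (alt_group 6) = 360"
    using alt_group_card_carrier[of 6] by (simp add: order_def fact_numeral)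
  ultimately show ?thesis by (simp add: potential_signature_def signature_genus_def)
qed

theorem theorem1p3:
  shows "(\<forall>n ns. n > 6 \<and> potential_signature (alt_group n) 1 ns
            \<longrightarrow> actual_signature (alt_group n) 1 ns)
       \<and> {ns. potential_signature (alt_group 5) 1 ns
              \<and> \<not> actual_signature (alt_group 5) 1 ns} = {[2]}
       \<and> {ns. potential_signature (alt_group 6) 1 ns
              \<and> \<not> actual_signature (alt_group 6) 1 ns} = {[3]}"
proof (intro conjI allI impI)
  fix n ns assume "6 < n \<and> potential_signature (alt_group n) 1 ns"
  then show "actual_signature (alt_group n) 1 ns" by (intro actual_signature_alt_group) simp_all
next
  have "ns = [2]" if "potential_signature (alt_group 5) 1 ns" "\<not> actual_signature (alt_group 5) 1 ns" for ns
    using actual_signature_alt_group[OF _ that(1)] that(2) by fastforce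
  moreover have "\<not> actual_signature (alt_group 5) 1 [2]"
    by (rule not_actual_signature_if_refutation[OF refutation_5]) simp_all
  ultimately show "{ns. potential_signature (alt_group 5) 1 ns \<and> \<not> actual_signature (alt_group 5) 1 ns} = {[2]}"
    using potential_signature_5 by blast
next
  have "ns = [3]" if "potential_signature (alt_group 6) 1 ns" "\<not> actual_signature (alt_group 6) 1 ns" for ns
    using actual_signature_alt_group[OF _ that(1)] that(2) by fastforce
  moreover have "\<not> actual_signature (alt_group 6) 1 [3]"
    by (rule not_actual_signature_if_refutation[OF refutation_6]) simp_all
  ultimately show "{ns. potential_signature (alt_group 6) 1 ns \<and> \<not> actual_signature (alt_group 6) 1 ns} = {[3]}"
    using potential_signature_6 by blast
qed

end
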